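(* Let $\Sigma$ be a closed horo-convex hypersurface in hyperbolic space $\mathbb{H}^{n+1}$, enclosing the domain $\Omega$, with the origin lying inside $\Omega$. Let $\lambda'(r)=\cosh r$, where $r$ is the distance to the origin. Then $$\int_\Sigma\lambda'\,d\mu\ \ge\ \left[\left((n+1)\int_\Omega\lambda'\,dN\right)^2+|\mathbb{S}^n|^{\frac{2}{n+1}}\left((n+1)\int_\Omega\lambda'\,dN\right)^{\frac{2n}{n+1}}\right]^{\frac12}.$$ Equality holds if and only if $\Sigma$ is a geodesic sphere centered at the origin.
   Context: $\mathbb{H}^{n+1}$ is hyperbolic space of constant curvature $-1$, written in geodesic polar coordinates around a fixed origin as $dr^2+\lambda^2(r)\sigma$ with $\lambda(r)=\sinh r$ and $\sigma$ the round metric on $\mathbb{S}^n$. A hypersurface of hyperbolic space is horo-convex if all its principal curvatures (with respect to the outward unit normal, with the sign for which geodesic spheres have positive principal curvatures) are greater than or equal to $1$. $d\mu$ is the area element of $\Sigma$, $dN$ the volume element of $\mathbb{H}^{n+1}$, and $|\mathbb{S}^n|$ is the area of the round unit sphere. *)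

theory Defs
  imports "HOL-Analysis.Analysis"
begin

text \<open>
  Hyperbolic space \<open>H^m\<close> of constant curvature \<open>-1\<close> is the upper sheet of the unit hyperboloid in
  Minkowski space \<open>R^m \<times> R\<close>, with the Riemannian metric induced by the Lorentz form
  \<open>mink\<close>.
\<close>

definition mink :: "('a::real_inner \<times> real) \<Rightarrow> ('a \<times> real) \<Rightarrow> real" where
  "mink p q = fst p \<bullet> fst q - snd p * snd q"

definition hyp_space :: "('a::real_inner \<times> real) set" where
  "hyp_space = {p. mink p p = -1 \<and> snd p > 0}"

definition hyp_origin :: "'a::real_inner \<times> real" where
  "hyp_origin = (0, 1)"

definition hyp_dist :: "('a::real_inner \<times> real) \<Rightarrow> ('a \<times> real) \<Rightarrow> real" where
  "hyp_dist p q = arcosh (- mink p q)"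

definition geodesic_sphere :: "('a::real_inner \<times> real) \<Rightarrow> real \<Rightarrow> ('a \<times> real) set" where
  "geodesic_sphere p R = {q \<in> hyp_space. hyp_dist p q = R}"

text \<open>
  Geodesic polar coordinates around the origin. The lemmas below show that they cover the whole
  space, that the coordinate \<open>r\<close> is the distance to the origin, and that in them the metric is
  \<open>dr\<^sup>2 + (sinh r)\<^sup>2 \<sigma>\<close>, with \<open>\<sigma>\<close> the round metric.
\<close>

definition polar :: "real \<Rightarrow> 'a::real_inner \<Rightarrow> 'a \<times> real" where
  "polar r \<theta> = (sinh r *\<^sub>R \<theta>, cosh r)"

lemma polar_in_hyp_space:
  assumes "norm \<theta> = 1"
  shows "polar r \<theta> \<in> hyp_space"
proof -
  have "\<theta> \<bullet> \<theta> = 1"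
    using assms by (simp add: dot_square_norm)
  then show ?thesis
    using cosh_square_eq[of r] by (simp add: hyp_space_def polar_def mink_def power2_eq_square)
qed

lemma hyp_dist_origin_polar:
  fixes \<theta> :: "'a::real_inner"
  assumes "r \<ge> 0"
  shows "hyp_dist hyp_origin (polar r \<theta>) = r"
  using assms by (simp add: hyp_dist_def hyp_origin_def polar_def mink_def arcosh_cosh_real)

lemma hyp_space_polar:
  fixes p :: "'a::euclidean_space \<times> real"
  assumes "p \<in> hyp_space"
  obtains r \<theta> where "r \<ge> 0" "norm \<theta> = 1" "p = polar r \<theta>"
proof -
  obtain \<theta> :: 'a where \<theta>: "norm \<theta> = 1" "fst p = norm (fst p) *\<^sub>R \<theta>"
  proof (cases "fst p = 0")
    case True
    then show ?thesis using that[of "SOME i. i \<in> Basis"] by (simp add: SOME_Basis)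
  next
    case False
    then show ?thesis using that[of "fst p /\<^sub>R norm (fst p)"] by simp
  qed
  define r where "r = arsinh (norm (fst p))"
  have s: "sinh r = norm (fst p)" by (simp add: r_def)
  then have "r \<ge> 0" using sinh_real_nonneg_iff[of r] by simp
  have "(cosh r)\<^sup>2 = (snd p)\<^sup>2"
    using assms s cosh_square_eq[of r]
    by (simp add: hyp_space_def mink_def power2_eq_square dot_square_norm)
  then have "cosh r = snd p"
    using assms by (simp add: hyp_space_def power2_eq_iff_nonneg)
  with s \<theta> have "p = polar r \<theta>" by (simp add: polar_def prod_eq_iff)
  with \<open>r \<ge> 0\<close> \<theta> that show ?thesis by blast
qed

lemma polar_metric:
  fixes \<theta> :: "real \<Rightarrow> 'a::real_inner"
  assumes "\<And>t. norm (\<theta> t) = 1"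
    and r: "(r has_real_derivative r') (at t)"
    and \<theta>: "(\<theta> has_vector_derivative w) (at t)"
  obtains v where "((\<lambda>t. polar (r t) (\<theta> t)) has_vector_derivative v) (at t)"
    and "mink v v = r'\<^sup>2 + (sinh (r t))\<^sup>2 * (w \<bullet> w)"
proof
  have one: "\<theta> t \<bullet> \<theta> t = 1" for t
    using assms(1) by (simp add: dot_square_norm)
  have "((\<lambda>t. \<theta> t \<bullet> \<theta> t) has_derivative (\<lambda>h. \<theta> t \<bullet> (h *\<^sub>R w) + (h *\<^sub>R w) \<bullet> \<theta> t)) (at t)"
    using \<theta> unfolding has_vector_derivative_def by (intro has_derivative_inner)
  moreover have "((\<lambda>t. \<theta> t \<bullet> \<theta> t) has_derivative (\<lambda>h. 0)) (at t)"
    by (simp add: one)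
  ultimately have "(\<lambda>h. \<theta> t \<bullet> (h *\<^sub>R w) + (h *\<^sub>R w) \<bullet> \<theta> t) = (\<lambda>h. 0)"
    by (rule has_derivative_unique)
  then have "\<theta> t \<bullet> (1 *\<^sub>R w) + (1 *\<^sub>R w) \<bullet> \<theta> t = 0" by metis
  then have orth: "\<theta> t \<bullet> w = 0" by (simp add: inner_commute)
  let ?v = "(sinh (r t) *\<^sub>R w + (cosh (r t) * r') *\<^sub>R \<theta> t, sinh (r t) * r')"
  have "((\<lambda>t. sinh (r t)) has_real_derivative cosh (r t) * r') (at t)"
    and c: "((\<lambda>t. cosh (r t)) has_real_derivative sinh (r t) * r') (at t)"
    using r by (auto intro!: derivative_eq_intros)
  then show "((\<lambda>t. polar (r t) (\<theta> t)) has_vector_derivative ?v) (at t)"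
    unfolding polar_def using \<theta>
    by (intro has_vector_derivative_Pair has_vector_derivative_scaleR)
       (simp_all add: has_real_derivative_iff_has_vector_derivative)
  have "mink ?v ?v = (sinh (r t))\<^sup>2 * (w \<bullet> w) + ((cosh (r t))\<^sup>2 - (sinh (r t))\<^sup>2) * r'\<^sup>2"
    using orth one[of t]
    by (simp add: mink_def inner_add_left inner_add_right inner_commute[of w "\<theta> t"]
        power2_eq_square left_diff_distrib)
  then show "mink ?v ?v = r'\<^sup>2 + (sinh (r t))\<^sup>2 * (w \<bullet> w)"
    by (simp add: cosh_square_eq)
qed

text \<open>\<open>C\<^sup>k\<close> maps on an open set \<open>U\<close>.\<close>

primrec Ck_on :: "nat \<Rightarrow> ('a::euclidean_space \<Rightarrow> 'b::real_normed_vector) \<Rightarrow> 'a set \<Rightarrow> bool" where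
  "Ck_on 0 f U = continuous_on U f"
| "Ck_on (Suc k) f U =
     (f differentiable_on U \<and> (\<forall>v. Ck_on k (\<lambda>x. frechet_derivative f (at x) v) U))"

text \<open>
  A regular \<open>C\<^sup>2\<close> parametrization of a relatively open piece of \<open>M\<close>, as in the definition of an
  embedded submanifold. The dimension of \<open>M\<close> is that of the parameter domain; it is passed as
  a type argument where it cannot be inferred.
\<close>

definition patch :: "'e::euclidean_space set \<Rightarrow> (real^'k) set \<Rightarrow> (real^'k \<Rightarrow> 'e) \<Rightarrow> bool" where
  "patch M U \<phi> \<longleftrightarrow>
     open U \<and> Ck_on 2 \<phi> U \<and> (\<forall>x\<in>U. inj (frechet_derivative \<phi> (at x))) \<and>
     openin (top_of_set M) (\<phi> ` U) \<and> (\<exists>\<psi>. homeomorphism U (\<phi> ` U) \<phi> \<psi>)"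

definition submanifold :: "'k::finite itself \<Rightarrow> 'e::euclidean_space set \<Rightarrow> bool" where
  "submanifold _ M \<longleftrightarrow> (\<forall>p\<in>M. \<exists>(U :: (real^'k) set) \<phi>. patch M U \<phi> \<and> p \<in> \<phi> ` U)"

definition tangent_space :: "'k::finite itself \<Rightarrow> 'e::euclidean_space set \<Rightarrow> 'e \<Rightarrow> 'e set" where
  "tangent_space _ M p =
     {frechet_derivative \<phi> (at x) a | (U :: (real^'k) set) \<phi> x a. patch M U \<phi> \<and> x \<in> U \<and> \<phi> x = p}"

text \<open>
  The Riemannian measure of a submanifold \<open>M\<close> on which the bilinear form \<open>B\<close> restricts to a
  Riemannian metric \<open>g\<close>: the Borel measure given in every local parametrization by
  \<open>sqrt (det g\<^sub>i\<^sub>j) dx\<^sub>1 \<dots> dx\<^sub>k\<close>. Since \<open>M\<close> is covered by countably many patches there is at most one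
  such measure, and its existence is the change of variables formula.
\<close>

definition gram_det :: "('e \<Rightarrow> 'e \<Rightarrow> real) \<Rightarrow> (real^'k \<Rightarrow> 'e::euclidean_space) \<Rightarrow> real^'k \<Rightarrow> real" where
  "gram_det B \<phi> x =
     det (\<chi> i j. B (frechet_derivative \<phi> (at x) (axis i 1)) (frechet_derivative \<phi> (at x) (axis j 1)))"

definition riemannian_measure ::
    "'k::finite itself \<Rightarrow> ('e \<Rightarrow> 'e \<Rightarrow> real) \<Rightarrow> 'e::euclidean_space set \<Rightarrow> 'e measure \<Rightarrow> bool" where
  "riemannian_measure _ B M \<mu> \<longleftrightarrow>
     space \<mu> = M \<and> sets \<mu> = sets (restrict_space borel M) \<and>
     (\<forall>(U :: (real^'k) set) \<phi> A. patch M U \<phi> \<and> A \<in> sets borel \<and> A \<subseteq> U \<longrightarrow>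
        emeasure \<mu> (\<phi> ` A) = (\<integral>\<^sup>+ x\<in>A. ennreal (sqrt (gram_det B \<phi> x)) \<partial>lborel))"

definition closed_hypersurface ::
    "'n::finite itself \<Rightarrow> ((real^'m) \<times> real) set \<Rightarrow> bool" where
  "closed_hypersurface n \<Sigma> \<longleftrightarrow> \<Sigma> \<subseteq> hyp_space \<and> compact \<Sigma> \<and> submanifold n \<Sigma>"

text \<open>
  The height \<open>snd q\<close> is \<open>cosh\<close> of the distance to the origin, so boundedness in the ambient
  vector space is boundedness for the hyperbolic distance.
\<close>

definition encloses :: "((real^'m) \<times> real) set \<Rightarrow> ((real^'m) \<times> real) set \<Rightarrow> bool" where
  "encloses \<Sigma> \<Omega> \<longleftrightarrow>
     openin (top_of_set hyp_space) \<Omega> \<and> connected \<Omega> \<and> bounded \<Omega> \<and>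
     top_of_set hyp_space frontier_of \<Omega> = \<Sigma>"

text \<open>
  \<open>t \<mapsto> cosh t p + sinh t v\<close> is the geodesic of hyperbolic space starting at \<open>p\<close> with unit
  velocity \<open>v\<close>.
\<close>

definition outward_unit_normal ::
    "'n::finite itself \<Rightarrow> ((real^'m) \<times> real) set \<Rightarrow> ((real^'m) \<times> real) set \<Rightarrow>
     ((real^'m) \<times> real \<Rightarrow> (real^'m) \<times> real) \<Rightarrow> bool" where
  "outward_unit_normal n \<Sigma> \<Omega> \<nu> \<longleftrightarrow>
     (\<forall>(U :: (real^'n) set) \<phi>. patch \<Sigma> U \<phi> \<longrightarrow> Ck_on 1 (\<nu> \<circ> \<phi>) U) \<and>
     (\<forall>p\<in>\<Sigma>. mink (\<nu> p) p = 0 \<and> mink (\<nu> p) (\<nu> p) = 1 \<and>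
        (\<forall>v\<in>tangent_space n \<Sigma> p. mink (\<nu> p) v = 0) \<and>
        (\<exists>\<epsilon>>0. \<forall>t. 0 < t \<and> t < \<epsilon> \<longrightarrow> cosh t *\<^sub>R p + sinh t *\<^sub>R \<nu> p \<notin> closure \<Omega>))"

text \<open>
  Principal curvatures are the eigenvalues of the shape operator \<open>v \<mapsto> \<nabla>\<^sub>v \<nu>\<close>. The Levi-Civita
  derivative \<open>\<nabla>\<^sub>v \<nu>\<close> is the projection of the ambient derivative \<open>D\<^sub>v \<nu>\<close> to the tangent space of the
  hyperboloid at \<open>p\<close>; as \<open>mink \<nu> p = 0\<close> along the hypersurface, \<open>mink (D\<^sub>v \<nu>) p = - mink \<nu> v = 0\<close>,
  so that no projection is needed. With this sign and the outward normal, a geodesic sphere of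
  radius \<open>R\<close> has principal curvatures \<open>coth R\<close>.
\<close>

definition principal_curvature ::
    "'n::finite itself \<Rightarrow> ((real^'m) \<times> real) set \<Rightarrow> ((real^'m) \<times> real \<Rightarrow> (real^'m) \<times> real) \<Rightarrow>
     (real^'m) \<times> real \<Rightarrow> real \<Rightarrow> bool" where
  "principal_curvature _ \<Sigma> \<nu> p \<kappa> \<longleftrightarrow>
     (\<exists>(U :: (real^'n) set) \<phi> x a. patch \<Sigma> U \<phi> \<and> x \<in> U \<and> \<phi> x = p \<and> a \<noteq> 0 \<and>
        frechet_derivative (\<nu> \<circ> \<phi>) (at x) a = \<kappa> *\<^sub>R frechet_derivative \<phi> (at x) a)"

definition horo_convex ::
    "'n::finite itself \<Rightarrow> ((real^'m) \<times> real) set \<Rightarrow> ((real^'m) \<times> real) set \<Rightarrow> bool" where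
  "horo_convex n \<Sigma> \<Omega> \<longleftrightarrow>
     (\<exists>\<nu>. outward_unit_normal n \<Sigma> \<Omega> \<nu> \<and>
        (\<forall>p\<in>\<Sigma>. \<forall>\<kappa>. principal_curvature n \<Sigma> \<nu> p \<kappa> \<longrightarrow> \<kappa> \<ge> 1))"

end

theory Submission
  imports Defs
begin

text \<open>
  Projecting the hyperboloid orthogonally to \<open>R\<^sup>m\<close>, where \<open>m = n + 1\<close>, turns both sides of the
  inequality into Euclidean quantities. Write \<open>p = (x, x\<^sub>0)\<close> for a point of \<open>\<Sigma>\<close>, \<open>\<nu> = (y, y\<^sub>0)\<close> for its
  unit normal, \<open>D\<close> for the projection of \<open>\<Omega>\<close>, and note that \<open>x\<^sub>0\<close> is the hyperbolic cosine of the distance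
  to the origin. The volume element of the hyperboloid over \<open>x\<close> is \<open>dx / x\<^sub>0\<close>, so the weighted volume of
  \<open>\<Omega>\<close> is the Lebesgue measure of \<open>D\<close>. The projected hypersurface has the Euclidean area element
  \<open>w d\<mu>\<close> with \<open>w = sqrt (x\<^sub>0\<^sup>2 - y\<^sub>0\<^sup>2)\<close>, and its support function \<open>x \<bullet> N\<close>, where \<open>N\<close> is the Euclidean
  unit normal, is \<open>y\<^sub>0 / w\<close>. Hence \<open>x\<^sub>0\<^sup>2 = w\<^sup>2 + y\<^sub>0\<^sup>2\<close>, and for constants with \<open>a\<^sup>2 + b\<^sup>2 = 1\<close> the
  Cauchy-Schwarz inequality gives

  \<open>\<integral> x\<^sub>0 d\<mu> \<ge> a \<integral> w d\<mu> + b \<integral> \<bar>y\<^sub>0\<bar> d\<mu>\<close>.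

  Two bounds finish the proof. Let \<open>B\<close> be the unit ball. The flux of the position vector satisfies
  \<open>\<integral> \<bar>y\<^sub>0\<bar> d\<mu> \<ge> V = m \<bar>D\<bar>\<close> (\<open>position_flux_ge_volume\<close>, half of the divergence theorem), and the
  Euclidean isoperimetric inequality says \<open>\<integral> w d\<mu> \<ge> P = m \<bar>B\<bar>\<^bsup>1/m\<^esup> \<bar>D\<bar>\<^bsup>n/m\<^esup>\<close> (\<open>area_ge_isoperimetric\<close>).
  The choice of \<open>(a, b)\<close> proportional to \<open>(P, V)\<close> yields \<open>\<integral> x\<^sub>0 d\<mu> \<ge> sqrt (V\<^sup>2 + P\<^sup>2)\<close>, which is
  the claim because the area of the unit sphere is at most \<open>m \<bar>B\<bar>\<close>.

  Both bounds are statements about first variations. If the points of the hypersurface are moved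
  along a vector field \<open>X\<close> for all times \<open>s\<close> in \<open>[-t, t]\<close>, the change of variables formula bounds the
  volume swept out by \<open>2 t \<integral> \<bar>det (X, df)\<bar> + o(t)\<close> for local parametrizations \<open>f\<close>
  (\<open>thin_tube_cover\<close>, \<open>first_variation_bound\<close>). When \<open>X\<close> is the position vector, this set contains
  \<open>(1 + t) D\<close> without \<open>(1 - t) D\<close>. When \<open>X = N\<close>, it contains the two-sided \<open>t\<close>-neighbourhood of the
  frontier of \<open>D\<close>, whose volume the Brunn-Minkowski inequality bounds from below, once for the outer
  and once for the inner parallel set of \<open>D\<close>.

  Equality forces \<open>\<bar>y\<^sub>0\<bar> = b x\<^sub>0\<close> on \<open>\<Sigma>\<close>, so \<open>\<bar>x \<bullet> N\<bar>\<close> is constant. Where \<open>\<bar>x\<bar>\<close> is largest or smallest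
  \<open>x\<close> is a multiple of \<open>N\<close>, so the largest and the smallest value of \<open>\<bar>x\<bar>\<close> agree, \<open>D\<close> is a ball
  around \<open>0\<close>, and \<open>\<Sigma>\<close> is a geodesic sphere around the origin. For geodesic spheres both sides are
  computed by scaling the unit sphere.
\<close>

section \<open>The Brunn-Minkowski inequality\<close>

definition sumset :: "'a::ab_group_add set \<Rightarrow> 'a set \<Rightarrow> 'a set" where
  "sumset A B = (\<Union>x\<in>A. \<Union>y\<in>B. {x + y})"

lemma sumset_commute: "sumset A B = sumset B A"
  by (auto simp: sumset_def add.commute)

lemma sumset_mono: "A \<subseteq> A' \<Longrightarrow> B \<subseteq> B' \<Longrightarrow> sumset A B \<subseteq> sumset A' B'"
  by (auto simp: sumset_def)

lemma open_sumset: "open A \<Longrightarrow> open (sumset A (B::'a::real_normed_vector set))"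
  unfolding sumset_def by (rule open_sums) simp

lemma bounded_sumset: "bounded A \<Longrightarrow> bounded B \<Longrightarrow> bounded (sumset A (B::'a::real_normed_vector set))"
  unfolding sumset_def by (rule bounded_sums)

lemma lmeasurable_open_bounded: "open A \<Longrightarrow> bounded A \<Longrightarrow> (A::'a::euclidean_space set) \<in> lmeasurable"
  by (simp add: bounded_set_imp_lmeasurable borel_open)

text \<open>
  Dividing by the right-hand side reduces the claim to the arithmetic-geometric mean inequality for
  the numbers \<open>p i / (p i + q i)\<close> and for \<open>q i / (p i + q i)\<close>, whose means add up to \<open>1\<close>. It is the
  Brunn-Minkowski inequality for two boxes with edge lengths \<open>p\<close> and \<open>q\<close>.
\<close>

lemma geometric_mean_superadditive:
  fixes p q :: "'a \<Rightarrow> real"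
  assumes "finite S" "S \<noteq> {}" "\<And>i. i \<in> S \<Longrightarrow> p i > 0" "\<And>i. i \<in> S \<Longrightarrow> q i > 0"
  shows "(root (card S) (\<Prod>i\<in>S. p i) + root (card S) (\<Prod>i\<in>S. q i)) ^ card S \<le> (\<Prod>i\<in>S. p i + q i)"
proof -
  let ?m = "card S"
  have m: "?m > 0" using assms by (simp add: card_gt_0_iff)
  have amgm: "root ?m (\<Prod>i\<in>S. f i) \<le> (\<Sum>i\<in>S. f i / ?m)" if "\<And>i. i \<in> S \<Longrightarrow> f i > 0" for f :: "'a \<Rightarrow> real"
  proof -
    have "(\<Prod>i\<in>S. f i) > 0" using that by (intro prod_pos) auto
    moreover have "(\<Prod>i\<in>S. f i) powr (1 / ?m) \<le> (\<Sum>i\<in>S. f i / ?m)"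
      by (rule arith_geom_mean) (use assms that in \<open>auto intro: less_imp_le\<close>)
    ultimately show ?thesis using m by (simp add: root_powr_inverse)
  qed
  let ?P = "\<Prod>i\<in>S. p i + q i"
  have Ppos: "?P > 0" using assms by (intro prod_pos) (auto intro: add_pos_pos)
  have "root ?m (\<Prod>i\<in>S. p i / (p i + q i)) + root ?m (\<Prod>i\<in>S. q i / (p i + q i))
      \<le> (\<Sum>i\<in>S. p i / (p i + q i) / ?m) + (\<Sum>i\<in>S. q i / (p i + q i) / ?m)"
    by (intro add_mono amgm divide_pos_pos add_pos_pos assms)
  also have "\<dots> = (\<Sum>i\<in>S. 1 / ?m)"
    unfolding sum.distrib[symmetric]
  proof (rule sum.cong)
    fix i assume "i \<in> S"
    then have "p i + q i \<noteq> 0" using assms(3,4)[of i] by auto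
    then show "p i / (p i + q i) / ?m + q i / (p i + q i) / ?m = 1 / ?m"
      by (simp add: add_divide_distrib[symmetric])
  qed simp
  also have "\<dots> = 1" using m by simp
  finally have "root ?m (\<Prod>i\<in>S. p i) / root ?m ?P + root ?m (\<Prod>i\<in>S. q i) / root ?m ?P \<le> 1"
    by (simp add: prod_dividef real_root_divide)
  moreover have "root ?m ?P > 0" using Ppos m by simp
  ultimately have "root ?m (\<Prod>i\<in>S. p i) + root ?m (\<Prod>i\<in>S. q i) \<le> root ?m ?P"
    by (simp add: add_divide_distrib[symmetric] divide_le_eq)
  moreover have "0 \<le> root ?m (\<Prod>i\<in>S. p i) + root ?m (\<Prod>i\<in>S. q i)"
    by (intro add_nonneg_nonneg real_root_ge_zero prod_nonneg) (use assms in \<open>auto intro: less_imp_le\<close>)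
  ultimately have "(root ?m (\<Prod>i\<in>S. p i) + root ?m (\<Prod>i\<in>S. q i)) ^ ?m \<le> root ?m ?P ^ ?m"
    by (rule power_mono)
  then show ?thesis using Ppos m by simp
qed

lemma box_plus_box:
  fixes a b c d :: "'a::euclidean_space"
  assumes "box a b \<noteq> {}" "box c d \<noteq> {}"
  shows "box (a + c) (b + d) \<subseteq> sumset (box a b) (box c d)"
proof
  fix x assume x: "x \<in> box (a + c) (b + d)"
  define t where "t i = (x \<bullet> i - (a + c) \<bullet> i) / ((b + d) \<bullet> i - (a + c) \<bullet> i)" for i
  define y where "y = (\<Sum>i\<in>Basis. (a \<bullet> i + t i * (b \<bullet> i - a \<bullet> i)) *\<^sub>R i)"
  have ab: "a \<bullet> i < b \<bullet> i" "c \<bullet> i < d \<bullet> i" if "i \<in> Basis" for i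
    using assms that by (auto simp: box_ne_empty)
  have yi: "y \<bullet> i = a \<bullet> i + t i * (b \<bullet> i - a \<bullet> i)" if "i \<in> Basis" for i
    using that by (simp add: y_def)
  have t: "0 < t i" "t i < 1" if "i \<in> Basis" for i
    using x that ab[OF that] unfolding t_def mem_box
    by (auto simp: inner_add_left divide_less_eq intro!: divide_pos_pos)
  have xi: "x \<bullet> i = a \<bullet> i + c \<bullet> i + t i * (b \<bullet> i - a \<bullet> i) + t i * (d \<bullet> i - c \<bullet> i)" if "i \<in> Basis" for i
  proof -
    have "t i * ((b + d) \<bullet> i - (a + c) \<bullet> i) = x \<bullet> i - (a + c) \<bullet> i"
      using ab[OF that] by (simp add: t_def inner_add_left)
    then show ?thesis by (simp add: inner_add_left algebra_simps)
  qed
  have "y \<in> box a b" unfolding mem_box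
  proof
    fix i assume i: "i \<in> (Basis::'a set)"
    have "t i * (b \<bullet> i - a \<bullet> i) < 1 * (b \<bullet> i - a \<bullet> i)"
      using t[OF i] ab[OF i] by (intro mult_strict_right_mono) auto
    moreover have "0 < t i * (b \<bullet> i - a \<bullet> i)" using t[OF i] ab[OF i] by simp
    ultimately show "a \<bullet> i < y \<bullet> i \<and> y \<bullet> i < b \<bullet> i" using yi[OF i] by simp
  qed
  moreover have "x - y \<in> box c d" unfolding mem_box
  proof
    fix i assume i: "i \<in> (Basis::'a set)"
    have "t i * (d \<bullet> i - c \<bullet> i) < 1 * (d \<bullet> i - c \<bullet> i)"
      using t[OF i] ab[OF i] by (intro mult_strict_right_mono) auto
    moreover have "0 < t i * (d \<bullet> i - c \<bullet> i)" using t[OF i] ab[OF i] by simp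
    ultimately show "c \<bullet> i < (x - y) \<bullet> i \<and> (x - y) \<bullet> i < d \<bullet> i"
      using xi[OF i] yi[OF i] by (simp add: inner_diff_left)
  qed
  ultimately show "x \<in> sumset (box a b) (box c d)"
    unfolding sumset_def by (intro UN_I[of y] UN_I[of "x - y"]) auto
qed

lemma measure_box_pos:
  fixes a b :: "'a::euclidean_space"
  assumes "box a b \<noteq> {}"
  shows "measure lebesgue (box a b) = (\<Prod>i\<in>Basis. b \<bullet> i - a \<bullet> i)" "\<And>i. i \<in> Basis \<Longrightarrow> b \<bullet> i - a \<bullet> i > 0"
  using assms by (auto simp: measure_lborel_box_eq inner_diff_left box_ne_empty less_imp_le)

lemma brunn_minkowski_box:
  fixes a b c d :: "'a::euclidean_space"
  assumes "box a b \<noteq> {}" "box c d \<noteq> {}"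
  shows "(root DIM('a) (measure lebesgue (box a b)) + root DIM('a) (measure lebesgue (box c d))) ^ DIM('a)
    \<le> measure lebesgue (sumset (box a b) (box c d))"
proof -
  have ne: "box (a + c) (b + d) \<noteq> {}"
    using assms by (auto simp: box_ne_empty inner_add_left intro!: add_strict_mono)
  have "(root DIM('a) (measure lebesgue (box a b)) + root DIM('a) (measure lebesgue (box c d))) ^ DIM('a)
      \<le> (\<Prod>i\<in>Basis. (b \<bullet> i - a \<bullet> i) + (d \<bullet> i - c \<bullet> i))"
    unfolding measure_box_pos(1)[OF assms(1)] measure_box_pos(1)[OF assms(2)]
    by (rule geometric_mean_superadditive) (use measure_box_pos(2)[OF assms(1)] measure_box_pos(2)[OF assms(2)] in auto)
  also have "\<dots> = measure lebesgue (box (a + c) (b + d))"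
    unfolding measure_box_pos(1)[OF ne] by (rule prod.cong) (auto simp: inner_add_left)
  also have "\<dots> \<le> measure lebesgue (sumset (box a b) (box c d))"
    by (intro measure_mono_fmeasurable box_plus_box assms lmeasurable_open_bounded open_sumset bounded_sumset) auto
  finally show ?thesis .
qed

text \<open>
  The Brunn-Minkowski inequality is proved by the method of Hadwiger and Ohmann: induction over finite
  families of disjoint boxes, then approximation of open sets from inside.
\<close>

definition box_family :: "'a::euclidean_space set set \<Rightarrow> bool" where
  "box_family \<A> \<longleftrightarrow> finite \<A> \<and> \<A> \<noteq> {} \<and> pairwise disjnt \<A> \<and> (\<forall>S\<in>\<A>. S \<noteq> {} \<and> (\<exists>a b. S = box a b))"

definition cut_boxes :: "'a set set \<Rightarrow> 'a set \<Rightarrow> 'a set set" where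
  "cut_boxes \<A> H = (\<lambda>S. S \<inter> H) ` \<A> - {{}}"

lemma Union_cut_boxes: "\<Union>(cut_boxes \<A> H) = \<Union>\<A> \<inter> H"
  by (auto simp: cut_boxes_def)

lemma card_cut_boxes_le: "finite \<A> \<Longrightarrow> card (cut_boxes \<A> H) \<le> card \<A>"
  unfolding cut_boxes_def by (meson card_Diff1_le card_image_le finite_imageI order_trans)

lemma card_cut_boxes_less:
  assumes "finite \<A>" "S \<in> \<A>" "S \<inter> H = {}"
  shows "card (cut_boxes \<A> H) < card \<A>"
proof -
  have "cut_boxes \<A> H \<subseteq> (\<lambda>S. S \<inter> H) ` (\<A> - {S})"
    using assms by (auto simp: cut_boxes_def)
  then have "card (cut_boxes \<A> H) \<le> card (\<A> - {S})"
    by (meson assms(1) card_image_le card_mono finite_Diff finite_imageI order_trans)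
  then show ?thesis using assms by (metis card_Diff1_less le_less_trans)
qed

lemma box_Int_halfspace:
  fixes a b :: "'a::euclidean_space"
  assumes "i \<in> Basis"
  shows "\<exists>a' b'. box a b \<inter> {x. x \<bullet> i < c} = box a' b'" "\<exists>a' b'. box a b \<inter> {x. x \<bullet> i > c} = box a' b'"
proof -
  have "box a b \<inter> {x. x \<bullet> i < c} = box a (b + (min (b \<bullet> i) c - b \<bullet> i) *\<^sub>R i)"
    using assms by (auto simp: mem_box inner_add_left inner_Basis split: if_splits)
  then show "\<exists>a' b'. box a b \<inter> {x. x \<bullet> i < c} = box a' b'" by blast
  have "box a b \<inter> {x. x \<bullet> i > c} = box (a + (max (a \<bullet> i) c - a \<bullet> i) *\<^sub>R i) b"
    using assms by (auto simp: mem_box inner_add_left inner_Basis split: if_splits)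
  then show "\<exists>a' b'. box a b \<inter> {x. x \<bullet> i > c} = box a' b'" by blast
qed

lemma box_family_cut_boxes:
  assumes "box_family \<A>" and H: "H = {x. x \<bullet> i < c} \<or> H = {x. x \<bullet> i > c}" and i: "i \<in> Basis" and ne: "\<Union>\<A> \<inter> H \<noteq> {}"
  shows "box_family (cut_boxes \<A> H)"
proof -
  have "cut_boxes \<A> H \<noteq> {}" using ne by (metis Union_cut_boxes Union_empty)
  moreover have "\<exists>a b. S \<inter> H = box a b" if "S \<in> \<A>" for S
    using assms(1) that H box_Int_halfspace[OF i] unfolding box_family_def by metis
  moreover have "pairwise disjnt (cut_boxes \<A> H)"
    using assms(1) unfolding box_family_def pairwise_def cut_boxes_def disjnt_def by blast
  ultimately show ?thesis using assms(1) unfolding box_family_def by (auto simp: cut_boxes_def)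
qed

lemma box_family_open: "box_family \<A> \<Longrightarrow> open (\<Union>\<A>)"
  by (auto simp: box_family_def intro!: open_Union)

lemma box_family_bounded: "box_family \<A> \<Longrightarrow> bounded (\<Union>\<A>)"
  by (auto simp: box_family_def intro!: bounded_Union)

lemma open_measure_pos:
  fixes A :: "'a::euclidean_space set"
  assumes "open A" "bounded A" "A \<noteq> {}"
  shows "measure lebesgue A > 0"
proof -
  have "measure lebesgue A \<noteq> 0"
    using assms open_not_negligible negligible_iff_measure lmeasurable_open_bounded by blast
  then show ?thesis by (simp add: less_le)
qed

lemma measure_split_hyperplane:
  fixes A :: "'a::euclidean_space set"
  assumes "A \<in> lmeasurable" "i \<in> Basis"
  shows "measure lebesgue A = measure lebesgue (A \<inter> {x. x \<bullet> i < c}) + measure lebesgue (A \<inter> {x. x \<bullet> i > c})"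
proof -
  have neg: "negligible {x::'a. x \<bullet> i = c}" by (rule negligible_standard_hyperplane[OF assms(2)])
  have m1: "A \<inter> {x. x \<bullet> i < c} \<in> lmeasurable" "A \<inter> {x. x \<bullet> i > c} \<in> lmeasurable"
    using assms open_halfspace_component_lt[of i c] open_halfspace_component_gt[of c i]
    by (auto intro!: fmeasurable_Int_fmeasurable)
  have "measure lebesgue A = measure lebesgue ((A \<inter> {x. x \<bullet> i < c}) \<union> (A \<inter> {x. x \<bullet> i > c}))"
    by (rule measure_negligible_symdiff[OF assms(1), symmetric])
       (rule negligible_subset[OF neg], auto)
  also have "\<dots> = measure lebesgue (A \<inter> {x. x \<bullet> i < c}) + measure lebesgue (A \<inter> {x. x \<bullet> i > c})"
    using m1 by (subst measure_Un3) (auto intro: arg_cong[of _ "{}" "measure lebesgue", THEN trans])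
  finally show ?thesis .
qed

text \<open>
  The measure of the part below the hyperplane at height \<open>c\<close> is a Lipschitz function of \<open>c\<close>, because
  \<open>B\<close> lies in a cube; the intermediate value theorem applies.
\<close>

lemma halfspace_measure_IVT:
  fixes B :: "'a::euclidean_space set"
  assumes "open B" "bounded B" "i \<in> Basis" "0 \<le> v" "v \<le> measure lebesgue B"
  shows "\<exists>c. measure lebesgue (B \<inter> {x. x \<bullet> i < c}) = v"
proof -
  obtain r where r: "r > 0" "B \<subseteq> cbox (- r *\<^sub>R One) (r *\<^sub>R One)"
  proof -
    from bounded_subset_cbox_symmetric[OF assms(2)] obtain a where a: "B \<subseteq> cbox (-a) a" by blast
    define r where "r = (\<Sum>j\<in>Basis. \<bar>a \<bullet> j\<bar>) + 1"
    have "\<bar>a \<bullet> j\<bar> \<le> r" if "j \<in> Basis" for j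
      using member_le_sum[of j Basis "\<lambda>j. \<bar>a \<bullet> j\<bar>"] that by (auto simp: r_def)
    then have "cbox (-a) a \<subseteq> cbox (- r *\<^sub>R One) (r *\<^sub>R One)"
      by (auto simp: mem_box abs_le_iff) (smt (verit) inner_minus_left)+
    moreover have "r > 0" by (auto simp: r_def intro!: add_nonneg_pos sum_nonneg)
    ultimately show ?thesis using a that[of r] by blast
  qed
  define g where "g c = measure lebesgue (B \<inter> {x. x \<bullet> i < c})" for c
  have Bm: "B \<in> lmeasurable" using assms lmeasurable_open_bounded by blast
  have m: "B \<inter> {x. x \<bullet> i < c} \<in> lmeasurable" for c
    using assms open_halfspace_component_lt[of i c] by (intro lmeasurable_open_bounded) auto
  have lip: "g d - g c \<le> (2 * r) ^ (DIM('a) - 1) * (d - c)" if "c \<le> d" for c d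
  proof -
    let ?a = "- r *\<^sub>R One + (c + r) *\<^sub>R i" let ?b = "r *\<^sub>R One + (d - r) *\<^sub>R i"
    have le: "?a \<bullet> j \<le> ?b \<bullet> j" if "j \<in> Basis" for j
      using that r \<open>c \<le> d\<close> assms(3) by (auto simp: inner_add_left inner_diff_left inner_Basis)
    have "g d - g c = measure lebesgue (B \<inter> {x. x \<bullet> i < d} - B \<inter> {x. x \<bullet> i < c})"
      unfolding g_def by (rule measurable_measure_Diff[symmetric]) (use m \<open>c \<le> d\<close> fmeasurableD in auto)
    also have "\<dots> \<le> measure lebesgue (cbox ?a ?b)"
    proof (rule measure_mono_fmeasurable)
      show "B \<inter> {x. x \<bullet> i < d} - B \<inter> {x. x \<bullet> i < c} \<subseteq> cbox ?a ?b"
      proof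
        fix x assume x: "x \<in> B \<inter> {x. x \<bullet> i < d} - B \<inter> {x. x \<bullet> i < c}"
        then have "x \<in> cbox (- r *\<^sub>R One) (r *\<^sub>R One)" using r by auto
        then show "x \<in> cbox ?a ?b" using x assms(3)
          by (auto simp: mem_box inner_add_left inner_diff_left inner_Basis)
      qed
    qed (use m in \<open>auto intro: sets.Diff fmeasurableD\<close>)
    also have "\<dots> = (\<Prod>j\<in>Basis. (?b - ?a) \<bullet> j)"
      using le by (simp add: measure_lborel_cbox_eq inner_diff_left)
    also have "\<dots> = (?b - ?a) \<bullet> i * (\<Prod>j\<in>Basis - {i}. (?b - ?a) \<bullet> j)"
      using assms(3) by (simp add: prod.remove)
    also have "(\<Prod>j\<in>Basis - {i}. (?b - ?a) \<bullet> j) = (\<Prod>j\<in>Basis - {i}. 2 * r)"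
      using assms(3) by (intro prod.cong) (auto simp: inner_add_left inner_diff_left inner_Basis)
    also have "(?b - ?a) \<bullet> i = d - c" using assms(3) by (simp add: inner_add_left inner_diff_left)
    finally show ?thesis using assms(3) by (simp add: mult.commute)
  qed
  have mono: "g c \<le> g d" if "c \<le> d" for c d
    unfolding g_def by (rule measure_mono_fmeasurable) (use m that fmeasurableD in auto)
  have "((2 * r) ^ (DIM('a) - 1))-lipschitz_on UNIV g"
  proof (rule lipschitz_onI)
    fix x y show "dist (g x) (g y) \<le> (2 * r) ^ (DIM('a) - 1) * dist x y"
      using lip[of x y] lip[of y x] mono[of x y] mono[of y x] by (cases "x \<le> y") (auto simp: dist_real_def)
  qed (use r in auto)
  then have cont: "continuous_on UNIV g" by (rule lipschitz_on_continuous_on)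
  have low: "B \<inter> {x. x \<bullet> i < - r} = {}"
  proof -
    have "\<not> x \<bullet> i < - r" if "x \<in> B" for x
      using r(2) that assms(3) by (force simp: mem_box subset_iff)
    then show ?thesis by auto
  qed
  have up: "B \<inter> {x. x \<bullet> i < r + 1} = B"
  proof -
    have "x \<bullet> i < r + 1" if "x \<in> B" for x
      using r(2) that assms(3) by (force simp: mem_box subset_iff)
    then show ?thesis by auto
  qed
  have "g (- r) \<le> v" "v \<le> g (r + 1)" using assms by (simp_all add: g_def low up)
  then have "\<exists>c. - r \<le> c \<and> c \<le> r + 1 \<and> g c = v"
    using r by (intro IVT') (auto intro: continuous_on_subset[OF cont])
  then show ?thesis by (auto simp: g_def)
qed

text \<open>
  Two disjoint boxes of \<open>\<A>\<close> are separated by a coordinate hyperplane, so each side of it meets fewer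
  boxes of \<open>\<A>\<close>. A parallel hyperplane cuts the union of \<open>\<B>\<close> in the same proportion \<open>l : 1 - l\<close>. The sums
  of the lower parts and of the upper parts lie on different sides of a third hyperplane, so their
  measures add up, and by homogeneity the induction hypotheses give \<open>l\<close> and \<open>1 - l\<close> times the bound.
\<close>

lemma brunn_minkowski_cut_step:
  fixes \<A> \<B> :: "'a::euclidean_space set set"
  assumes A: "box_family \<A>" and B: "box_family \<B>" and two: "card \<A> \<ge> 2"
    and IH: "\<And>\<A>' \<B>' :: 'a set set. \<lbrakk>box_family \<A>'; box_family \<B>'; card \<A>' + card \<B>' < card \<A> + card \<B>\<rbrakk> \<Longrightarrow>
      (root DIM('a) (measure lebesgue (\<Union>\<A>')) + root DIM('a) (measure lebesgue (\<Union>\<B>'))) ^ DIM('a)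
        \<le> measure lebesgue (sumset (\<Union>\<A>') (\<Union>\<B>'))"
  shows "(root DIM('a) (measure lebesgue (\<Union>\<A>)) + root DIM('a) (measure lebesgue (\<Union>\<B>))) ^ DIM('a)
        \<le> measure lebesgue (sumset (\<Union>\<A>) (\<Union>\<B>))"
proof -
  let ?m = "DIM('a)" and ?\<mu> = "measure lebesgue"
  note opA = box_family_open[OF A] and bdA = box_family_bounded[OF A]
  note opB = box_family_open[OF B] and bdB = box_family_bounded[OF B]
  have finA: "finite \<A>" and finB: "finite \<B>" using A B by (auto simp: box_family_def)
  obtain S T where ST: "S \<in> \<A>" "T \<in> \<A>" "S \<noteq> T"
    using two by (metis card_le_Suc0_iff_eq finA not_less_eq_eq numeral_2_eq_2)
  have dST: "S \<inter> T = {}" using A ST by (auto simp: box_family_def pairwise_def disjnt_def)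
  obtain a b c d where box: "S = box a b" "T = box c d" using A ST by (meson box_family_def)
  have ne: "S \<noteq> {}" "T \<noteq> {}" using A ST by (auto simp: box_family_def)
  obtain i where i: "i \<in> Basis" and sep: "b \<bullet> i \<le> c \<bullet> i \<or> d \<bullet> i \<le> a \<bullet> i"
  proof -
    have lt: "a \<bullet> j < b \<bullet> j" "c \<bullet> j < d \<bullet> j" if "j \<in> Basis" for j
      using ne box that by (auto simp: box_ne_empty)
    from dST[unfolded box] obtain j where j: "j \<in> Basis"
       "b \<bullet> j \<le> a \<bullet> j \<or> d \<bullet> j \<le> c \<bullet> j \<or> b \<bullet> j \<le> c \<bullet> j \<or> d \<bullet> j \<le> a \<bullet> j"
      unfolding disjoint_interval by blast
    show ?thesis using that[OF j(1)] j(2) lt[OF j(1)] by auto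
  qed
  obtain t P Q where PQ: "P \<in> \<A>" "Q \<in> \<A>" and P: "P \<subseteq> {x. x \<bullet> i < t}" and Q: "Q \<subseteq> {x. x \<bullet> i > t}" "P \<noteq> {}" "Q \<noteq> {}"
  proof (cases "b \<bullet> i \<le> c \<bullet> i")
    case True
    then show ?thesis using ST ne box i by (intro that[of S T "b \<bullet> i"]) (force simp: mem_box)+
  next
    case False
    then have "d \<bullet> i \<le> a \<bullet> i" using sep by simp
    then show ?thesis using ST ne box i by (intro that[of T S "d \<bullet> i"]) (force simp: mem_box)+
  qed
  define L where "L s = {x::'a. x \<bullet> i < s}" for s
  define G where "G s = {x::'a. x \<bullet> i > s}" for s
  have oL: "open (L s)" "open (G s)" for s
    unfolding L_def G_def using open_halfspace_component_lt[of i s] open_halfspace_component_gt[of s i] by auto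
  have splitA: "?\<mu> (\<Union>\<A>) = ?\<mu> (\<Union>\<A> \<inter> L t) + ?\<mu> (\<Union>\<A> \<inter> G t)"
    unfolding L_def G_def by (rule measure_split_hyperplane[OF lmeasurable_open_bounded[OF opA bdA] i])
  have neA: "\<Union>\<A> \<inter> L t \<noteq> {}" "\<Union>\<A> \<inter> G t \<noteq> {}" using PQ P Q by (auto simp: L_def G_def)
  have posA: "?\<mu> (\<Union>\<A> \<inter> L t) > 0" "?\<mu> (\<Union>\<A> \<inter> G t) > 0"
    using neA by (auto intro!: open_measure_pos open_Int bounded_Int opA bdA oL)
  have posB: "?\<mu> (\<Union>\<B>) > 0" using B by (intro open_measure_pos opB bdB) (auto simp: box_family_def)
  define l where "l = ?\<mu> (\<Union>\<A> \<inter> L t) / ?\<mu> (\<Union>\<A>)"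
  have l: "0 < l" "l < 1" using posA splitA by (auto simp: l_def)
  have Al: "?\<mu> (\<Union>\<A> \<inter> L t) = l * ?\<mu> (\<Union>\<A>)" using posA splitA by (simp add: l_def)
  have Ag: "?\<mu> (\<Union>\<A> \<inter> G t) = (1 - l) * ?\<mu> (\<Union>\<A>)" using Al splitA by (simp add: algebra_simps)
  \<comment> \<open>The second hyperplane, at height \<open>s\<close>, cuts off the same fraction \<open>l\<close>.\<close>
  obtain s where Bl: "?\<mu> (\<Union>\<B> \<inter> L s) = l * ?\<mu> (\<Union>\<B>)"
    using halfspace_measure_IVT[OF opB bdB i, of "l * ?\<mu> (\<Union>\<B>)"] l posB unfolding L_def by auto
  have splitB: "?\<mu> (\<Union>\<B>) = ?\<mu> (\<Union>\<B> \<inter> L s) + ?\<mu> (\<Union>\<B> \<inter> G s)"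
    unfolding L_def G_def by (rule measure_split_hyperplane[OF lmeasurable_open_bounded[OF opB bdB] i])
  have Bg: "?\<mu> (\<Union>\<B> \<inter> G s) = (1 - l) * ?\<mu> (\<Union>\<B>)" using Bl splitB by (simp add: algebra_simps)
  have neB: "\<Union>\<B> \<inter> L s \<noteq> {}" "\<Union>\<B> \<inter> G s \<noteq> {}" using Bl Bg l posB by fastforce+
  have cL: "card (cut_boxes \<A> (L t)) < card \<A>" by (rule card_cut_boxes_less[OF finA PQ(2)]) (use Q in \<open>auto simp: L_def\<close>)
  have cG: "card (cut_boxes \<A> (G t)) < card \<A>" by (rule card_cut_boxes_less[OF finA PQ(1)]) (use P in \<open>auto simp: G_def\<close>)
  have bf: "box_family (cut_boxes \<A> (L t))" "box_family (cut_boxes \<A> (G t))" "box_family (cut_boxes \<B> (L s))" "box_family (cut_boxes \<B> (G s))"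
    using neA neB by (auto intro!: box_family_cut_boxes[OF A _ i] box_family_cut_boxes[OF B _ i] simp: L_def G_def)
  define K where "K = root ?m (?\<mu> (\<Union>\<A>)) + root ?m (?\<mu> (\<Union>\<B>))"
  have scale: "(root ?m (k * ?\<mu> (\<Union>\<A>)) + root ?m (k * ?\<mu> (\<Union>\<B>))) ^ ?m = k * K ^ ?m" if "k > 0" for k
    using that by (simp add: K_def real_root_mult distrib_left[symmetric] power_mult_distrib)
  have "l * K ^ ?m \<le> ?\<mu> (sumset (\<Union>\<A> \<inter> L t) (\<Union>\<B> \<inter> L s))"
    using IH[OF bf(1) bf(3)] cL card_cut_boxes_le[OF finB, of "L s"] scale[OF l(1)]
    unfolding Union_cut_boxes Al Bl by linarith
  moreover have "(1 - l) * K ^ ?m \<le> ?\<mu> (sumset (\<Union>\<A> \<inter> G t) (\<Union>\<B> \<inter> G s))"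
    using IH[OF bf(2) bf(4)] cG card_cut_boxes_le[OF finB, of "G s"] scale[of "1 - l"] l
    unfolding Union_cut_boxes Ag Bg by linarith
  ultimately have "K ^ ?m \<le> ?\<mu> (sumset (\<Union>\<A> \<inter> L t) (\<Union>\<B> \<inter> L s)) + ?\<mu> (sumset (\<Union>\<A> \<inter> G t) (\<Union>\<B> \<inter> G s))"
    by (simp add: algebra_simps)
  also have "\<dots> \<le> ?\<mu> (sumset (\<Union>\<A>) (\<Union>\<B>) \<inter> {x. x \<bullet> i < t + s}) + ?\<mu> (sumset (\<Union>\<A>) (\<Union>\<B>) \<inter> {x. x \<bullet> i > t + s})"
  proof (intro add_mono measure_mono_fmeasurable)
    show "sumset (\<Union>\<A> \<inter> L t) (\<Union>\<B> \<inter> L s) \<subseteq> sumset (\<Union>\<A>) (\<Union>\<B>) \<inter> {x. x \<bullet> i < t + s}"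
      by (auto simp: sumset_def L_def inner_add_left)
    show "sumset (\<Union>\<A> \<inter> G t) (\<Union>\<B> \<inter> G s) \<subseteq> sumset (\<Union>\<A>) (\<Union>\<B>) \<inter> {x. x \<bullet> i > t + s}"
      by (auto simp: sumset_def G_def inner_add_left)
    show "sumset (\<Union>\<A> \<inter> L t) (\<Union>\<B> \<inter> L s) \<in> sets lebesgue"
      "sumset (\<Union>\<A> \<inter> G t) (\<Union>\<B> \<inter> G s) \<in> sets lebesgue"
      by (auto intro!: fmeasurableD lmeasurable_open_bounded open_sumset bounded_sumset bounded_Int oL opA bdA opB bdB)
    show "sumset (\<Union>\<A>) (\<Union>\<B>) \<inter> {x. x \<bullet> i < t + s} \<in> lmeasurable" "sumset (\<Union>\<A>) (\<Union>\<B>) \<inter> {x. x \<bullet> i > t + s} \<in> lmeasurable"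
      using oL[of "t + s"] unfolding L_def G_def
      by (auto intro!: lmeasurable_open_bounded open_Int open_sumset bounded_sumset bounded_Int oL opA bdA opB bdB)
  qed
  also have "\<dots> = ?\<mu> (sumset (\<Union>\<A>) (\<Union>\<B>))"
    by (rule measure_split_hyperplane[symmetric, OF _ i])
       (intro lmeasurable_open_bounded open_sumset bounded_sumset opA bdA bdB)
  finally show ?thesis unfolding K_def .
qed

lemma brunn_minkowski_box_family:
  fixes \<A> \<B> :: "'a::euclidean_space set set"
  assumes "box_family \<A>" "box_family \<B>"
  shows "(root DIM('a) (measure lebesgue (\<Union>\<A>)) + root DIM('a) (measure lebesgue (\<Union>\<B>))) ^ DIM('a)
        \<le> measure lebesgue (sumset (\<Union>\<A>) (\<Union>\<B>))"
  using assms
proof (induction "card \<A> + card \<B>" arbitrary: \<A> \<B> rule: less_induct)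
  case less
  consider "card \<A> \<ge> 2" | "card \<B> \<ge> 2" | "card \<A> < 2" "card \<B> < 2" by linarith
  then show ?case
  proof cases
    case 1
    show ?thesis
      by (rule brunn_minkowski_cut_step[OF less.prems 1]) (rule less.hyps)
  next
    case 2
    have "(root DIM('a) (measure lebesgue (\<Union>\<B>)) + root DIM('a) (measure lebesgue (\<Union>\<A>))) ^ DIM('a)
        \<le> measure lebesgue (sumset (\<Union>\<B>) (\<Union>\<A>))"
      by (rule brunn_minkowski_cut_step[OF less.prems(2,1) 2])
         (rule less.hyps, simp_all add: add.commute)
    then show ?thesis by (simp add: add.commute sumset_commute)
  next
    case 3
    have "card \<A> > 0" "card \<B> > 0" using less.prems by (auto simp: box_family_def card_gt_0_iff)
    then have "card \<A> = 1" "card \<B> = 1" using 3 by auto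
    then obtain S T where S: "\<A> = {S}" and T: "\<B> = {T}" by (meson card_1_singletonE)
    obtain a b where "S = box a b" "S \<noteq> {}" using less.prems(1) S by (auto simp: box_family_def)
    moreover obtain c d where "T = box c d" "T \<noteq> {}" using less.prems(2) T by (auto simp: box_family_def)
    ultimately show ?thesis unfolding S T using brunn_minkowski_box[of a b c d] by simp
  qed
qed

text \<open>
  The covering lemma for gauges, applied to the gauge with constant value \<open>A\<close> on \<open>A\<close>, decomposes \<open>A\<close>
  into countably many non-overlapping closed boxes; finitely many of their interiors carry almost all
  of the measure.
\<close>

lemma box_family_inner_approximation:
  fixes A :: "'a::euclidean_space set"
  assumes "open A" "bounded A" "A \<noteq> {}" "e > 0"
  shows "\<exists>\<A>. box_family \<A> \<and> \<Union>\<A> \<subseteq> A \<and> measure lebesgue A - e < measure lebesgue (\<Union>\<A>)"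
proof -
  let ?\<mu> = "measure lebesgue"
  define e' where "e' = min e (?\<mu> A)"
  have e': "e' > 0" "e' \<le> e" "e' \<le> ?\<mu> A"
    using open_measure_pos[OF assms(1-3)] assms(4) by (auto simp: e'_def)
  obtain a where a: "A \<subseteq> cbox (-a) a" using bounded_subset_cbox_symmetric[OF assms(2)] by blast
  then have sub: "A \<subseteq> cbox (- a - One) (a + One)"
    by (force simp: mem_box subset_iff inner_diff_left inner_add_left)
  have ne: "box (- a - One) (a + One) \<noteq> {}"
  proof -
    obtain x where "x \<in> A" using assms by blast
    then have "x \<in> cbox (-a) a" using a by blast
    then have "x \<in> box (- a - One) (a + One)"
      by (force simp: mem_box inner_diff_left inner_add_left)
    then show ?thesis by blast
  qed
  obtain \<D> where cD: "countable \<D>"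
      and K: "\<And>K. K \<in> \<D> \<Longrightarrow> interior K \<noteq> {} \<and> (\<exists>c d. K = cbox c d)"
      and pw: "pairwise (\<lambda>A B. interior A \<inter> interior B = {}) \<D>"
      and inA: "\<And>K. K \<in> \<D> \<Longrightarrow> \<exists>x\<in>A \<inter> K. K \<subseteq> (if x \<in> A then A else UNIV)" and cov: "A \<subseteq> \<Union>\<D>"
    by (rule covering_lemma[OF sub ne, of "\<lambda>x. if x \<in> A then A else UNIV"]) (use assms(1) in \<open>auto simp: gauge_def\<close>)
  have UD: "\<Union>\<D> = A" using cov inA by (fastforce split: if_splits)
  have Dne: "\<D> \<noteq> {}" using UD assms by auto
  define f where "f = from_nat_into \<D>"
  have rf: "range f = \<D>" using cD Dne by (simp add: f_def)
  have fb: "\<exists>c d. f n = cbox c d" for n using K rf by (metis rangeI)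
  define U where "U n = (\<Union>k\<le>n. f k)" for n
  have UU: "(\<Union>n. U n) = A" using rf UD by (auto simp: U_def)
  have "f n \<in> lmeasurable" for n using fb[of n] by auto
  then have Um: "U n \<in> lmeasurable" for n unfolding U_def by (intro fmeasurable.finite_UN) auto
  have lim: "(\<lambda>n. ?\<mu> (U n)) \<longlonglongrightarrow> ?\<mu> (\<Union>n. U n)"
  proof (rule measure_nested_Union)
    show "?\<mu> (U n) \<le> ?\<mu> A" for n
      by (rule measure_mono_fmeasurable) (use UU Um assms in \<open>auto simp: lmeasurable_open_bounded dest: fmeasurableD\<close>)
    show "U n \<subseteq> U (Suc n)" for n by (auto simp: U_def intro: le_SucI)
  qed (rule Um)
  then have "\<forall>\<^sub>F n in sequentially. ?\<mu> A - e' < ?\<mu> (U n)"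
    using e' UU by (intro order_tendstoD(1)) auto
  then obtain n where n: "?\<mu> A - e' < ?\<mu> (U n)" using eventually_happens' by force
  define \<A> where "\<A> = interior ` f ` {..n}"
  have "box_family \<A>"
    unfolding box_family_def
  proof (intro conjI ballI)
    show "pairwise disjnt \<A>"
    proof (rule pairwiseI)
      fix X Y assume "X \<in> \<A>" "Y \<in> \<A>" "X \<noteq> Y"
      then obtain k l where kl: "X = interior (f k)" "Y = interior (f l)" by (auto simp: \<A>_def)
      then have "f k \<noteq> f l" using \<open>X \<noteq> Y\<close> by auto
      then show "disjnt X Y" using pw rf kl unfolding pairwise_def disjnt_def by auto
    qed
    fix S assume "S \<in> \<A>"
    then obtain k where k: "S = interior (f k)" by (auto simp: \<A>_def)
    show "S \<noteq> {}" using K[of "f k"] rf k by auto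
    show "\<exists>a b. S = box a b" using fb[of k] k interior_cbox by metis
  qed (auto simp: \<A>_def)
  moreover have UAU: "\<Union>\<A> \<subseteq> U n" using interior_subset by (fastforce simp: \<A>_def U_def)
  moreover have "?\<mu> (\<Union>\<A>) = ?\<mu> (U n)"
  proof (rule measure_negligible_symdiff[OF Um])
    have "negligible (frontier (f k))" for k
      using fb[of k] negligible_convex_frontier[OF convex_box(1)] by auto
    then have neg: "negligible (\<Union>k\<le>n. frontier (f k))"
      by (intro negligible_Union) auto
    show "negligible ((U n - \<Union>\<A>) \<union> (\<Union>\<A> - U n))"
    proof (rule negligible_subset[OF neg], rule subsetI, rule ccontr)
      fix x assume nf: "x \<notin> (\<Union>k\<le>n. frontier (f k))" and x: "x \<in> (U n - \<Union>\<A>) \<union> (\<Union>\<A> - U n)"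
      then obtain k where k: "k \<le> n" "x \<in> f k" using UAU by (auto simp: U_def)
      moreover have "closed (f k)" using fb by (metis closed_cbox)
      ultimately have "x \<in> interior (f k)" using nf by (auto simp: frontier_def)
      then show False using k x UAU by (auto simp: \<A>_def)
    qed
  qed
  ultimately show ?thesis using n e' UU by (intro exI[of _ \<A>]) auto
qed

theorem brunn_minkowski:
  fixes A B :: "'a::euclidean_space set"
  assumes "open A" "bounded A" "A \<noteq> {}" "open B" "bounded B" "B \<noteq> {}"
  shows "(root DIM('a) (measure lebesgue A) + root DIM('a) (measure lebesgue B)) ^ DIM('a)
        \<le> measure lebesgue (sumset A B)"
proof -
  let ?\<mu> = "measure lebesgue"
  have "\<exists>\<A>. box_family \<A> \<and> \<Union>\<A> \<subseteq> A \<and> ?\<mu> A - 1 / Suc n < ?\<mu> (\<Union>\<A>)" for n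
    using assms by (intro box_family_inner_approximation) auto
  then obtain F where F: "\<And>n. box_family (F n)" "\<And>n. \<Union>(F n) \<subseteq> A" "\<And>n. ?\<mu> A - 1 / Suc n < ?\<mu> (\<Union>(F n))"
    by metis
  have "\<exists>\<A>. box_family \<A> \<and> \<Union>\<A> \<subseteq> B \<and> ?\<mu> B - 1 / Suc n < ?\<mu> (\<Union>\<A>)" for n
    using assms by (intro box_family_inner_approximation) auto
  then obtain G where G: "\<And>n. box_family (G n)" "\<And>n. \<Union>(G n) \<subseteq> B" "\<And>n. ?\<mu> B - 1 / Suc n < ?\<mu> (\<Union>(G n))"
    by metis
  have le: "(root DIM('a) (?\<mu> (\<Union>(F n))) + root DIM('a) (?\<mu> (\<Union>(G n)))) ^ DIM('a) \<le> ?\<mu> (sumset A B)" for n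
  proof -
    have "?\<mu> (sumset (\<Union>(F n)) (\<Union>(G n))) \<le> ?\<mu> (sumset A B)"
      by (intro measure_mono_fmeasurable sumset_mono F G lmeasurable_open_bounded open_sumset bounded_sumset assms)
         (auto intro!: fmeasurableD lmeasurable_open_bounded open_sumset bounded_sumset box_family_open box_family_bounded F G)
    then show ?thesis using brunn_minkowski_box_family[OF F(1) G(1), of n n] by linarith
  qed
  have "(\<lambda>n. ?\<mu> (\<Union>(F n))) \<longlonglongrightarrow> ?\<mu> A"
  proof (rule real_tendsto_sandwich)
    show "(\<lambda>n. ?\<mu> A - 1 / Suc n) \<longlonglongrightarrow> ?\<mu> A" using tendsto_diff[OF tendsto_const LIMSEQ_inverse_real_of_nat]
      by (simp add: divide_inverse)
    show "\<forall>\<^sub>F n in sequentially. ?\<mu> (\<Union>(F n)) \<le> ?\<mu> A"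
      by (intro always_eventually allI measure_mono_fmeasurable F lmeasurable_open_bounded assms)
        (auto intro!: fmeasurableD lmeasurable_open_bounded box_family_open box_family_bounded F)
  qed (use F in \<open>auto intro!: always_eventually less_imp_le\<close>)
  moreover have "(\<lambda>n. ?\<mu> (\<Union>(G n))) \<longlonglongrightarrow> ?\<mu> B"
  proof (rule real_tendsto_sandwich)
    show "(\<lambda>n. ?\<mu> B - 1 / Suc n) \<longlonglongrightarrow> ?\<mu> B" using tendsto_diff[OF tendsto_const LIMSEQ_inverse_real_of_nat]
      by (simp add: divide_inverse)
    show "\<forall>\<^sub>F n in sequentially. ?\<mu> (\<Union>(G n)) \<le> ?\<mu> B"
      by (intro always_eventually allI measure_mono_fmeasurable G lmeasurable_open_bounded assms)
        (auto intro!: fmeasurableD lmeasurable_open_bounded box_family_open box_family_bounded G)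
  qed (use G in \<open>auto intro!: always_eventually less_imp_le\<close>)
  ultimately have "(\<lambda>n. (root DIM('a) (?\<mu> (\<Union>(F n))) + root DIM('a) (?\<mu> (\<Union>(G n)))) ^ DIM('a)) \<longlonglongrightarrow>
      (root DIM('a) (?\<mu> A) + root DIM('a) (?\<mu> B)) ^ DIM('a)"
    by (intro tendsto_intros)
  then show ?thesis by (rule LIMSEQ_le_const2) (use le in auto)
qed

section \<open>Determinants of frames\<close>

text \<open>
  The frame of a hypersurface parametrized over \<open>'n\<close>, together with one transversal vector, is indexed
  by \<open>'n ext\<close>. The order, with \<open>Base\<close> as least element, makes the theorems on triangular matrices and
  on change of variables applicable.
\<close>

datatype 'n ext = Base | Ext 'n

lemma UNIV_ext: "UNIV = insert Base (range Ext)"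
proof -
  have "x \<in> insert Base (range Ext)" for x :: "'n ext" by (cases x) auto
  then show ?thesis by blast
qed

instance ext :: (finite) finite
  by standard (simp add: UNIV_ext)

primrec ext_index :: "'n::finite ext \<Rightarrow> nat" where
  "ext_index Base = 0"
| "ext_index (Ext i) = Suc (to_nat i)"

lemma ext_index_inject: "ext_index x = ext_index y \<longleftrightarrow> x = y"
  by (cases x; cases y) auto

instantiation ext :: (finite) wellorder
begin

definition less_eq_ext :: "'a ext \<Rightarrow> 'a ext \<Rightarrow> bool" where
  "x \<le> y \<longleftrightarrow> ext_index x \<le> ext_index y"

definition less_ext :: "'a ext \<Rightarrow> 'a ext \<Rightarrow> bool" where
  "x < y \<longleftrightarrow> ext_index x < ext_index y"

instance
proof
  fix P :: "'a ext \<Rightarrow> bool" and a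
  assume "\<And>x. (\<And>y. y < x \<Longrightarrow> P y) \<Longrightarrow> P x"
  then show "P a" unfolding less_ext_def by (rule measure_induct_rule[of ext_index])
next
  fix x y :: "'a ext"
  show "x \<le> y \<Longrightarrow> y \<le> x \<Longrightarrow> x = y"
    unfolding less_eq_ext_def using ext_index_inject[of x y] by linarith
qed (unfold less_eq_ext_def less_ext_def, linarith+)

end

lemma sum_ext: "(\<Sum>x\<in>UNIV. f x) = f Base + (\<Sum>i\<in>UNIV. f (Ext i))" for f :: "'n::finite ext \<Rightarrow> 'b::comm_monoid_add"
  unfolding UNIV_ext by (subst sum.insert) (auto simp: sum.reindex inj_on_def)

lemma prod_ext: "(\<Prod>x\<in>UNIV. f x) = f Base * (\<Prod>i\<in>UNIV. f (Ext i))" for f :: "'n::finite ext \<Rightarrow> 'b::comm_monoid_mult"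
  unfolding UNIV_ext by (subst prod.insert) (auto simp: prod.reindex inj_on_def)

lemma CARD_ext: "CARD('n::finite ext) = CARD('n) + 1"
  unfolding UNIV_ext by (subst card_insert_disjoint) (auto simp: card_image inj_on_def)

text \<open>
  Only permutations fixing \<open>Base\<close> contribute, and these are the permutations of \<open>'n\<close> with equal signs.
\<close>

lemma det_block_Base:
  fixes A :: "real^'n::finite ext^'n ext"
  assumes "\<And>i. A $ Ext i $ Base = 0"
  shows "det A = A $ Base $ Base * det (\<chi> i j. A $ Ext i $ Ext j)"
proof -
  let ?t = "\<lambda>p. of_int (sign p) * (\<Prod>i\<in>UNIV. A $ i $ p i)"
  have "det A = (\<Sum>p | p permutes UNIV. ?t p)" by (simp add: det_def)
  also have "\<dots> = (\<Sum>p | p permutes range Ext. ?t p)"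
  proof (rule sum.mono_neutral_right)
    show "{p. p permutes range Ext} \<subseteq> {p. p permutes (UNIV :: 'n ext set)}"
      using permutes_subset by auto
    show "\<forall>p\<in>{p. p permutes UNIV} - {p. p permutes range Ext}. ?t p = 0"
    proof
      fix p :: "'n ext \<Rightarrow> 'n ext" assume p: "p \<in> {p. p permutes UNIV} - {p. p permutes range Ext}"
      then have pU: "p permutes UNIV" by simp
      have "p Base \<noteq> Base"
      proof
        assume "p Base = Base"
        then have "p permutes range Ext"
          by (intro permutes_superset[OF pU]) (auto simp: UNIV_ext)
        then show False using p by simp
      qed
      obtain k where k: "p k = Base" using pU by (metis permutes_surj surjD)
      then obtain i where "k = Ext i" using \<open>p Base \<noteq> Base\<close> by (cases k) auto
      then have "A $ k $ p k = 0" using k assms by simp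
      then show "?t p = 0" by (subst prod_zero) auto
    qed
  qed simp
  also have "\<dots> = (\<Sum>q | q permutes UNIV. ?t (map_permutation UNIV Ext q))"
  proof (rule sum.reindex_bij_witness[of _ "map_permutation UNIV Ext" "map_permutation (range Ext) (inv Ext)"])
    have bij: "bij_betw Ext UNIV (range Ext)" by (auto simp: bij_betw_def inj_on_def)
    have inv: "inv Ext (Ext i) = i" for i :: 'n by (auto intro: inv_f_f simp: inj_on_def)
    have bij': "bij_betw (inv Ext) (range Ext) UNIV" by (rule bij_betw_inv_into[OF bij])
    fix p :: "'n ext \<Rightarrow> 'n ext" assume "p \<in> {p. p permutes range Ext}"
    then have p: "p permutes range Ext" by simp
    show *: "map_permutation UNIV Ext (map_permutation (range Ext) (inv Ext) p) = p"
      by (rule map_permutation_compose_inv[OF bij' p]) (auto simp: inv)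
    show "map_permutation (range Ext) (inv Ext) p \<in> {q. q permutes UNIV}"
      using map_permutation_permutes[OF bij' p] by simp
    show "?t (map_permutation UNIV Ext (map_permutation (range Ext) (inv Ext) p)) = ?t p"
      by (simp only: *)
  next
    have bij: "bij_betw Ext UNIV (range Ext)" by (auto simp: bij_betw_def inj_on_def)
    have inv: "inv Ext (Ext i) = i" for i :: 'n by (auto intro: inv_f_f simp: inj_on_def)
    fix q :: "'n \<Rightarrow> 'n" assume "q \<in> {q. q permutes UNIV}"
    then have q: "q permutes UNIV" by simp
    show "map_permutation (range Ext) (inv Ext) (map_permutation UNIV Ext q) = q"
      by (rule map_permutation_compose_inv[OF bij q]) (auto simp: inv)
    show "map_permutation UNIV Ext q \<in> {p. p permutes range Ext}"
      using map_permutation_permutes[OF bij q] by simp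
  qed
  also have "\<dots> = (\<Sum>q | q permutes UNIV. A $ Base $ Base * (of_int (sign q) * (\<Prod>i\<in>UNIV. A $ Ext i $ Ext (q i))))"
  proof (rule sum.cong)
    fix q :: "'n \<Rightarrow> 'n" assume "q \<in> {q. q permutes UNIV}"
    then have "sign (map_permutation UNIV Ext q) = sign q"
      by (intro sign_map_permutation) (auto simp: inj_on_def)
    moreover have "map_permutation UNIV Ext q Base = Base" by (auto simp: map_permutation_def restrict_id_def)
    moreover have "map_permutation UNIV Ext q (Ext i) = Ext (q i)" for i
      by (rule map_permutation_apply) (auto simp: inj_on_def)
    ultimately show "?t (map_permutation UNIV Ext q) = A $ Base $ Base * (of_int (sign q) * (\<Prod>i\<in>UNIV. A $ Ext i $ Ext (q i)))"
      by (simp add: prod_ext)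
  qed simp
  also have "\<dots> = A $ Base $ Base * det (\<chi> i j. A $ Ext i $ Ext j)"
    by (simp add: det_def sum_distrib_left)
  finally show ?thesis .
qed

definition bordered :: "real \<Rightarrow> real^'n::finite \<Rightarrow> real^'n \<Rightarrow> real^'n^'n \<Rightarrow> real^'n ext^'n ext" where
  "bordered d b c A = (\<chi> k l. case k of Base \<Rightarrow> (case l of Base \<Rightarrow> d | Ext j \<Rightarrow> c $ j)
     | Ext i \<Rightarrow> (case l of Base \<Rightarrow> b $ i | Ext j \<Rightarrow> A $ i $ j))"

lemma bordered_simps [simp]:
  "bordered d b c A $ Base $ Base = d"
  "bordered d b c A $ Base $ Ext j = c $ j"
  "bordered d b c A $ Ext i $ Base = b $ i"
  "bordered d b c A $ Ext i $ Ext j = A $ i $ j"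
  by (simp_all add: bordered_def)

lemma matrix_ext_eqI:
  fixes A B :: "real^'n::finite ext^'n ext"
  assumes "A $ Base $ Base = B $ Base $ Base" "\<And>j. A $ Base $ Ext j = B $ Base $ Ext j"
    "\<And>i. A $ Ext i $ Base = B $ Ext i $ Base" "\<And>i j. A $ Ext i $ Ext j = B $ Ext i $ Ext j"
  shows "A = B"
  unfolding vec_eq_iff
proof (intro allI)
  fix k l show "A $ k $ l = B $ k $ l" using assms by (cases k; cases l) auto
qed

text \<open>
  Schur complement: subtracting multiples of the first row clears the first column.
\<close>

lemma det_bordered:
  fixes A :: "real^'n::finite^'n"
  assumes "d \<noteq> 0"
  shows "det (bordered d b c A) = d * det (\<chi> i j. A $ i $ j - b $ i * c $ j / d)"
proof -
  \<comment> \<open>The row operations are left multiplication by the lower triangular matrix \<open>?L\<close>.\<close>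
  let ?L = "bordered 1 ((1 / d) *\<^sub>R b) 0 (mat 1) :: real^'n ext^'n ext"
  let ?M = "bordered d 0 c (\<chi> i j. A $ i $ j - b $ i * c $ j / d)"
  have "bordered d b c A = ?L ** ?M"
    using assms
    by (intro matrix_ext_eqI) (simp_all add: matrix_matrix_mult_def sum_ext mat_def if_distrib[of "\<lambda>x. x * _"] cong: if_cong)
  then have "det (bordered d b c A) = det ?L * det ?M" by (simp add: det_mul)
  moreover have "det ?L = (\<Prod>k\<in>UNIV. ?L $ k $ k)"
  proof (rule det_lowerdiagonal)
    fix i j :: "'n ext" assume "i < j"
    then show "?L $ i $ j = 0" by (cases i; cases j) (auto simp: less_ext_def mat_def)
  qed
  ultimately show ?thesis by (simp add: prod_ext mat_def det_block_Base)
qed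

lemma det_bordered_add_corner:
  fixes A :: "real^'n::finite^'n"
  shows "det (bordered (d + e) b c A) = det (bordered d b c A) + e * det A"
proof -
  let ?r = "\<lambda>i. bordered d b c A $ i"
  have "bordered (d + e) b c A = (\<chi> i. if i = Base then ?r i + e *s axis Base 1 else ?r i)"
    by (intro matrix_ext_eqI) (auto simp: axis_def)
  also have "det \<dots> =
     det (\<chi> i. if i = Base then ?r i else ?r i) + det (\<chi> i. if i = Base then e *s axis Base 1 else ?r i)"
    by (rule det_row_add)
  also have "(\<chi> i. if i = Base then ?r i else ?r i) = bordered d b c A"
    by (intro matrix_ext_eqI) auto
  also have "(\<chi> i. if i = Base then e *s axis Base 1 else ?r i) = bordered e b 0 A"
    by (intro matrix_ext_eqI) (auto simp: axis_def)
  also have "det (bordered e b 0 A) = det (transpose (bordered e b 0 A))" by simp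
  also have "transpose (bordered e b 0 A) = bordered e 0 b (transpose A)"
    by (intro matrix_ext_eqI) (auto simp: transpose_def)
  also have "det \<dots> = e * det (transpose A)" by (simp add: det_block_Base)
  finally show ?thesis by simp
qed

definition rowmat :: "real^'n::finite ext \<Rightarrow> ('n \<Rightarrow> real^'n ext) \<Rightarrow> real^'n ext^'n ext" where
  "rowmat w v = (\<chi> k. case k of Base \<Rightarrow> w | Ext i \<Rightarrow> v i)"

definition gram :: "('n::finite \<Rightarrow> 'a::real_inner) \<Rightarrow> real^'n^'n" where
  "gram v = (\<chi> i j. v i \<bullet> v j)"

text \<open>
  Multiplying one frame by the transpose of another turns determinants into inner products, so that
  volumes of frames can be compared without computing them.
\<close>

lemma det_rowmat_mult:
  "det (rowmat w v) * det (rowmat w' v) =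
     det (bordered (w \<bullet> w') (\<chi> i. v i \<bullet> w') (\<chi> j. w \<bullet> v j) (gram v))"
proof -
  have "det (rowmat w v) * det (rowmat w' v) = det (rowmat w v ** transpose (rowmat w' v))"
    by (simp add: det_mul)
  also have "rowmat w v ** transpose (rowmat w' v) =
      bordered (w \<bullet> w') (\<chi> i. v i \<bullet> w') (\<chi> j. w \<bullet> v j) (gram v)"
    by (intro matrix_ext_eqI)
       (simp_all add: matrix_matrix_mult_def rowmat_def transpose_def gram_def inner_vec_def)
  finally show ?thesis .
qed

lemma det_rowmat_normal:
  assumes "\<And>i. N \<bullet> v i = 0"
  shows "det (rowmat f v) * det (rowmat N v) = (f \<bullet> N) * det (gram v)"
proof -
  have "(\<chi> i. v i \<bullet> N) = 0" using assms by (simp add: vec_eq_iff inner_commute)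
  then show ?thesis unfolding det_rowmat_mult by (simp add: det_block_Base gram_def)
qed

text \<open>
  On the left is the Gram determinant of the vectors \<open>v i\<close> for the metric that the graph of
  \<open>x \<mapsto> sqrt (1 + x \<bullet> x)\<close> inherits from the Lorentz form at \<open>f\<close>. Both sides are the determinant of
  the Euclidean Gram matrix of \<open>f, v\<close> with \<open>1\<close> added in the corner: the left by a Schur complement,
  the right by linearity in the first row.
\<close>

lemma det_graph_metric:
  fixes f :: "real^'n::finite ext"
  shows "(1 + f \<bullet> f) * det (\<chi> i j. v i \<bullet> v j - (f \<bullet> v i) * (f \<bullet> v j) / (1 + f \<bullet> f)) =
     (det (rowmat f v))\<^sup>2 + det (gram v)"
proof -
  have "1 + f \<bullet> f > 0" by (rule add_pos_nonneg) auto
  then have "(1 + f \<bullet> f) * det (\<chi> i j. v i \<bullet> v j - (f \<bullet> v i) * (f \<bullet> v j) / (1 + f \<bullet> f)) =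
      det (bordered (f \<bullet> f + 1) (\<chi> i. v i \<bullet> f) (\<chi> j. f \<bullet> v j) (gram v))"
    by (simp add: det_bordered add.commute gram_def inner_commute)
  also have "\<dots> = (det (rowmat f v))\<^sup>2 + det (gram v)"
    unfolding det_bordered_add_corner by (simp add: power2_eq_square det_rowmat_mult)
  finally show ?thesis .
qed

lemma det_gram_normal:
  assumes "\<And>i. N \<bullet> v i = 0" "N \<bullet> N = 1"
  shows "det (gram v) = (det (rowmat N v))\<^sup>2"
  using det_rowmat_normal[of N v, OF assms(1), of N] assms(2) by (simp add: power2_eq_square)

text \<open>
  The tangential part of \<open>f\<close> does not contribute to the volume it spans with the \<open>v i\<close>.
\<close>

lemma abs_det_rowmat_normal:
  assumes "\<And>i. N \<bullet> v i = 0" "N \<bullet> N = 1" "det (rowmat N v) \<noteq> 0"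
  shows "\<bar>det (rowmat f v)\<bar> = \<bar>f \<bullet> N\<bar> * \<bar>det (rowmat N v)\<bar>"
proof -
  have "det (rowmat f v) = (f \<bullet> N) * det (rowmat N v)"
    using det_rowmat_normal[of N v, OF assms(1), of f] det_gram_normal[of N v, OF assms(1,2)] assms(3)
    by (simp add: power2_eq_square)
  then show ?thesis by (simp add: abs_mult)
qed

lemma det_rowmat_nonzero:
  assumes "\<And>i. N \<bullet> v i = 0" "N \<bullet> N = 1" and ind: "\<And>c. (\<Sum>i\<in>UNIV. c i *\<^sub>R v i) = 0 \<Longrightarrow> (\<forall>i. c i = 0)"
  shows "det (rowmat N v) \<noteq> 0"
proof -
  have "x = 0" if x: "transpose (rowmat N v) *v x = 0" for x
  proof -
    have eq: "x $ Base *\<^sub>R N + (\<Sum>i\<in>UNIV. x $ Ext i *\<^sub>R v i) = 0"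
      using x by (simp add: matrix_vector_mult_def transpose_def sum_ext rowmat_def vec_eq_iff mult.commute)
    then have "(x $ Base *\<^sub>R N + (\<Sum>i\<in>UNIV. x $ Ext i *\<^sub>R v i)) \<bullet> N = 0" by simp
    then have "x $ Base = 0"
      using assms(1,2) by (simp add: inner_add_right inner_sum_right inner_commute)
    then have "\<forall>i. x $ Ext i = 0" using eq ind[of "\<lambda>i. x $ Ext i"] by simp
    then show ?thesis using \<open>x $ Base = 0\<close> by (metis ext.exhaust vec_eq_iff zero_index)
  qed
  then have "invertible (transpose (rowmat N v))"
    using matrix_left_invertible_ker invertible_left_inverse by blast
  then show ?thesis by (simp add: invertible_det_nz)
qed

lemma det_rowmat_scale: "det (rowmat w (\<lambda>i. s *\<^sub>R v i)) = s ^ CARD('n) * det (rowmat w v)"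
  for v :: "'n::finite \<Rightarrow> real^'n ext"
proof -
  have "rowmat w (\<lambda>i. s *\<^sub>R v i) = (\<chi> k. (case k of Base \<Rightarrow> 1 | Ext i \<Rightarrow> s) *s (rowmat w v $ k))"
    by (intro matrix_ext_eqI) (auto simp: rowmat_def)
  then have "det (rowmat w (\<lambda>i. s *\<^sub>R v i)) =
     (\<Prod>k\<in>(UNIV :: 'n ext set). (case k of Base \<Rightarrow> 1 | Ext i \<Rightarrow> s)) * det (\<chi> k. rowmat w v $ k)"
    by (simp only: det_rows_mul)
  then show ?thesis by (simp add: prod_ext)
qed

lemma det_bordered_mat_1:
  fixes b c :: "real^'n::finite"
  shows "det (bordered d b c (mat 1)) = d - c \<bullet> b"
proof -
  have "bordered d b c (mat 1) = bordered 1 0 c (mat 1) ** bordered (d - c \<bullet> b) b 0 (mat 1)"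
    by (intro matrix_ext_eqI)
       (simp_all add: matrix_matrix_mult_def sum_ext mat_def inner_vec_def if_distrib[of "\<lambda>x. x * _"] if_distrib[of "\<lambda>x. _ * x"] cong: if_cong)
  then have "det (bordered d b c (mat 1)) = det (bordered 1 0 c (mat 1 :: real^'n^'n)) * det (bordered (d - c \<bullet> b) b 0 (mat 1))"
    by (simp add: det_mul)
  also have "det (bordered (d - c \<bullet> b) b 0 (mat 1)) = det (transpose (bordered (d - c \<bullet> b) b 0 (mat 1)))" by simp
  also have "transpose (bordered (d - c \<bullet> b) b 0 (mat 1)) = bordered (d - c \<bullet> b) 0 b (mat 1)"
    by (intro matrix_ext_eqI) (auto simp: transpose_def mat_def)
  finally show ?thesis by (simp add: det_block_Base)
qed

lemma det_scale: "det (\<chi> i j. c * (A :: real^'n^'n::finite) $ i $ j) = c ^ CARD('n) * det A"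
proof -
  have "(\<chi> i j. c * A $ i $ j) = (\<chi> i. c *s A $ i)" by (simp add: vec_eq_iff)
  then show ?thesis using det_rows_mul[of "\<lambda>i. c" "\<lambda>i. A $ i"] by simp
qed

section \<open>Change of variables between Cartesian spaces with different index types\<close>

text \<open>
  A linear bijection between the standard bases identifies coordinates only; it preserves inner
  products and Lebesgue measure, and it carries the change of variables theorem from well-ordered
  index types to \<open>'n\<close> and \<open>'m\<close>.
\<close>

definition basis_iso :: "('a::euclidean_space \<Rightarrow> 'b::euclidean_space) \<Rightarrow> bool" where
  "basis_iso T \<longleftrightarrow> linear T \<and> bij_betw T Basis Basis"

lemma basis_iso_linear: "basis_iso T \<Longrightarrow> linear T" by (simp add: basis_iso_def)

lemma basis_iso_inner_Basis:
  assumes "basis_iso T" "b \<in> Basis"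
  shows "T x \<bullet> T b = x \<bullet> b"
proof -
  have T: "linear T" "inj_on T Basis" "T ` Basis = Basis" using assms by (auto simp: basis_iso_def bij_betw_def)
  have "T x = T (\<Sum>c\<in>Basis. (x \<bullet> c) *\<^sub>R c)" by (simp add: euclidean_representation)
  also have "\<dots> = (\<Sum>c\<in>Basis. (x \<bullet> c) *\<^sub>R T c)" using T(1) by (simp add: linear_sum linear_cmul)
  finally have "T x \<bullet> T b = (\<Sum>c\<in>Basis. (x \<bullet> c) * (T c \<bullet> T b))" by (simp add: inner_sum_left)
  also have "\<dots> = (\<Sum>c\<in>Basis. if c = b then x \<bullet> b else 0)"
  proof (rule sum.cong)
    fix c :: 'a assume c: "c \<in> Basis"
    then have "T c \<in> Basis" "T b \<in> Basis" "T c = T b \<longleftrightarrow> c = b" using T assms(2) by (auto simp: inj_on_def)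
    then show "(x \<bullet> c) * (T c \<bullet> T b) = (if c = b then x \<bullet> b else 0)" by (auto simp: inner_Basis)
  qed simp
  finally show ?thesis using assms(2) by simp
qed

lemma basis_iso_inner:
  assumes "basis_iso T" shows "T x \<bullet> T y = x \<bullet> y"
proof -
  have T: "linear T" using assms by (rule basis_iso_linear)
  have "T y = T (\<Sum>c\<in>Basis. (y \<bullet> c) *\<^sub>R c)" by (simp add: euclidean_representation)
  also have "\<dots> = (\<Sum>c\<in>Basis. (y \<bullet> c) *\<^sub>R T c)" using T by (simp add: linear_sum linear_cmul)
  finally have "T x \<bullet> T y = (\<Sum>c\<in>Basis. (y \<bullet> c) * (x \<bullet> c))"
    by (simp add: inner_sum_right basis_iso_inner_Basis[OF assms])
  then show ?thesis by (simp add: euclidean_inner[of x y] mult.commute)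
qed

lemma basis_iso_bij:
  assumes "basis_iso T" shows "bij T"
proof (rule bijI)
  have T: "linear T" using assms by (rule basis_iso_linear)
  have "x = 0" if "T x = 0" for x using basis_iso_inner[OF assms, of x x] that by simp
  then show "inj T" using T linear_injective_0 by blast
  show "surj T"
  proof (rule surjI)
    fix y
    have "T (\<Sum>c\<in>Basis. (y \<bullet> T c) *\<^sub>R c) = (\<Sum>c\<in>Basis. (y \<bullet> T c) *\<^sub>R T c)"
      using T by (simp add: linear_sum linear_cmul)
    also have "\<dots> = (\<Sum>c\<in>Basis. (y \<bullet> c) *\<^sub>R c)"
      by (rule sum.reindex_bij_betw) (use assms in \<open>simp add: basis_iso_def\<close>)
    finally show "T (\<Sum>c\<in>Basis. (y \<bullet> T c) *\<^sub>R c) = y" by (simp add: euclidean_representation)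
  qed
qed

lemma basis_iso_measurable: "basis_iso T \<Longrightarrow> T \<in> borel_measurable borel"
  by (intro borel_measurable_continuous_onI linear_continuous_on)
     (simp add: basis_iso_linear linear_conv_bounded_linear[symmetric])

lemma basis_iso_distr_lborel:
  fixes T :: "'a::euclidean_space \<Rightarrow> 'b::euclidean_space"
  assumes "basis_iso T" shows "distr lborel borel T = lborel"
proof (rule lborel_eqI[symmetric])
  fix l u :: 'b assume lu: "\<And>b. b \<in> Basis \<Longrightarrow> l \<bullet> b \<le> u \<bullet> b"
  have bij: "bij_betw T Basis Basis" using assms by (simp add: basis_iso_def)
  define pull where "pull y = (\<Sum>b\<in>Basis. (y \<bullet> T b) *\<^sub>R b)" for y
  have pull: "pull y \<bullet> b = y \<bullet> T b" if "b \<in> Basis" for y b using that by (simp add: pull_def)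
  have "T -` box l u = box (pull l) (pull u)"
  proof (rule set_eqI)
    fix x
    have "x \<in> T -` box l u \<longleftrightarrow> (\<forall>c\<in>T ` Basis. l \<bullet> c < T x \<bullet> c \<and> T x \<bullet> c < u \<bullet> c)"
      using bij by (simp add: mem_box bij_betw_def)
    also have "\<dots> \<longleftrightarrow> x \<in> box (pull l) (pull u)"
      by (simp add: mem_box pull basis_iso_inner_Basis[OF assms])
    finally show "x \<in> T -` box l u \<longleftrightarrow> x \<in> box (pull l) (pull u)" .
  qed
  then have "emeasure (distr lborel borel T) (box l u) = emeasure lborel (box (pull l) (pull u))"
    using basis_iso_measurable[OF assms] by (simp add: emeasure_distr)
  also have "\<dots> = (\<Prod>b\<in>Basis. (pull u - pull l) \<bullet> b)"
  proof (rule emeasure_lborel_box)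
    fix b :: 'a assume "b \<in> Basis"
    then have "T b \<in> Basis" using bij by (auto simp: bij_betw_def)
    then show "pull l \<bullet> b \<le> pull u \<bullet> b" using lu \<open>b \<in> Basis\<close> by (simp add: pull)
  qed
  also have "(\<Prod>b\<in>Basis. (pull u - pull l) \<bullet> b) = (\<Prod>b\<in>Basis. (u - l) \<bullet> T b)"
    by (rule prod.cong) (auto simp: inner_diff_left pull)
  also have "\<dots> = (\<Prod>b\<in>Basis. (u - l) \<bullet> b)" by (rule prod.reindex_bij_betw[OF bij])
  finally show "emeasure (distr lborel borel T) (box l u) = (\<Prod>b\<in>Basis. (u - l) \<bullet> b)" .
qed simp

definition reindex :: "real^'m::finite \<Rightarrow> real^'k::finite" where
  "reindex y = (\<chi> k. y $ (SOME \<beta>. bij (\<beta> :: 'k \<Rightarrow> 'm)) k)"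

lemma basis_iso_reindex:
  assumes "CARD('m::finite) = CARD('k::finite)"
  shows "basis_iso (reindex :: real^'m \<Rightarrow> real^'k)"
proof -
  define \<beta> where "\<beta> = (SOME \<beta>. bij (\<beta> :: 'k \<Rightarrow> 'm))"
  have "\<exists>\<beta>. bij (\<beta> :: 'k \<Rightarrow> 'm)" using assms by (intro finite_same_card_bij) auto
  then have b: "bij \<beta>" unfolding \<beta>_def by (rule someI_ex)
  have R: "reindex y = (\<chi> k. y $ \<beta> k)" for y :: "real^'m" by (simp add: reindex_def \<beta>_def)
  have ax: "reindex (axis (\<beta> k) 1) = (axis k 1 :: real^'k)" for k
    using b by (auto simp: R axis_def vec_eq_iff bij_def inj_def)
  have Bm: "Basis = range (\<lambda>i. axis i 1 :: real^'m)" and Bk: "Basis = range (\<lambda>i. axis i 1 :: real^'k)"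
    by (auto simp: Basis_vec_def)

  have im: "(reindex :: real^'m \<Rightarrow> real^'k) ` Basis = Basis"
  proof -
    have "(reindex :: real^'m \<Rightarrow> real^'k) ` (\<lambda>i. axis i 1) ` (\<beta> ` UNIV) = range (\<lambda>k. axis k 1)"
      by (simp add: image_image ax)
    then show ?thesis using b by (simp only: Bm Bk bij_is_surj)
  qed
  have "inj_on (reindex :: real^'m \<Rightarrow> real^'k) Basis"
  proof (rule inj_onI)
    fix x y :: "real^'m" assume "reindex x = (reindex y :: real^'k)"
    then have "x $ \<beta> k = y $ \<beta> k" for k by (simp add: R vec_eq_iff)
    then have "x $ j = y $ j" for j using bij_is_surj[OF b] by (metis surjD)
    then show "x = y" by (simp add: vec_eq_iff)
  qed
  then show ?thesis using im
    unfolding basis_iso_def bij_betw_def by (auto intro!: linearI simp: R vec_eq_iff)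
qed

definition split_Base :: "real^'n::finite ext \<Rightarrow> (real^'n) \<times> real" where
  "split_Base z = ((\<chi> i. z $ Ext i), z $ Base)"

lemma split_Base_axis:
  "split_Base (axis Base 1) = (0, 1)" "split_Base (axis (Ext i) 1) = (axis i 1, 0)"
  by (auto simp: split_Base_def axis_def vec_eq_iff)

lemma basis_iso_split_Base: "basis_iso (split_Base :: real^'n::finite ext \<Rightarrow> _)"
proof -
  have "(split_Base :: real^'n ext \<Rightarrow> _) ` Basis = Basis"
  proof -
    have B1: "Basis = insert (axis Base 1) (range (\<lambda>i. axis (Ext i) 1 :: real^'n ext))"
      by (auto simp: Basis_vec_def UNIV_ext)
    have B2: "(Basis :: ((real^'n) \<times> real) set) = insert (0, 1) (range (\<lambda>i. (axis i 1, 0)))"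
      by (auto simp: Basis_prod_def Basis_vec_def)
    show ?thesis unfolding B1 B2 image_insert image_image split_Base_axis ..
  qed
  moreover have "inj_on (split_Base :: real^'n ext \<Rightarrow> _) Basis"
  proof (rule inj_onI)
    fix x y :: "real^'n ext" assume eq: "split_Base x = split_Base y"
    have "x $ k = y $ k" for k using eq by (cases k) (auto simp: split_Base_def vec_eq_iff)
    then show "x = y" by (simp add: vec_eq_iff)
  qed
  ultimately show ?thesis
    unfolding basis_iso_def bij_betw_def by (auto intro!: linearI simp: split_Base_def vec_eq_iff)
qed

text \<open>
  The absolute Jacobian determinant of a linear map into \<open>real^'m\<close>, for \<open>CARD('m) = CARD('n) + 1\<close>.
\<close>

definition jac :: "((real^'n::finite) \<times> real \<Rightarrow> real^'m::finite) \<Rightarrow> real" where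
  "jac L = \<bar>det (matrix ((reindex :: real^'m \<Rightarrow> real^'n ext) \<circ> L \<circ> split_Base))\<bar>"

lemma jac_rowmat:
  "jac L = \<bar>det (rowmat (reindex (L (0, 1))) (\<lambda>i. reindex (L (axis i 1, 0))))\<bar>"
proof -
  have "matrix (reindex \<circ> L \<circ> split_Base) =
      transpose (rowmat (reindex (L (0, 1))) (\<lambda>i. reindex (L (axis i 1, 0))))"
    by (intro matrix_ext_eqI) (simp_all add: matrix_def transpose_def rowmat_def split_Base_axis)
  then show ?thesis by (simp add: jac_def)
qed

text \<open>
  A map from a subset of \<open>(real^'n) \<times> real\<close> to \<open>real^'m\<close>, to which the change of variables theorem is
  transported from the self-map \<open>g\<close> of \<open>real^'n ext\<close>.
\<close>

locale parametrised_image =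
  fixes F :: "(real^'n::finite) \<times> real \<Rightarrow> real^'m::finite" and F' and S
  assumes card: "CARD('m) = CARD('n) + 1" and S: "S \<in> sets borel"
    and der: "\<And>z. z \<in> S \<Longrightarrow> (F has_derivative F' z) (at z within S)"
    and meas: "(\<lambda>z. indicator S z * jac (F' z)) \<in> borel_measurable borel"
begin

abbreviation R :: "real^'m \<Rightarrow> real^'n ext" where "R \<equiv> reindex"
abbreviation sp :: "real^'n ext \<Rightarrow> (real^'n) \<times> real" where "sp \<equiv> split_Base"

definition "S' = sp -` S"
definition "g = R \<circ> F \<circ> sp"
definition "g' z = R \<circ> F' (sp z) \<circ> sp"

lemma R: "basis_iso R" using card by (intro basis_iso_reindex) (simp add: CARD_ext)
lemma sp: "basis_iso sp" by (rule basis_iso_split_Base)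

lemma bounded_linear_R: "bounded_linear R" and bounded_linear_sp: "bounded_linear sp"
  using R sp by (simp_all add: basis_iso_linear linear_conv_bounded_linear[symmetric])

lemma S'_borel: "S' \<in> sets borel"
  unfolding S'_def using measurable_sets[OF basis_iso_measurable[OF sp], of S] S by simp

lemma der_g: "z \<in> S' \<Longrightarrow> (g has_derivative g' z) (at z within S')"
proof -
  assume "z \<in> S'"
  then have d: "(F has_derivative F' (sp z)) (at (sp z) within S)" by (simp add: der S'_def)
  have "(F has_derivative F' (sp z)) (at (sp z) within sp ` S')"
    by (rule has_derivative_subset[OF d]) (auto simp: S'_def)
  then have "((\<lambda>z. F (sp z)) has_derivative (\<lambda>h. F' (sp z) (sp h))) (at z within S')"
    by (rule has_derivative_in_compose[OF bounded_linear_imp_has_derivative[OF bounded_linear_sp]])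
  then show ?thesis
    unfolding g_def g'_def comp_def by (rule bounded_linear.has_derivative[OF bounded_linear_R])
qed

lemma image_g: "g ` S' = R ` F ` S"
proof -
  have "sp ` S' = S" unfolding S'_def using basis_iso_bij[OF sp] by (simp add: bij_is_surj surj_image_vimage_eq)
  then show ?thesis by (metis g_def image_comp)
qed

definition "h z = indicator S' z * \<bar>det (matrix (g' z))\<bar>"

lemma h_if: "h = (\<lambda>z. if z \<in> S' then \<bar>det (matrix (g' z))\<bar> else 0)"
  by (auto simp: h_def)

lemma h_eq: "h z = indicator S (sp z) * jac (F' (sp z))"
  by (simp add: h_def jac_def g'_def S'_def indicator_def)

lemma h_nonneg: "h z \<ge> 0" by (simp add: h_def)

lemma h_borel: "h \<in> borel_measurable borel"
  using measurable_compose[OF basis_iso_measurable[OF sp] meas] by (simp add: h_eq[abs_def])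

lemma nn_integral_h: "(\<integral>\<^sup>+z. h z \<partial>lborel) = (\<integral>\<^sup>+z\<in>S. jac (F' z) \<partial>lborel)"
proof -
  have "(\<integral>\<^sup>+z\<in>S. jac (F' z) \<partial>lborel) = (\<integral>\<^sup>+z. ennreal (indicator S z * jac (F' z)) \<partial>lborel)"
    by (intro nn_integral_cong) (auto simp: indicator_def)
  also have "\<dots> = (\<integral>\<^sup>+z. ennreal (indicator S z * jac (F' z)) \<partial>distr lborel borel sp)"
    by (simp add: basis_iso_distr_lborel[OF sp])
  also have "\<dots> = (\<integral>\<^sup>+z. h z \<partial>lborel)"
    using meas basis_iso_measurable[OF sp] by (subst nn_integral_distr) (simp_all add: h_eq)
  finally show ?thesis by simp
qed

lemma emeasure_vimage_R: "X \<in> sets borel \<Longrightarrow> emeasure lborel (R -` X) = emeasure lborel X"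
  using basis_iso_measurable[OF R] emeasure_distr[of R lborel borel X] basis_iso_distr_lborel[OF R] by simp

text \<open>
  The image need not be a Borel set and the map need not be injective; an open superset of almost the
  same measure is all that upper bounds for unions of such images require.
\<close>

lemma open_cover_of_image:
  assumes fin: "(\<integral>\<^sup>+z\<in>S. jac (F' z) \<partial>lborel) < \<infinity>" and e: "e > 0"
  obtains W where "open W" "F ` S \<subseteq> W" "emeasure lborel W \<le> (\<integral>\<^sup>+z\<in>S. jac (F' z) \<partial>lborel) + ennreal e"
proof -
  obtain r where r: "r \<ge> 0" "(\<integral>\<^sup>+z. h z \<partial>lborel) = ennreal r"
    using fin by (cases "\<integral>\<^sup>+z. h z \<partial>lborel" rule: ennreal_cases) (auto simp: nn_integral_h)
  have "(h has_integral r) UNIV"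
    by (rule nn_integral_has_integral[OF h_borel h_nonneg r(2,1)])
  then have int: "((\<lambda>z. \<bar>det (matrix (g' z))\<bar>) has_integral r) S'"
    unfolding h_if by (simp only: has_integral_restrict_UNIV)
  have S'l: "S' \<in> sets lebesgue" using S'_borel by simp
  have "g ` S' \<in> lmeasurable" "measure lebesgue (g ` S') \<le> r"
    using measurable_differentiable_image[OF S'l der_g] measure_differentiable_image[OF S'l der_g] int
    by (auto simp: has_integral_iff)
  then have gl: "g ` S' \<in> sets lebesgue" and gr: "emeasure lebesgue (g ` S') \<le> ennreal r"
    by (auto simp: emeasure_eq_measure2 intro: ennreal_leI)
  obtain T where T: "open T" "g ` S' \<subseteq> T" "T - g ` S' \<in> lmeasurable"
      "emeasure lebesgue (T - g ` S') < ennreal e"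
    using sets_lebesgue_outer_open[OF gl e] by blast
  show thesis
  proof (rule that[of "R -` T"])
    show "open (R -` T)"
      by (rule open_vimage[OF T(1)]) (simp add: linear_continuous_on bounded_linear_R)
    show "F ` S \<subseteq> R -` T" using T(2) image_g by auto
    have "emeasure lborel (R -` T) = emeasure lebesgue T" using T by (simp add: emeasure_vimage_R)
    also have "\<dots> \<le> emeasure lebesgue (g ` S' \<union> (T - g ` S'))"
      using T(1) gl by (intro emeasure_mono) auto
    also have "\<dots> \<le> emeasure lebesgue (g ` S') + emeasure lebesgue (T - g ` S')"
      using T(3) gl by (intro emeasure_subadditive) (auto dest: fmeasurableD)
    also have "\<dots> \<le> ennreal r + ennreal e" using gr T(4) by (intro add_mono) auto
    finally show "emeasure lborel (R -` T) \<le> (\<integral>\<^sup>+z\<in>S. jac (F' z) \<partial>lborel) + ennreal e"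
      using r nn_integral_h by simp
  qed
qed

lemma emeasure_inj_image:
  assumes inj: "inj_on F S" and FS: "F ` S \<in> sets borel" "bounded (F ` S)"
  shows "emeasure lborel (F ` S) = (\<integral>\<^sup>+z\<in>S. jac (F' z) \<partial>lborel)"
proof -
  have bR: "bij R" by (rule basis_iso_bij[OF R])
  have vi: "R -` (g ` S') = F ` S" using bR image_g by (simp add: inj_vimage_image_eq bij_is_inj)
  have "bounded_linear (inv R)"
    unfolding linear_conv_bounded_linear[symmetric]
  proof (rule linearI)
    have Ri: "R (inv R y) = y" for y using bR by (simp add: bij_is_surj surj_f_inv_f)
    show "inv R (x + y) = inv R x + inv R y" for x y
      by (rule inv_f_eq[OF bij_is_inj[OF bR]]) (simp add: linear_add[OF basis_iso_linear[OF R]] Ri)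
    show "inv R (c *\<^sub>R x) = c *\<^sub>R inv R x" for c x
      by (rule inv_f_eq[OF bij_is_inj[OF bR]]) (simp add: linear_cmul[OF basis_iso_linear[OF R]] Ri)
  qed
  then have "inv R \<in> borel_measurable borel"
    by (intro borel_measurable_continuous_onI linear_continuous_on)
  then have "inv R -` (F ` S) \<in> sets borel" using FS(1) measurable_sets[of "inv R" borel borel "F ` S"] by simp
  moreover have "inv R -` (F ` S) = g ` S'" using bR image_g by (simp add: bij_vimage_eq_inv_image bij_imp_bij_inv inv_inv_eq)
  ultimately have gb: "g ` S' \<in> sets borel" by simp
  moreover have "bounded (g ` S')" unfolding image_g by (rule bounded_linear_image[OF FS(2) bounded_linear_R])
  ultimately have gm: "g ` S' \<in> lmeasurable" by (intro bounded_set_imp_lmeasurable) auto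
  have "inj_on g S'"
  proof (rule inj_onI)
    fix x y assume "x \<in> S'" "y \<in> S'" "g x = g y"
    then have "sp x = sp y" using inj bij_is_inj[OF bR] by (auto simp: g_def S'_def inj_on_def)
    then show "x = y" using basis_iso_bij[OF sp] by (simp add: bij_def inj_def)
  qed
  then have "((\<lambda>z. \<bar>det (matrix (g' z))\<bar>) has_integral (measure lebesgue (g ` S'))) S'"
    using has_measure_differentiable_image[of S' g g' "measure lebesgue (g ` S')"] der_g S'_borel gm by simp
  then have "(h has_integral (measure lebesgue (g ` S'))) UNIV"
    unfolding h_if by (simp only: has_integral_restrict_UNIV)
  then have "(\<integral>\<^sup>+z. h z \<partial>lborel) = ennreal (measure lebesgue (g ` S'))"
    by (rule nn_integral_has_integral_lborel[OF h_borel h_nonneg])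
  also have "\<dots> = emeasure lebesgue (g ` S')" using gm by (simp add: emeasure_eq_measure2)
  also have "\<dots> = emeasure lborel (F ` S)" using emeasure_vimage_R[OF gb] gb by (simp add: vi)
  finally show ?thesis by (simp add: nn_integral_h)
qed

end

section \<open>Calculus of differentiable maps on open sets\<close>

lemma Ck_on_has_derivative:
  assumes "Ck_on (Suc k) f U" "open U" "x \<in> U"
  shows "(f has_derivative frechet_derivative f (at x)) (at x)"
  using assms by (simp add: differentiable_on_eq_differentiable_at frechet_derivative_works)

lemma Ck_on_cong:
  assumes "open U" "\<And>x. x \<in> U \<Longrightarrow> f x = g x" "Ck_on k f U"
  shows "Ck_on k g U"
  using assms(2,3)
proof (induction k arbitrary: f g)
  case 0
  then show ?case by (simp cong: continuous_on_cong)
next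
  case (Suc k)
  have d: "(g has_derivative frechet_derivative f (at x)) (at x)" if "x \<in> U" for x
    using Ck_on_has_derivative[OF Suc.prems(2) assms(1) that] assms(1) that Suc.prems(1)
    by (rule has_derivative_transform_within_open)
  then have e: "frechet_derivative f (at x) = frechet_derivative g (at x)" if "x \<in> U" for x
    using that frechet_derivative_at by blast
  have "g differentiable_on U"
    using d unfolding differentiable_on_eq_differentiable_at[OF assms(1)] differentiable_def by blast
  moreover have "Ck_on k (\<lambda>x. frechet_derivative g (at x) v) U" for v
    by (rule Suc.IH[of "\<lambda>x. frechet_derivative f (at x) v"]) (use e Suc.prems in auto)
  ultimately show ?case by simp
qed

lemma Ck_on_SucI:
  assumes U: "open U" and d: "\<And>x. x \<in> U \<Longrightarrow> (f has_derivative f' x) (at x)"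
    and C: "\<And>v. Ck_on k (\<lambda>x. f' x v) U"
  shows "Ck_on (Suc k) f U"
proof -
  have e: "f' x = frechet_derivative f (at x)" if "x \<in> U" for x
    using d[OF that] frechet_derivative_at by blast
  have "f differentiable_on U"
    using d unfolding differentiable_on_eq_differentiable_at[OF U] differentiable_def by blast
  moreover have "Ck_on k (\<lambda>x. frechet_derivative f (at x) v) U" for v
    by (rule Ck_on_cong[OF U _ C[of v]]) (simp add: e)
  ultimately show ?thesis by simp
qed

lemma Ck_on_SucD: "open U \<Longrightarrow> Ck_on (Suc k) f U \<Longrightarrow> Ck_on k f U"
proof (induction k arbitrary: f)
  case 0
  then show ?case by (auto intro: differentiable_imp_continuous_on)
next
  case (Suc k)
  then show ?case by (metis Ck_on.simps(2))
qed

lemma Ck_on_const: "open U \<Longrightarrow> Ck_on k (\<lambda>x. c) U"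
proof (induction k arbitrary: c)
  case (Suc k)
  then show ?case by (intro Ck_on_SucI[where f' = "\<lambda>x v. 0"]) auto
qed simp

lemma Ck_on_bounded_linear:
  assumes "open U" "bounded_linear L" shows "Ck_on k L U"
proof (cases k)
  case 0
  then show ?thesis using assms by (simp add: linear_continuous_on)
next
  case (Suc k')
  then show ?thesis
    using assms by (auto intro!: Ck_on_SucI[where f' = "\<lambda>x. L"] bounded_linear_imp_has_derivative Ck_on_const simp del: Ck_on.simps)
qed

lemma Ck_on_add:
  assumes "open U" "Ck_on k f U" "Ck_on k g U" shows "Ck_on k (\<lambda>x. f x + g x) U"
  using assms(2,3)
proof (induction k arbitrary: f g)
  case 0
  then show ?case by (auto intro: continuous_on_add)
next
  case (Suc k)
  show ?case
  proof (rule Ck_on_SucI[OF assms(1)])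
    fix x assume "x \<in> U"
    then show "((\<lambda>x. f x + g x) has_derivative
        (\<lambda>v. frechet_derivative f (at x) v + frechet_derivative g (at x) v)) (at x)"
      by (intro has_derivative_add Ck_on_has_derivative[OF Suc.prems(1) assms(1)] Ck_on_has_derivative[OF Suc.prems(2) assms(1)])
  qed (use Suc in auto)
qed

lemma Ck_on_compose_linear:
  assumes "open U" "Ck_on k f U" "bounded_linear L" shows "Ck_on k (\<lambda>x. L (f x)) U"
  using assms(2)
proof (induction k arbitrary: f)
  case 0
  then show ?case
    using continuous_on_compose2[OF linear_continuous_on[OF assms(3), of UNIV], of U f] by simp
next
  case (Suc k)
  show ?case
  proof (rule Ck_on_SucI[OF assms(1)])
    fix x assume "x \<in> U"
    then show "((\<lambda>x. L (f x)) has_derivative (\<lambda>v. L (frechet_derivative f (at x) v))) (at x)"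
      by (intro bounded_linear.has_derivative[OF assms(3)] Ck_on_has_derivative[OF Suc.prems assms(1)])
  qed (use Suc in auto)
qed

lemma Ck_on_scaleR:
  fixes f :: "'a::euclidean_space \<Rightarrow> real" and g :: "'a \<Rightarrow> 'b::real_normed_vector"
  assumes "open U" "Ck_on k f U" "Ck_on k g U" shows "Ck_on k (\<lambda>x. f x *\<^sub>R g x) U"
  using assms(2,3)
proof (induction k arbitrary: f g)
  case 0
  then show ?case by (auto intro: continuous_on_scaleR)
next
  case (Suc k)
  show ?case
  proof (rule Ck_on_SucI[OF assms(1)])
    fix x assume "x \<in> U"
    then show "((\<lambda>x. f x *\<^sub>R g x) has_derivative
        (\<lambda>v. f x *\<^sub>R frechet_derivative g (at x) v + frechet_derivative f (at x) v *\<^sub>R g x)) (at x)"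
      by (intro has_derivative_scaleR Ck_on_has_derivative[OF Suc.prems(1) assms(1)] Ck_on_has_derivative[OF Suc.prems(2) assms(1)])
  next
    fix v
    show "Ck_on k (\<lambda>x. f x *\<^sub>R frechet_derivative g (at x) v + frechet_derivative f (at x) v *\<^sub>R g x) U"
      using Suc.prems Ck_on_SucD[OF assms(1) Suc.prems(1)] Ck_on_SucD[OF assms(1) Suc.prems(2)]
      by (intro Ck_on_add Suc.IH assms(1)) auto
  qed
qed

lemma Ck_on_Pair:
  assumes "open U" "Ck_on k f U" "Ck_on k g U" shows "Ck_on k (\<lambda>x. (f x, g x)) U"
proof -
  have "Ck_on k (\<lambda>x. (f x, 0) + (0, g x)) U"
    by (intro Ck_on_add assms Ck_on_compose_linear[OF assms(1) assms(2), of "\<lambda>y. (y, 0)"]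
        Ck_on_compose_linear[OF assms(1) assms(3), of "\<lambda>y. (0, y)"])
      (auto intro!: bounded_linear_intros)
  then show ?thesis by simp
qed

text \<open>
  The exponent is arbitrary because differentiation lowers it by one. The exponents \<open>1/2\<close> and \<open>-1/2\<close>
  are the ones that occur: in the graph of the hyperboloid and in charts of the sphere.
\<close>

lemma Ck_on_powr_one_plus_norm:
  "Ck_on k (\<lambda>x::'a::euclidean_space. (1 + x \<bullet> x) powr a) UNIV"
proof (induction k arbitrary: a)
  case 0
  have "1 + x \<bullet> x \<noteq> 0" for x :: 'a using inner_ge_zero[of x] by linarith
  then show ?case by (auto intro!: continuous_intros)
next
  case (Suc k)
  show ?case
  proof (rule Ck_on_SucI[OF open_UNIV])
    fix x :: 'a
    have pos: "1 + x \<bullet> x > 0" using inner_ge_zero[of x] by linarith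
    show "((\<lambda>x. (1 + x \<bullet> x) powr a) has_derivative
       (\<lambda>v. ((1 + x \<bullet> x) powr (a - 1)) *\<^sub>R ((2 * a) *\<^sub>R (x \<bullet> v)))) (at x)"
      by (rule has_derivative_eq_rhs, (rule derivative_intros | rule pos)+)
         (use pos in \<open>auto simp: fun_eq_iff powr_diff inner_commute field_simps\<close>)
  next
    fix v :: 'a
    show "Ck_on k (\<lambda>x. ((1 + x \<bullet> x) powr (a - 1)) *\<^sub>R ((2 * a) *\<^sub>R (x \<bullet> v))) UNIV"
      by (intro Ck_on_scaleR Suc.IH Ck_on_bounded_linear) (auto intro!: bounded_linear_intros)
  qed
qed

lemma Ck_on_sqrt_one_plus_norm: "Ck_on k (\<lambda>x::'a::euclidean_space. sqrt (1 + x \<bullet> x)) UNIV"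
proof -
  have "(1 + x \<bullet> x) powr (1 / 2) = sqrt (1 + x \<bullet> x)" for x :: 'a
    using inner_ge_zero[of x] by (intro powr_half_sqrt) linarith
  then show ?thesis using Ck_on_powr_one_plus_norm[where k = k and a = "1 / 2" and 'a = 'a] by simp
qed

lemma Ck1_powr:
  assumes U: "open U" and u: "Ck_on (Suc 0) u U" "\<And>x. x \<in> U \<Longrightarrow> u x > (0::real)"
  shows "Ck_on (Suc 0) (\<lambda>x. u x powr a) U"
proof (rule Ck_on_SucI[OF U])
  fix x assume x: "x \<in> U"
  have d: "(u has_derivative frechet_derivative u (at x)) (at x)" by (rule Ck_on_has_derivative[OF u(1) U x])
  show "((\<lambda>x. u x powr a) has_derivative (\<lambda>v. (a * u x powr (a - 1)) * frechet_derivative u (at x) v)) (at x)"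
    by (rule has_derivative_eq_rhs, rule has_derivative_powr[OF d has_derivative_const u(2)[OF x]])
       (use u(2)[OF x] x in \<open>auto simp: fun_eq_iff powr_diff field_simps\<close>)
next
  fix v
  have "continuous_on U u" using Ck_on_SucD[OF U u(1)] by simp
  moreover have "continuous_on U (\<lambda>x. frechet_derivative u (at x) v)" using u(1) by simp
  ultimately show "Ck_on 0 (\<lambda>x. (a * u x powr (a - 1)) * frechet_derivative u (at x) v) U"
    using u(2) by (auto intro!: continuous_intros) (metis less_irrefl)+
qed

section \<open>Integration over compact submanifolds\<close>

lemma patch_Ck1:
  assumes "patch M U \<phi>" shows "open U" "Ck_on (Suc 0) \<phi> U" "Ck_on (Suc 0) (\<lambda>x. frechet_derivative \<phi> (at x) v) U"
proof -
  show U: "open U" using assms by (simp add: patch_def)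
  have C: "Ck_on (Suc (Suc 0)) \<phi> U" using assms by (simp add: patch_def numeral_2_eq_2)
  show "Ck_on (Suc 0) \<phi> U" by (rule Ck_on_SucD[OF U C])
  show "Ck_on (Suc 0) (\<lambda>x. frechet_derivative \<phi> (at x) v) U" using C by simp
qed

lemma patch_has_derivative:
  assumes "patch M U \<phi>" "x \<in> U"
  shows "(\<phi> has_derivative frechet_derivative \<phi> (at x)) (at x)"
  using Ck_on_has_derivative[OF patch_Ck1(2,1)[OF assms(1)] assms(2)] .

lemma patch_continuous_on_derivative:
  assumes "patch M U \<phi>" shows "continuous_on U (\<lambda>x. frechet_derivative \<phi> (at x) v)"
  using Ck_on_SucD[OF patch_Ck1(1,3)[OF assms]] by simp

lemma patch_continuous_on:
  assumes "patch M U \<phi>" shows "continuous_on U \<phi>"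
  using Ck_on_SucD[OF patch_Ck1(1,2)[OF assms]] by simp

lemma patch_inj_on:
  assumes "patch M U \<phi>" shows "inj_on \<phi> U"
  using assms unfolding patch_def homeomorphism_def by (metis inj_on_inverseI)

lemma patch_image_subset: "patch M U \<phi> \<Longrightarrow> \<phi> ` U \<subseteq> M"
  unfolding patch_def using openin_imp_subset by blast

lemma patch_openin_image:
  assumes "patch M U \<phi>" "open V" "V \<subseteq> U"
  shows "openin (top_of_set M) (\<phi> ` V)"
proof -
  obtain \<psi> where h: "homeomorphism U (\<phi> ` U) \<phi> \<psi>" and o: "openin (top_of_set M) (\<phi> ` U)"
    using assms(1) by (auto simp: patch_def)
  have "openin (top_of_set U) V" using assms patch_Ck1(1)[OF assms(1)] by (simp add: openin_open_eq)
  then have "openin (top_of_set (\<phi> ` U)) (\<phi> ` V)" by (rule homeomorphism_imp_open_map[OF h])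
  then show ?thesis using o by (rule openin_trans)
qed

lemma patch_image_borel:
  assumes p: "patch M U \<phi>" and M: "closed M" and A: "A \<in> sets borel" "A \<subseteq> U"
  shows "\<phi> ` A \<in> sets borel"
proof -
  obtain \<psi> where h: "homeomorphism U (\<phi> ` U) \<phi> \<psi>" and o: "openin (top_of_set M) (\<phi> ` U)"
    using p by (auto simp: patch_def)
  obtain T where T: "open T" "\<phi> ` U = M \<inter> T" using o by (auto simp: openin_open)
  then have UB: "\<phi> ` U \<in> sets borel" using M by auto
  have "continuous_on (\<phi> ` U) \<psi>" using h by (simp add: homeomorphism_def)
  then have "\<psi> \<in> borel_measurable (restrict_space borel (\<phi> ` U))"
    by (rule borel_measurable_continuous_on_restrict)
  then have "\<psi> -` A \<inter> space (restrict_space borel (\<phi> ` U)) \<in> sets (restrict_space borel (\<phi> ` U))"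
    using A(1) by (rule measurable_sets)
  then have "\<psi> -` A \<inter> \<phi> ` U \<in> sets borel"
    using UB by (auto simp: space_restrict_space sets_restrict_space_iff)
  moreover have "\<psi> -` A \<inter> \<phi> ` U = \<phi> ` A"
    using h A(2) unfolding homeomorphism_def by force
  ultimately show ?thesis by simp
qed

lemma gram_det_continuous_on:
  assumes p: "patch M U \<phi>" and B: "\<And>g h. continuous_on U g \<Longrightarrow> continuous_on U h \<Longrightarrow> continuous_on U (\<lambda>x. B (g x) (h x))"
  shows "continuous_on U (gram_det B \<phi>)"
  unfolding gram_det_def[abs_def] det_def
  by (auto intro!: continuous_intros B patch_continuous_on_derivative[OF p])

lemma continuous_on_mink:
  assumes "continuous_on U g" "continuous_on U h"
  shows "continuous_on U (\<lambda>x. mink (g x) (h x))"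
  unfolding mink_def by (intro continuous_intros assms)

lemma borel_indicator_times_continuous_on:
  fixes g :: "'a::euclidean_space \<Rightarrow> real"
  assumes "continuous_on U g" "A \<in> sets borel" "A \<subseteq> U"
  shows "(\<lambda>x. indicator A x * g x) \<in> borel_measurable borel"
  using borel_measurable_continuous_on_indicator[OF assms(2) continuous_on_subset[OF assms(1,3)]] by simp

text \<open>
  A finite partition of \<open>M\<close> into Borel sets, each inside one patch. The compact sets \<open>C k\<close> give
  uniform bounds for continuous functions of the parameter.
\<close>

definition pieces ::
    "'e::euclidean_space set \<Rightarrow> nat \<Rightarrow> (nat \<Rightarrow> (real^'n::finite) set) \<Rightarrow> (nat \<Rightarrow> real^'n \<Rightarrow> 'e) \<Rightarrow>
     (nat \<Rightarrow> (real^'n) set) \<Rightarrow> (nat \<Rightarrow> (real^'n) set) \<Rightarrow> bool" where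
  "pieces M K U \<phi> C A \<longleftrightarrow>
     (\<forall>k<K. patch M (U k) (\<phi> k) \<and> compact (C k) \<and> C k \<subseteq> U k \<and> A k \<subseteq> C k \<and> A k \<in> sets borel) \<and>
     disjoint_family_on (\<lambda>k. \<phi> k ` A k) {..<K} \<and> (\<Union>k<K. \<phi> k ` A k) = M"

lemma compact_submanifold_pieces:
  fixes M :: "'e::euclidean_space set"
  assumes M: "compact M" and sub: "submanifold TYPE('n::finite) M"
  obtains K U \<phi> C A where "pieces M K (U :: nat \<Rightarrow> (real^'n) set) \<phi> C A"
proof -
  have "\<exists>U (\<phi> :: real^'n \<Rightarrow> 'e) x r. patch M U \<phi> \<and> \<phi> x = p \<and> 0 < r \<and> cball x r \<subseteq> U" if "p \<in> M" for p
  proof -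
    have "\<exists>U (\<phi> :: real^'n \<Rightarrow> 'e). patch M U \<phi> \<and> p \<in> \<phi> ` U"
      using bspec[OF sub[unfolded submanifold_def] that] .
    then obtain U and \<phi> :: "real^'n \<Rightarrow> 'e" where p: "patch M U \<phi>" "p \<in> \<phi> ` U"
      by (elim exE conjE)
    obtain x where x: "x \<in> U" "\<phi> x = p" using p(2) by (elim imageE) simp
    obtain r where "r > 0" "cball x r \<subseteq> U"
      using x(1) patch_Ck1(1)[OF p(1)] open_contains_cball_eq by blast
    then show ?thesis using p(1) x(2) by (intro exI[of _ U] exI[of _ \<phi>] exI[of _ x] exI[of _ r]) simp
  qed
  then obtain u :: "'e \<Rightarrow> (real^'n) set" and f x r where
    u: "\<And>p. p \<in> M \<Longrightarrow> patch M (u p) (f p) \<and> f p (x p) = p \<and> 0 < r p \<and> cball (x p) (r p) \<subseteq> u p"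
    by metis
  define b where "b p = ball (x p) (r p)" for p
  have b: "open (b p)" "b p \<subseteq> cball (x p) (r p)" for p by (auto simp: b_def)
  have op: "openin (top_of_set M) (f p ` b p)" if "p \<in> M" for p
    using u[OF that] b by (intro patch_openin_image) auto
  have cov: "M \<subseteq> \<Union>((\<lambda>p. f p ` b p) ` M)"
  proof
    fix p assume "p \<in> M"
    then have "f p (x p) = p" "x p \<in> b p" using u by (auto simp: b_def)
    then show "p \<in> \<Union>((\<lambda>p. f p ` b p) ` M)" using \<open>p \<in> M\<close> by (metis UN_I imageI)
  qed
  obtain D where D: "finite D" "D \<subseteq> (\<lambda>p. f p ` b p) ` M" "M \<subseteq> \<Union>D"
    using M[unfolded compact_eq_openin_cover] cov op by (metis (mono_tags, lifting) imageE)
  obtain P where P: "P \<subseteq> M" "finite P" "D = (\<lambda>p. f p ` b p) ` P"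
    using finite_subset_image[OF D(1,2)] by blast
  obtain K and q :: "nat \<Rightarrow> 'e" where q: "P = q ` {i. i < K}"
    using finite_imp_nat_seg_image_inj_on[OF P(2)] by auto
  have qM: "q k \<in> M" if "k < K" for k using q P that by auto
  define V where "V k = f (q k) ` b (q k)" for k
  \<comment> \<open>The patches overlap; disjointness is achieved by removing from each image all earlier ones.\<close>
  define A where "A k = b (q k) - (\<Union>j<k. b (q k) \<inter> f (q k) -` V j)" for k
  have fA: "f (q k) ` A k = V k - (\<Union>j<k. V j)" for k
    by (auto simp: A_def V_def)
  have UV: "(\<Union>k<K. V k) = M"
  proof
    show "(\<Union>k<K. V k) \<subseteq> M" using op qM openin_imp_subset unfolding V_def by blast
    have "{i. i < K} = {..<K}" by auto
    then show "M \<subseteq> (\<Union>k<K. V k)" using D(3) P(3) q by (simp add: V_def)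
  qed
  have "pieces M K (\<lambda>k. u (q k)) (\<lambda>k. f (q k)) (\<lambda>k. cball (x (q k)) (r (q k))) A"
    unfolding pieces_def
  proof (intro conjI allI impI)
    fix k assume k: "k < K"
    show "patch M (u (q k)) (f (q k))" "cball (x (q k)) (r (q k)) \<subseteq> u (q k)" using u qM[OF k] by auto
    show "A k \<subseteq> cball (x (q k)) (r (q k))" using b(2) by (auto simp: A_def)
    have "open (b (q k) \<inter> f (q k) -` V j)" if "j < k" for j
    proof -
      have "continuous_on (b (q k)) (f (q k))"
        using u[OF qM[OF k]] b(2) by (meson continuous_on_subset patch_continuous_on)
      moreover have "f (q k) ` b (q k) \<subseteq> M" using op[OF qM[OF k]] openin_imp_subset by blast
      moreover have "openin (top_of_set M) (V j)" unfolding V_def using op qM k that by simp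
      ultimately have "openin (top_of_set (b (q k))) (b (q k) \<inter> f (q k) -` V j)"
        by (intro continuous_openin_preimage) auto
      then show ?thesis using b(1) openin_open_trans by blast
    qed
    then show "A k \<in> sets borel" using b(1) unfolding A_def by (intro sets.Diff sets.finite_UN) auto
  next
    show "disjoint_family_on (\<lambda>k. f (q k) ` A k) {..<K}"
      unfolding disjoint_family_on_def fA
    proof (intro ballI impI)
      fix m n :: nat assume "m \<noteq> n"
      then consider "m < n" | "n < m" by linarith
      then show "(V m - \<Union> (V ` {..<m})) \<inter> (V n - \<Union> (V ` {..<n})) = {}" by cases auto
    qed
    have "y \<in> (\<Union>k<K. V k - (\<Union>j<k. V j))" if yM: "y \<in> M" for y
    proof -
      obtain k where k: "k < K" "y \<in> V k" using yM unfolding UV[symmetric] by auto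
      define m where "m = (LEAST k. y \<in> V k)"
      have "y \<in> V m" "m \<le> k" using k by (auto simp: m_def intro: LeastI Least_le)
      moreover have "y \<notin> V j" if "j < m" for j using that not_less_Least unfolding m_def by blast
      ultimately show ?thesis using k by (auto intro!: bexI[of _ m])
    qed
    then show "(\<Union>k<K. f (q k) ` A k) = M" unfolding fA using UV by blast
  qed auto
  then show thesis by (rule that)
qed

text \<open>
  The definition of a Riemannian measure prescribes the measure of images of Borel sets. Hence the
  restriction of \<open>\<mu>\<close> to \<open>\<phi> ` A\<close> is the image under \<open>\<phi>\<close> of the measure with density
  \<open>sqrt (gram_det B \<phi>)\<close> on \<open>A\<close>, and so are integrals.
\<close>

lemma riemannian_measure_patch_integral:
  fixes \<mu> :: "'e::euclidean_space measure" and \<phi> :: "real^'n::finite \<Rightarrow> 'e" and g :: "'e \<Rightarrow> real"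
  assumes rm: "riemannian_measure TYPE('n) B M \<mu>" and M: "closed M" and p: "patch M U \<phi>"
    and A: "A \<in> sets borel" "A \<subseteq> U"
    and B: "\<And>g h. continuous_on U g \<Longrightarrow> continuous_on U h \<Longrightarrow> continuous_on U (\<lambda>x. B (g x) (h x))"
    and g: "(\<lambda>p. indicator M p * g p) \<in> borel_measurable borel" "\<And>p. p \<in> M \<Longrightarrow> g p \<ge> 0"
  shows "(\<integral>\<^sup>+p\<in>\<phi> ` A. ennreal (g p) \<partial>\<mu>) =
     (\<integral>\<^sup>+x\<in>A. ennreal (g (\<phi> x) * sqrt (gram_det B \<phi> x)) \<partial>lborel)"
proof -
  have sp: "space \<mu> = M" and se: "sets \<mu> = sets (restrict_space borel M)"
    using rm by (auto simp: riemannian_measure_def)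
  have em: "emeasure \<mu> (\<phi> ` A') = (\<integral>\<^sup>+ x\<in>A'. ennreal (sqrt (gram_det B \<phi> x)) \<partial>lborel)"
    if "A' \<in> sets borel" "A' \<subseteq> U" for A' using rm p that by (auto simp: riemannian_measure_def)
  have idm: "(\<lambda>p. p) \<in> measurable \<mu> borel"
    unfolding measurable_cong_sets[OF se refl] by (rule measurable_restrict_space1) simp
  have AU: "\<phi> ` A \<subseteq> M" using patch_image_subset[OF p] A by blast
  have pA: "\<phi> ` A \<in> sets borel" by (rule patch_image_borel[OF p M A])
  have pA': "\<phi> ` A \<in> sets \<mu>" using pA AU M unfolding se by (auto simp: sets_restrict_space_iff)
  \<comment> \<open>Outside \<open>A\<close> the value \<open>0\<close> is harmless, since the density \<open>w\<close> below vanishes there.\<close>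
  define \<phi>A where "\<phi>A x = indicator A x *\<^sub>R \<phi> x" for x
  have mA: "\<phi>A \<in> borel_measurable borel"
    unfolding \<phi>A_def[abs_def] by (rule borel_measurable_continuous_on_indicator[OF A(1) continuous_on_subset[OF patch_continuous_on[OF p] A(2)]])
  define w where "w x = indicator A x * sqrt (gram_det B \<phi> x)" for x
  have wm: "w \<in> borel_measurable borel"
    unfolding w_def[abs_def]
    by (rule borel_indicator_times_continuous_on[OF _ A]) (intro continuous_intros gram_det_continuous_on[OF p B])
  define \<mu>1 where "\<mu>1 = distr (density \<mu> (indicator (\<phi> ` A))) borel (\<lambda>p. p)"
  define \<mu>2 where "\<mu>2 = distr (density lborel (\<lambda>x. ennreal (w x))) borel \<phi>A"
  have "\<mu>1 = \<mu>2"
  proof (rule measure_eqI)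
    show "sets \<mu>1 = sets \<mu>2" by (simp add: \<mu>1_def \<mu>2_def)
    fix E assume "E \<in> sets \<mu>1"
    then have E: "E \<in> sets borel" by (simp add: \<mu>1_def)
    define A' where "A' = A \<inter> \<phi>A -` E"
    have A': "A' \<in> sets borel" "A' \<subseteq> U" using A measurable_sets[OF mA E] by (auto simp: A'_def)
    have im: "\<phi> ` A' = E \<inter> \<phi> ` A" by (auto simp: A'_def \<phi>A_def)
    have ES: "E \<inter> space \<mu> \<in> sets \<mu>" using measurable_sets[OF idm E] by (simp add: vimage_def Int_def)
    have "emeasure \<mu>1 E = emeasure (density \<mu> (indicator (\<phi> ` A))) (E \<inter> space \<mu>)"
      using E idm by (simp add: \<mu>1_def emeasure_distr vimage_def Int_def)
    also have "\<dots> = (\<integral>\<^sup>+p. indicator (\<phi> ` A) p * indicator (E \<inter> space \<mu>) p \<partial>\<mu>)"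
      using pA' ES by (intro emeasure_density) auto
    also have "\<dots> = (\<integral>\<^sup>+p. indicator (\<phi> ` A') p \<partial>\<mu>)"
      using AU sp by (intro nn_integral_cong) (auto simp: im indicator_def)
    also have "\<dots> = emeasure \<mu> (\<phi> ` A')"
    proof (rule nn_integral_indicator)
      show "\<phi> ` A' \<in> sets \<mu>" using patch_image_borel[OF p M A'] AU M unfolding se im by (auto simp: sets_restrict_space_iff)
    qed
    also have "\<dots> = (\<integral>\<^sup>+ x\<in>A'. ennreal (sqrt (gram_det B \<phi> x)) \<partial>lborel)" by (rule em[OF A'])
    also have "\<dots> = (\<integral>\<^sup>+x. ennreal (w x) * indicator (\<phi>A -` E) x \<partial>lborel)"
      by (intro nn_integral_cong) (auto simp: w_def A'_def indicator_def)
    also have "\<dots> = emeasure \<mu>2 E"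
      using E mA wm measurable_sets[OF mA E] by (simp add: \<mu>2_def emeasure_distr emeasure_density)
    finally show "emeasure \<mu>1 E = emeasure \<mu>2 E" .
  qed
  define G where "G p = ennreal (indicator M p * g p)" for p
  have Gm: "G \<in> borel_measurable borel" unfolding G_def[abs_def] using g(1) by simp
  have "(\<integral>\<^sup>+p. G p \<partial>\<mu>1) = (\<integral>\<^sup>+p. indicator (\<phi> ` A) p * G p \<partial>\<mu>)"
    unfolding \<mu>1_def using Gm idm pA' measurable_compose[OF idm Gm]
    by (subst nn_integral_distr) (auto simp: nn_integral_density)
  also have "\<dots> = (\<integral>\<^sup>+p\<in>\<phi> ` A. ennreal (g p) \<partial>\<mu>)"
    using AU by (intro nn_integral_cong) (auto simp: G_def indicator_def)
  finally have 1: "(\<integral>\<^sup>+p. G p \<partial>\<mu>1) = (\<integral>\<^sup>+p\<in>\<phi> ` A. ennreal (g p) \<partial>\<mu>)" .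
  have "(\<integral>\<^sup>+p. G p \<partial>\<mu>2) = (\<integral>\<^sup>+x. ennreal (w x) * G (\<phi>A x) \<partial>lborel)"
    unfolding \<mu>2_def using Gm mA wm measurable_compose[OF mA Gm]
    by (subst nn_integral_distr) (auto simp: nn_integral_density)
  also have "\<dots> = (\<integral>\<^sup>+x\<in>A. ennreal (g (\<phi> x) * sqrt (gram_det B \<phi> x)) \<partial>lborel)"
  proof (intro nn_integral_cong)
    fix x
    show "ennreal (w x) * G (\<phi>A x) = ennreal (g (\<phi> x) * sqrt (gram_det B \<phi> x)) * indicator A x"
    proof (cases "x \<in> A")
      case True
      then have "\<phi> x \<in> M" using AU by blast
      then show ?thesis using True g(2)[of "\<phi> x"] by (simp add: w_def G_def \<phi>A_def ennreal_mult' mult.commute)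
    qed (simp add: w_def)
  qed
  finally show ?thesis using 1 \<open>\<mu>1 = \<mu>2\<close> by simp
qed

lemma riemannian_measure_integral:
  fixes \<mu> :: "'e::euclidean_space measure" and \<phi> :: "nat \<Rightarrow> real^'n::finite \<Rightarrow> 'e" and g :: "'e \<Rightarrow> real"
  assumes rm: "riemannian_measure TYPE('n) B M \<mu>" and M: "closed M" and p: "pieces M K U \<phi> C A"
    and B: "\<And>(U::(real^'n) set) g h. continuous_on U g \<Longrightarrow> continuous_on U h \<Longrightarrow> continuous_on U (\<lambda>x. B (g x) (h x))"
    and g: "continuous_on M g" "\<And>p. p \<in> M \<Longrightarrow> g p \<ge> 0"
  shows "(\<integral>\<^sup>+p. ennreal (g p) \<partial>\<mu>) =
     (\<Sum>k<K. \<integral>\<^sup>+x\<in>A k. ennreal (g (\<phi> k x) * sqrt (gram_det B (\<phi> k) x)) \<partial>lborel)"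
proof -
  have sp: "space \<mu> = M" and se: "sets \<mu> = sets (restrict_space borel M)"
    using rm by (auto simp: riemannian_measure_def)
  have gm: "(\<lambda>p. indicator M p * g p) \<in> borel_measurable borel"
    using borel_measurable_continuous_on_indicator[OF _ g(1)] M by simp
  have gm': "g \<in> borel_measurable \<mu>"
    unfolding measurable_cong_sets[OF se refl] by (rule borel_measurable_continuous_on_restrict[OF g(1)])
  have pk: "patch M (U k) (\<phi> k)" "A k \<in> sets borel" "A k \<subseteq> U k" if "k < K" for k
    using p that by (auto simp: pieces_def)
  have AM: "\<phi> k ` A k \<in> sets \<mu>" if "k < K" for k
  proof -
    have "\<phi> k ` A k \<subseteq> M" using patch_image_subset[OF pk(1)] pk(3) that by blast
    then show ?thesis using patch_image_borel[OF pk(1) M pk(2,3)] that M unfolding se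
      by (auto simp: sets_restrict_space_iff)
  qed
  have "(\<integral>\<^sup>+p. ennreal (g p) \<partial>\<mu>) = (\<integral>\<^sup>+p. (\<Sum>k<K. ennreal (g p) * indicator (\<phi> k ` A k) p) \<partial>\<mu>)"
  proof (rule nn_integral_cong)
    fix q assume "q \<in> space \<mu>"
    then have "q \<in> M" using sp by simp
    moreover have "(\<Sum>k<K. indicator (\<phi> k ` A k) q) = (indicator M q :: ennreal)"
      using p unfolding pieces_def by (metis indicator_UN_disjoint finite_lessThan)
    ultimately have "(\<Sum>k<K. indicator (\<phi> k ` A k) q) = (1 :: ennreal)" by simp
    then show "ennreal (g q) = (\<Sum>k<K. ennreal (g q) * indicator (\<phi> k ` A k) q)"
      by (simp add: sum_distrib_left[symmetric])
  qed
  also have "\<dots> = (\<Sum>k<K. \<integral>\<^sup>+p\<in>\<phi> k ` A k. ennreal (g p) \<partial>\<mu>)"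
    by (rule nn_integral_sum) (use gm' AM in auto)
  also have "\<dots> = (\<Sum>k<K. \<integral>\<^sup>+x\<in>A k. ennreal (g (\<phi> k x) * sqrt (gram_det B (\<phi> k) x)) \<partial>lborel)"
    by (rule sum.cong) (auto intro!: riemannian_measure_patch_integral[OF rm M pk(1) pk(2,3) B gm g(2)])
  finally show ?thesis .
qed

section \<open>The volume swept out by a moving hypersurface\<close>

lemma continuous_on_det_rowmat:
  fixes w :: "'z::topological_space \<Rightarrow> real^'n::finite ext"
  assumes "continuous_on S w" "\<And>i. continuous_on S (\<lambda>z. v z i)"
  shows "continuous_on S (\<lambda>z. det (rowmat (w z) (v z)))"
proof -
  have "continuous_on S (\<lambda>z. rowmat (w z) (v z) $ k $ l)" for k l
    using assms by (cases k) (auto simp: rowmat_def intro!: continuous_intros)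
  then show ?thesis unfolding det_def
    by (intro continuous_on_sum continuous_on_mult continuous_on_prod continuous_on_const)
qed

text \<open>
  The volume spanned by \<open>w\<close> and the images of the unit vectors under \<open>L\<close>.
\<close>

definition frame_volume :: "real^'m::finite \<Rightarrow> (real^'n::finite \<Rightarrow> real^'m) \<Rightarrow> real" where
  "frame_volume w L = \<bar>det (rowmat (reindex w) (\<lambda>i. reindex (L (axis i 1))))\<bar>"

lemma frame_volume_nonneg: "frame_volume w L \<ge> 0" by (simp add: frame_volume_def)

lemma bounded_linear_reindex:
  assumes "CARD('m::finite) = CARD('n::finite) + 1"
  shows "bounded_linear (reindex :: real^'m \<Rightarrow> real^'n ext)"
proof -
  have "basis_iso (reindex :: real^'m \<Rightarrow> real^'n ext)"
    using assms by (intro basis_iso_reindex) (simp add: CARD_ext)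
  then show ?thesis by (simp add: basis_iso_linear linear_conv_bounded_linear[symmetric])
qed

lemma continuous_on_frame_volume:
  fixes w :: "'z::topological_space \<Rightarrow> real^'m::finite" and L :: "'z \<Rightarrow> real^'n::finite \<Rightarrow> real^'m"
  assumes card: "CARD('m) = CARD('n) + 1"
    and "continuous_on S w" "\<And>v. continuous_on S (\<lambda>z. L z v)"
  shows "continuous_on S (\<lambda>z. frame_volume (w z) (L z))"
proof -
  have "continuous_on UNIV (reindex :: real^'m \<Rightarrow> real^'n ext)"
    by (rule linear_continuous_on[OF bounded_linear_reindex[OF card]])
  then have R: "continuous_on S (\<lambda>z. reindex (g z) :: real^'n ext)" if "continuous_on S g" for g :: "'z \<Rightarrow> real^'m"
    using continuous_on_compose2[OF _ that] by blast
  show ?thesis unfolding frame_volume_def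
    by (intro continuous_intros continuous_on_det_rowmat R assms)
qed

text \<open>
  A parametrization \<open>f\<close> of a hypersurface of \<open>real^'m\<close> together with a continuously differentiable
  vector field \<open>X\<close> along it.
\<close>

locale field_along =
  fixes f X :: "real^'n::finite \<Rightarrow> real^'m::finite" and f' X' and U :: "(real^'n) set"
  assumes card: "CARD('m) = CARD('n) + 1" and U: "open U"
    and df: "\<And>x. x \<in> U \<Longrightarrow> (f has_derivative f' x) (at x)"
    and dX: "\<And>x. x \<in> U \<Longrightarrow> (X has_derivative X' x) (at x)"
    and cf: "\<And>v. continuous_on U (\<lambda>x. f' x v)"
    and cX: "\<And>v. continuous_on U (\<lambda>x. X' x v)"
begin

lemma cont_X: "continuous_on U X"
  using dX by (meson continuous_at_imp_continuous_on has_derivative_continuous)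

definition F :: "(real^'n) \<times> real \<Rightarrow> real^'m" where "F z = f (fst z) + snd z *\<^sub>R X (fst z)"

definition F' :: "(real^'n) \<times> real \<Rightarrow> (real^'n) \<times> real \<Rightarrow> real^'m" where
  "F' z v = f' (fst z) (fst v) + (snd z *\<^sub>R X' (fst z) (fst v) + snd v *\<^sub>R X (fst z))"

lemma F_has_derivative:
  assumes "fst z \<in> U" shows "(F has_derivative F' z) (at z within S)"
proof -
  have d1: "((\<lambda>z. f (fst z)) has_derivative (\<lambda>v. f' (fst z) (fst v))) (at z within S)"
    by (rule has_derivative_compose[OF has_derivative_fst[OF has_derivative_ident] df[OF assms]])
  have d2: "((\<lambda>z. X (fst z)) has_derivative (\<lambda>v. X' (fst z) (fst v))) (at z within S)"
    by (rule has_derivative_compose[OF has_derivative_fst[OF has_derivative_ident] dX[OF assms]])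
  show ?thesis unfolding F_def[abs_def] F'_def[abs_def]
    by (rule has_derivative_add[OF d1 has_derivative_scaleR[OF has_derivative_snd[OF has_derivative_ident] d2]])
qed

lemma jac_F':
  assumes "fst z \<in> U"
  shows "jac (F' z) = frame_volume (X (fst z)) (\<lambda>v. f' (fst z) v + snd z *\<^sub>R X' (fst z) v)"
proof -
  have "f' (fst z) 0 = 0" "X' (fst z) 0 = 0"
    using df[OF assms] dX[OF assms] by (auto intro: linear_0 has_derivative_linear)
  then show ?thesis by (simp add: jac_rowmat frame_volume_def F'_def)
qed

lemma cont_jac_F': "continuous_on (U \<times> UNIV) (\<lambda>z. jac (F' z))"
proof -
  have c: "continuous_on (U \<times> UNIV) (\<lambda>z. g (fst z))" if "continuous_on U g" for g :: "real^'n \<Rightarrow> real^'m"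
    by (rule continuous_on_compose2[OF that]) (auto intro!: continuous_intros)
  have "continuous_on (U \<times> (UNIV :: real set)) (\<lambda>z. frame_volume (X (fst z)) (\<lambda>v. f' (fst z) v + snd z *\<^sub>R X' (fst z) v))"
    by (intro continuous_on_frame_volume card continuous_intros c cX cf cont_X)
  then show ?thesis by (rule continuous_on_eq) (auto simp: jac_F')
qed

lemma parametrised_image:
  assumes "A \<subseteq> U" "A \<in> sets borel" "I \<in> sets borel"
  shows "parametrised_image F F' (A \<times> I)"
proof
  show "CARD('m) = CARD('n) + 1" by (rule card)
  show AI: "A \<times> I \<in> sets borel" using assms(2,3) by (rule borel_Times)
  show "(F has_derivative F' z) (at z within A \<times> I)" if "z \<in> A \<times> I" for z
    using that assms(1) by (intro F_has_derivative) auto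
  show "(\<lambda>z. indicator (A \<times> I) z * jac (F' z)) \<in> borel_measurable borel"
    by (rule borel_indicator_times_continuous_on[OF cont_jac_F' AI]) (use assms in auto)
qed

text \<open>
  The Jacobian of \<open>(x, s) \<mapsto> f x + s X x\<close> at \<open>s = 0\<close> is the volume spanned by \<open>X\<close> and the frame of \<open>f\<close>.
  By uniform continuity on a compact set it changes by less than any given \<open>\<eta>\<close> for small \<open>s\<close>.
\<close>

lemma thin_tube_cover:
  assumes C: "compact C" "C \<subseteq> U" and A: "A \<subseteq> C" "A \<in> sets borel" and e: "\<epsilon> > 0"
  shows "\<exists>\<delta>>0. \<forall>t. 0 < t \<and> t < \<delta> \<longrightarrow> (\<exists>W. open W \<and> F ` (A \<times> {-t..t}) \<subseteq> W \<and>
     emeasure lborel W \<le> ennreal (2 * t) * (\<integral>\<^sup>+x\<in>A. ennreal (frame_volume (X x) (f' x)) \<partial>lborel) + ennreal (\<epsilon> * t))"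
proof -
  define J where "J x = frame_volume (X x) (f' x)" for x
  define c where "c = measure lborel C"
  \<comment> \<open>The Jacobian is allowed to vary by \<open>\<eta>\<close>; the resulting error \<open>2 t \<eta> c\<close> is at most half of
    \<open>\<epsilon> t\<close>, and the other half pays for passing to an open set.\<close>
  define \<eta> where "\<eta> = \<epsilon> / (4 * (c + 1))"
  have c: "c \<ge> 0" by (simp add: c_def)
  have eta: "\<eta> > 0" using c e by (simp add: \<eta>_def)
  have etac: "2 * \<eta> * c \<le> \<epsilon> / 2"
  proof -
    have "\<eta> * (c + 1) = \<epsilon> / 4" using c by (simp add: \<eta>_def divide_simps)
    then have "\<eta> * c + \<eta> = \<epsilon> / 4" by (simp add: distrib_left)
    then show ?thesis using eta by linarith
  qed
  have A_c: "emeasure lborel A \<le> ennreal c"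
  proof -
    have "emeasure lborel A \<le> emeasure lborel C" using A C by (intro emeasure_mono) (auto intro: borel_compact)
    also have "\<dots> = ennreal c" using C emeasure_compact_finite[of C] unfolding c_def
      by (intro emeasure_eq_ennreal_measure) auto
    finally show ?thesis .
  qed
  have "uniformly_continuous_on (C \<times> {-1..1}) (\<lambda>z. jac (F' z))"
    using C by (intro compact_uniformly_continuous continuous_on_subset[OF cont_jac_F'] compact_Times) auto
  then obtain d where d: "d > 0" "\<And>z z'. z \<in> C \<times> {-1..1} \<Longrightarrow> z' \<in> C \<times> {-1..1} \<Longrightarrow> dist z' z < d \<Longrightarrow>
       dist (jac (F' z')) (jac (F' z)) < \<eta>"
    unfolding uniformly_continuous_on_def using eta by metis
  have Jm: "(\<lambda>x. indicator A x * J x) \<in> borel_measurable borel"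
    unfolding J_def using C A
    by (intro borel_indicator_times_continuous_on[OF continuous_on_frame_volume[OF card cont_X cf]]) auto
  show ?thesis
  proof (rule exI[of _ "min d 1"], intro conjI allI impI)
    show "0 < min d 1" using d by simp
    fix t assume t: "0 < t \<and> t < min d 1"
    let ?S = "A \<times> {-t..t}"
    show "\<exists>W. open W \<and> F ` ?S \<subseteq> W \<and>
     emeasure lborel W \<le> ennreal (2 * t) * (\<integral>\<^sup>+x\<in>A. ennreal (frame_volume (X x) (f' x)) \<partial>lborel) + ennreal (\<epsilon> * t)"
    proof (cases "(\<integral>\<^sup>+x\<in>A. ennreal (frame_volume (X x) (f' x)) \<partial>lborel) = \<infinity>")
      case True
      then show ?thesis using t by (intro exI[of _ UNIV]) (simp add: ennreal_mult_top)
    next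
      case False
      interpret P: parametrised_image F F' ?S using A C by (intro parametrised_image) auto
      have le: "jac (F' z) \<le> J (fst z) + \<eta>" if "z \<in> ?S" for z
      proof -
        have "fst z \<in> C" using that A by auto
        moreover have "(fst z, 0) \<in> C \<times> {-1..1::real}" "z \<in> C \<times> {-1..1}" using that A t by auto
        moreover have "dist z (fst z, 0) < d" using that t by (cases z) (auto simp: dist_Pair_Pair dist_real_def)
        ultimately have "dist (jac (F' z)) (jac (F' (fst z, 0))) < \<eta>" using d by blast
        moreover have "jac (F' (fst z, 0)) = J (fst z)"
          using \<open>fst z \<in> C\<close> C by (subst jac_F') (auto simp: J_def)
        ultimately show ?thesis by (simp add: dist_real_def)
      qed
      have "(\<integral>\<^sup>+z\<in>?S. jac (F' z) \<partial>lborel) \<le>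
          (\<integral>\<^sup>+z. (ennreal (indicator A (fst z) * J (fst z)) + ennreal \<eta> * indicator A (fst z)) * indicator {-t..t} (snd z) \<partial>(lborel :: ((real^'n) \<times> real) measure))"
      proof (rule nn_integral_mono)
        fix z :: "(real^'n) \<times> real"
        show "ennreal (jac (F' z)) * indicator ?S z \<le>
           (ennreal (indicator A (fst z) * J (fst z)) + ennreal \<eta> * indicator A (fst z)) * indicator {-t..t} (snd z)"
        proof (cases "z \<in> ?S")
          case True
          then have "ennreal (jac (F' z)) \<le> ennreal (J (fst z) + \<eta>)" using le by (intro ennreal_leI)
          also have "\<dots> = ennreal (J (fst z)) + ennreal \<eta>" using eta by (simp add: J_def frame_volume_nonneg)
          finally show ?thesis using True by (cases z) auto
        qed simp
      qed
      also have "\<dots> = (\<integral>\<^sup>+z. (ennreal (indicator A (fst z) * J (fst z)) + ennreal \<eta> * indicator A (fst z)) * indicator {-t..t} (snd z) \<partial>(lborel \<Otimes>\<^sub>M lborel))"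
        by (simp only: lborel_prod)
      also have "\<dots> = (\<integral>\<^sup>+x. \<integral>\<^sup>+s. (ennreal (indicator A x * J x) + ennreal \<eta> * indicator A x) * indicator {-t..t} s \<partial>lborel \<partial>lborel)"
      proof (subst lborel.nn_integral_fst[symmetric])
        have "(\<lambda>x. ennreal (indicator A x * J x) + ennreal \<eta> * indicator A x) \<in> borel_measurable lborel"
          using Jm A by simp
        then show "(\<lambda>z. (ennreal (indicator A (fst z) * J (fst z)) + ennreal \<eta> * indicator A (fst z)) * indicator {-t..t} (snd z)) \<in> borel_measurable (lborel \<Otimes>\<^sub>M lborel)"
          by measurable
      qed simp
      also have "\<dots> = (\<integral>\<^sup>+x. (ennreal (indicator A x * J x) + ennreal \<eta> * indicator A x) * ennreal (2 * t) \<partial>lborel)"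
        using t by (subst nn_integral_cmult_indicator) auto
      also have "\<dots> = (\<integral>\<^sup>+x. ennreal (indicator A x * J x) + ennreal \<eta> * indicator A x \<partial>lborel) * ennreal (2 * t)"
        using Jm A by (intro nn_integral_multc) simp
      also have "\<dots> = ((\<integral>\<^sup>+x\<in>A. ennreal (J x) \<partial>lborel) + ennreal \<eta> * emeasure lborel A) * ennreal (2 * t)"
      proof -
        have "(\<integral>\<^sup>+x. ennreal (indicator A x * J x) + ennreal \<eta> * indicator A x \<partial>lborel) =
           (\<integral>\<^sup>+x. ennreal (indicator A x * J x) \<partial>lborel) + (\<integral>\<^sup>+x. ennreal \<eta> * indicator A x \<partial>lborel)"
          using Jm A by (intro nn_integral_add) simp_all
        also have "(\<integral>\<^sup>+x. ennreal (indicator A x * J x) \<partial>lborel) = (\<integral>\<^sup>+x\<in>A. ennreal (J x) \<partial>lborel)"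
          by (intro nn_integral_cong) (auto simp: indicator_def)
        finally show ?thesis using A by (simp add: nn_integral_cmult_indicator)
      qed
      also have "\<dots> \<le> ((\<integral>\<^sup>+x\<in>A. ennreal (J x) \<partial>lborel) + ennreal \<eta> * ennreal c) * ennreal (2 * t)"
        using A_c by (intro mult_right_mono add_left_mono mult_left_mono) auto
      also have "\<dots> = ennreal (2 * t) * (\<integral>\<^sup>+x\<in>A. ennreal (J x) \<partial>lborel) + ennreal (2 * \<eta> * c * t)"
      proof -
        have "ennreal (2 * \<eta> * c * t) = ennreal (\<eta> * c * (2 * t))" by (simp add: mult_ac)
        also have "\<dots> = ennreal \<eta> * ennreal c * ennreal (2 * t)" using eta c t by (simp add: ennreal_mult)
        finally show ?thesis by (simp add: distrib_left mult.commute[of _ "ennreal (2 * t)"])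
      qed
      finally have int: "(\<integral>\<^sup>+z\<in>?S. jac (F' z) \<partial>lborel) \<le> ennreal (2 * t) * (\<integral>\<^sup>+x\<in>A. ennreal (J x) \<partial>lborel) + ennreal (2 * \<eta> * c * t)" .
      also have "\<dots> < \<infinity>" using False by (simp add: J_def ennreal_mult_less_top top.not_eq_extremum)
      finally obtain W where W: "open W" "F ` ?S \<subseteq> W"
         "emeasure lborel W \<le> (\<integral>\<^sup>+z\<in>?S. jac (F' z) \<partial>lborel) + ennreal (\<epsilon> * t / 2)"
        using P.open_cover_of_image[of "\<epsilon> * t / 2"] e t by auto
      note W(3)
      also have "(\<integral>\<^sup>+z\<in>?S. jac (F' z) \<partial>lborel) + ennreal (\<epsilon> * t / 2) \<le>
         ennreal (2 * t) * (\<integral>\<^sup>+x\<in>A. ennreal (J x) \<partial>lborel) + ennreal (2 * \<eta> * c * t) + ennreal (\<epsilon> * t / 2)"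
        by (rule add_right_mono[OF int])
      also have "\<dots> = ennreal (2 * t) * (\<integral>\<^sup>+x\<in>A. ennreal (J x) \<partial>lborel) + ennreal (2 * \<eta> * c * t + \<epsilon> * t / 2)"
        using eta c t e by (simp add: add.assoc)
      also have "\<dots> \<le> ennreal (2 * t) * (\<integral>\<^sup>+x\<in>A. ennreal (J x) \<partial>lborel) + ennreal (\<epsilon> * t)"
      proof (intro add_left_mono ennreal_leI)
        have "2 * \<eta> * c * t \<le> \<epsilon> / 2 * t" using etac t by (intro mult_right_mono) auto
        then show "2 * \<eta> * c * t + \<epsilon> * t / 2 \<le> \<epsilon> * t" by simp
      qed
      finally show ?thesis using W unfolding J_def by blast
    qed
  qed
qed

end

section \<open>Lower bounds for the volume near a frontier\<close>

text \<open>
  In the binomial expansions of the sum and of the difference all terms are nonnegative; these are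
  the leading ones.
\<close>

lemma power_sum_diff_bounds:
  fixes d h :: real
  assumes "0 \<le> h" "h \<le> d"
  shows "2 * d ^ k \<le> (d + h) ^ k + (d - h) ^ k \<and> 2 * real k * h * d ^ (k - 1) \<le> (d + h) ^ k - (d - h) ^ k"
proof (induction k)
  case (Suc k)
  let ?p = "(d + h) ^ k + (d - h) ^ k" and ?m = "(d + h) ^ k - (d - h) ^ k"
  have d: "d \<ge> 0" using assms by simp
  have dk: "real k * (d * d ^ (k - 1)) = real k * d ^ k" by (cases k) auto
  have m: "?m \<ge> 0" using Suc assms d by (smt (verit) mult_nonneg_nonneg of_nat_0_le_iff zero_le_power)
  have "2 * (d * d ^ k) \<le> d * ?p" using mult_left_mono[OF conjunct1[OF Suc] d] by (simp add: algebra_simps)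
  also have "\<dots> \<le> d * ?p + h * ?m" using m assms by simp
  finally have 1: "2 * d ^ Suc k \<le> (d + h) ^ Suc k + (d - h) ^ Suc k" by (simp add: algebra_simps)
  have "2 * h * (real k * d ^ k) = d * (2 * real k * h * d ^ (k - 1))" unfolding dk[symmetric] by (simp add: algebra_simps)
  also have "\<dots> \<le> d * ?m" using mult_left_mono[OF conjunct2[OF Suc] d] .
  finally have "2 * h * (real k * d ^ k) + h * (2 * d ^ k) \<le> d * ?m + h * ?p"
    using mult_left_mono[OF conjunct1[OF Suc] assms(1)] by linarith
  then have "2 * real (Suc k) * h * d ^ (Suc k - 1) \<le> (d + h) ^ Suc k - (d - h) ^ Suc k"
    by (simp add: algebra_simps)
  with 1 show ?case by blast
qed simp

lemma closed_segment_meets_frontier: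
  fixes x y :: "'a::real_normed_vector"
  assumes "x \<in> D" "y \<notin> D"
  obtains z where "z \<in> closed_segment x y" "z \<in> frontier D"
proof -
  have "closed_segment x y \<inter> frontier D \<noteq> {}"
    using assms by (intro connected_Int_frontier) auto
  then show ?thesis using that by blast
qed

text \<open>
  With \<open>Q\<close> the closed \<open>t\<close>-neighbourhood of the frontier, \<open>D\<close> enlarged by a ball of radius \<open>t\<close> lies in
  \<open>D \<union> Q\<close>, and \<open>D - Q\<close> enlarged by that ball lies in \<open>D\<close>. With \<open>d\<close> the \<open>m\<close>-th root of the measure of
  \<open>D\<close> and \<open>\<beta>\<close> that of the unit ball, the Brunn-Minkowski inequality gives at least \<open>(d + t \<beta>)\<^sup>m\<close> for the
  measure of \<open>D \<union> Q\<close> and at most \<open>(d - t \<beta>)\<^sup>m\<close> for that of \<open>D - Q\<close>; their difference is the measure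
  of \<open>Q\<close>.
\<close>

lemma tube_measure_lower_bound:
  fixes D :: "'a::euclidean_space set"
  assumes D: "open D" "bounded D" "D \<noteq> {}"
  shows "\<exists>\<delta>>0. \<forall>t. 0 < t \<and> t < \<delta> \<longrightarrow>
    2 * t * (real DIM('a) * root DIM('a) (measure lebesgue (ball (0::'a) 1)) * root DIM('a) (measure lebesgue D) ^ (DIM('a) - 1))
      \<le> measure lebesgue (\<Union>x\<in>frontier D. cball x t)"
proof -
  let ?m = "DIM('a)" and ?\<mu> = "measure lebesgue"
  obtain x0 where "x0 \<in> D" using D(3) by blast
  then obtain r0 where r0: "r0 > 0" "ball x0 r0 \<subseteq> D" using D(1) by (meson openE)
  show ?thesis
  proof (intro exI conjI allI impI)
    show "r0 > 0" by (rule r0)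
    fix t assume t: "0 < t \<and> t < r0"
    define Q where "Q = (\<Union>x\<in>frontier D. cball x t)"
    have cQ: "compact Q" unfolding Q_def
      by (intro compact_minkowski_sum_cball) (simp add: D(2) compact_frontier_bounded)
    have mQ: "Q \<in> lmeasurable" using cQ by (rule lmeasurable_compact)
    have mD: "D \<in> lmeasurable" using D by (intro lmeasurable_open_bounded)
    \<comment> \<open>The inner parallel set of \<open>D\<close>.\<close>
    define D' where "D' = D - Q"
    have D': "open D'" "bounded D'" unfolding D'_def using D cQ by (auto intro: open_Diff compact_imp_closed bounded_subset)
    have "x0 \<in> D'"
    proof -
      have "x0 \<notin> cball x t" if "x \<in> frontier D" for x
      proof
        assume "x0 \<in> cball x t"
        then have "x \<in> ball x0 r0" using t by (auto simp: dist_commute)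
        then have "x \<in> interior D" using r0(2) by (meson interiorI open_ball)
        then show False using that by (simp add: frontier_def)
      qed
      then show ?thesis using r0 by (auto simp: D'_def Q_def)
    qed
    then have D'ne: "D' \<noteq> {}" by blast
    have mD': "D' \<in> lmeasurable" using D' by (intro lmeasurable_open_bounded)
    have near: "z \<in> Q" if "x \<in> frontier D" "dist x z \<le> t" for x z using that by (auto simp: Q_def)
    have out: "sumset D (ball 0 t) \<subseteq> D \<union> Q"
    proof
      fix y assume "y \<in> sumset D (ball 0 t)"
      then obtain d where d: "d \<in> D" "dist d y < t" by (auto simp: sumset_def dist_norm norm_minus_commute)
      show "y \<in> D \<union> Q"
      proof (cases "y \<in> D")
        case False
        then obtain z where "z \<in> closed_segment d y" "z \<in> frontier D" using closed_segment_meets_frontier d by blast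
        then show ?thesis using near[of z y] segment_bound[of z d y] d(2)
          by (auto simp: dist_norm norm_minus_commute)
      qed simp
    qed
    have inn: "sumset D' (ball 0 t) \<subseteq> D"
    proof
      fix y assume "y \<in> sumset D' (ball 0 t)"
      then obtain d where d: "d \<in> D'" "dist d y < t" by (auto simp: sumset_def dist_norm norm_minus_commute)
      show "y \<in> D"
      proof (rule ccontr)
        assume "y \<notin> D"
        moreover have "d \<in> D" using d by (simp add: D'_def)
        ultimately obtain z where "z \<in> closed_segment d y" "z \<in> frontier D" using closed_segment_meets_frontier by blast
        then have "d \<in> Q" using near[of z d] segment_bound[of z d y] d(2)
          by (auto simp: dist_norm norm_minus_commute)
        then show False using d by (simp add: D'_def)
      qed
    qed
    define a where "a = root ?m (?\<mu> D)"
    define a' where "a' = root ?m (?\<mu> D')"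
    define \<beta> where "\<beta> = root ?m (?\<mu> (ball (0::'a) 1))"
    have nn: "a \<ge> 0" "a' \<ge> 0" "\<beta> \<ge> 0" by (auto simp: a_def a'_def \<beta>_def intro!: real_root_ge_zero)
    have ball: "root ?m (?\<mu> (ball (0::'a) t)) = t * \<beta>"
    proof -
      have "?\<mu> (ball (0::'a) t) = t ^ ?m * ?\<mu> (ball (0::'a) 1)"
        using content_ball_conv_unit_ball[of t "0::'a"] t by simp
      then show ?thesis using t unfolding \<beta>_def by (simp only: real_root_mult) (simp add: real_root_power_cancel)
    qed
    have aD: "a ^ ?m = ?\<mu> D" "a' ^ ?m = ?\<mu> D'" by (simp_all add: a_def a'_def)
    have "(a + t * \<beta>) ^ ?m \<le> ?\<mu> (sumset D (ball 0 t))"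
      using brunn_minkowski[OF D, of "ball 0 t"] t unfolding ball[symmetric] a_def by simp
    also have "\<dots> \<le> ?\<mu> (D \<union> Q)"
    proof (rule measure_mono_fmeasurable[OF out])
      show "sumset D (ball 0 t) \<in> sets lebesgue"
        using D by (intro fmeasurableD lmeasurable_open_bounded open_sumset bounded_sumset) auto
      show "D \<union> Q \<in> lmeasurable" using mD mQ by (rule fmeasurable.Un)
    qed
    also have "D \<union> Q = D' \<union> Q" by (auto simp: D'_def)
    also have "?\<mu> (D' \<union> Q) \<le> ?\<mu> D' + ?\<mu> Q"
      using mD' mQ by (intro measure_Un_le) (auto dest: fmeasurableD)
    finally have 1: "(a + t * \<beta>) ^ ?m \<le> a' ^ ?m + ?\<mu> Q" using aD by simp
    have "(a' + t * \<beta>) ^ ?m \<le> ?\<mu> (sumset D' (ball 0 t))"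
      using brunn_minkowski[OF D' D'ne, of "ball 0 t"] t unfolding ball[symmetric] a'_def by simp
    also have "\<dots> \<le> ?\<mu> D"
    proof (rule measure_mono_fmeasurable[OF inn _ mD])
      show "sumset D' (ball 0 t) \<in> sets lebesgue"
        using D' by (intro fmeasurableD lmeasurable_open_bounded open_sumset bounded_sumset) auto
    qed
    finally have "(a' + t * \<beta>) ^ ?m \<le> a ^ ?m" using aD by simp
    then have le: "a' + t * \<beta> \<le> a"
      using nn t power_mono_iff[of "a' + t * \<beta>" a ?m] by simp
    then have "a' ^ ?m \<le> (a - t * \<beta>) ^ ?m" using nn by (intro power_mono) auto
    moreover have "2 * real ?m * (t * \<beta>) * a ^ (?m - 1) \<le> (a + t * \<beta>) ^ ?m - (a - t * \<beta>) ^ ?m"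
      using power_sum_diff_bounds[of "t * \<beta>" a ?m] nn t le by simp
    ultimately have "2 * real ?m * (t * \<beta>) * a ^ (?m - 1) \<le> ?\<mu> Q" using 1 by linarith
    then show "2 * t * (real ?m * root ?m (?\<mu> (ball (0::'a) 1)) * root ?m (?\<mu> D) ^ (?m - 1))
      \<le> ?\<mu> (\<Union>x\<in>frontier D. cball x t)"
      unfolding Q_def[symmetric] a_def[symmetric] \<beta>_def[symmetric] by (simp add: mult_ac)
  qed
qed

text \<open>
  A point of \<open>(1 + t) D\<close> outside \<open>(1 - t) D\<close> is joined to a frontier point by a ray from the origin:
  the segment between its rescalings by \<open>1 / (1 + t)\<close> and \<open>1 / (1 - t)\<close> leaves \<open>D\<close>.
\<close>

lemma radial_measure_lower_bound:
  fixes D :: "'a::euclidean_space set"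
  assumes D: "open D" "bounded D" and t: "0 < t" "t < 1"
  shows "2 * t * (real DIM('a) * measure lebesgue D)
      \<le> measure lebesgue ((\<lambda>(s, x). (1 + s) *\<^sub>R x) ` ({-t..t} \<times> frontier D))"
proof -
  let ?m = "DIM('a)" and ?\<mu> = "measure lebesgue"
  define Q where "Q = (\<lambda>(s, x). (1 + s) *\<^sub>R x) ` ({-t..t} \<times> frontier D)"
  have "compact Q" unfolding Q_def
    using D(2) by (intro compact_continuous_image compact_Times)
      (auto simp: compact_frontier_bounded case_prod_beta intro!: continuous_intros)
  then have mQ: "Q \<in> lmeasurable" by (rule lmeasurable_compact)
  have mD: "D \<in> lmeasurable" using D by (intro lmeasurable_open_bounded)
  have sc: "(\<lambda>x. c *\<^sub>R x) ` D \<in> lmeasurable" "?\<mu> ((\<lambda>x. c *\<^sub>R x) ` D) = c ^ ?m * ?\<mu> D" if "c > 0" for c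
    using that D measure_lebesgue_affine[of c 0 D]
    by (auto intro!: lmeasurable_open_bounded open_scaling bounded_scaling)
  have sub: "(\<lambda>x. (1 + t) *\<^sub>R x) ` D \<subseteq> (\<lambda>x. (1 - t) *\<^sub>R x) ` D \<union> Q"
  proof
    fix y assume "y \<in> (\<lambda>x. (1 + t) *\<^sub>R x) ` D"
    then obtain d where d: "d \<in> D" "y = (1 + t) *\<^sub>R d" by blast
    define e where "e = (1 / (1 - t)) *\<^sub>R y"
    have ye: "y = (1 - t) *\<^sub>R e" using t by (simp add: e_def)
    show "y \<in> (\<lambda>x. (1 - t) *\<^sub>R x) ` D \<union> Q"
    proof (cases "e \<in> D")
      case False
      then obtain z where z: "z \<in> closed_segment d e" "z \<in> frontier D" using closed_segment_meets_frontier d by blast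
      then obtain u where u: "0 \<le> u" "u \<le> 1" "z = (1 - u) *\<^sub>R d + u *\<^sub>R e" by (auto simp: closed_segment_def)
      \<comment> \<open>The frontier point is \<open>\<tau> y\<close>, so \<open>y\<close> is reached from it by the factor \<open>1 / \<tau>\<close>.\<close>
      define \<tau> where "\<tau> = (1 - u) / (1 + t) + u / (1 - t)"
      have z': "z = \<tau> *\<^sub>R y"
      proof -
        have "d = (1 / (1 + t)) *\<^sub>R y" using d t by simp
        then show ?thesis using u by (simp add: e_def \<tau>_def scaleR_add_left)
      qed
      have dec: "1 / (1 + t) \<le> 1 / (1 - t)" using t by (intro divide_left_mono) auto
      have "\<tau> = 1 / (1 + t) + u * (1 / (1 - t) - 1 / (1 + t))"
        by (simp add: \<tau>_def algebra_simps diff_divide_distrib)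
      moreover have "0 \<le> u * (1 / (1 - t) - 1 / (1 + t))" "u * (1 / (1 - t) - 1 / (1 + t)) \<le> 1 * (1 / (1 - t) - 1 / (1 + t))"
        using dec u by (intro mult_nonneg_nonneg mult_right_mono; simp)+
      ultimately have tau: "1 / (1 + t) \<le> \<tau>" "\<tau> \<le> 1 / (1 - t)" by auto
      have "0 < 1 / (1 + t)" using t by simp
      then have tpos: "\<tau> > 0" using tau by linarith
      have "1 / \<tau> \<le> 1 + t" using tau(1) tpos t by (simp add: field_simps)
      moreover have "1 - t \<le> 1 / \<tau>" using tau(2) tpos t by (simp add: field_simps)
      ultimately have "1 / \<tau> - 1 \<in> {-t..t}" by auto
      moreover have "y = (1 + (1 / \<tau> - 1)) *\<^sub>R z" using z' tpos by simp
      ultimately have "y \<in> Q" using z(2) unfolding Q_def by force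
      then show ?thesis by simp
    qed (use ye in auto)
  qed
  have "(1 + t) ^ ?m * ?\<mu> D = ?\<mu> ((\<lambda>x. (1 + t) *\<^sub>R x) ` D)" using sc[of "1 + t"] t by simp
  also have "\<dots> \<le> ?\<mu> ((\<lambda>x. (1 - t) *\<^sub>R x) ` D \<union> Q)"
    using sub sc[of "1 + t"] sc[of "1 - t"] t mQ by (intro measure_mono_fmeasurable) (auto dest: fmeasurableD)
  also have "\<dots> \<le> (1 - t) ^ ?m * ?\<mu> D + ?\<mu> Q"
    using measure_Un_le[of "(\<lambda>x. (1 - t) *\<^sub>R x) ` D" lebesgue Q] sc[of "1 - t"] t mQ by (auto dest: fmeasurableD)
  finally have "((1 + t) ^ ?m - (1 - t) ^ ?m) * ?\<mu> D \<le> ?\<mu> Q" by (simp add: algebra_simps)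
  moreover have "(2 * real ?m * t) * ?\<mu> D \<le> ((1 + t) ^ ?m - (1 - t) ^ ?m) * ?\<mu> D"
    using power_sum_diff_bounds[of t 1 ?m] t by (intro mult_right_mono) auto
  ultimately show ?thesis unfolding Q_def[symmetric] by (simp add: mult_ac)
qed

section \<open>Hypersurfaces of the hyperboloid and their Euclidean projection\<close>

text \<open>
  The hyperboloid is the graph of \<open>x \<mapsto> sqrt (1 + x \<bullet> x)\<close>; \<open>fst\<close> is the inverse of \<open>lift\<close>.
\<close>

definition lift :: "'a::real_inner \<Rightarrow> 'a \<times> real" where
  "lift x = (x, sqrt (1 + x \<bullet> x))"

lemma fst_lift [simp]: "fst (lift x) = x" by (simp add: lift_def)

lemma one_plus_inner_pos: "1 + x \<bullet> x > 0" for x :: "'a::real_inner"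
  using inner_ge_zero[of x] by linarith

lemma hyp_space_iff: "p \<in> hyp_space \<longleftrightarrow> snd p = sqrt (1 + fst p \<bullet> fst p)"
proof
  assume "p \<in> hyp_space"
  then have "(snd p)\<^sup>2 = 1 + fst p \<bullet> fst p" "snd p > 0" by (auto simp: hyp_space_def mink_def power2_eq_square)
  then show "snd p = sqrt (1 + fst p \<bullet> fst p)" using real_sqrt_unique[of "snd p"] by simp
next
  assume *: "snd p = sqrt (1 + fst p \<bullet> fst p)"
  then have "snd p > 0" "(snd p)\<^sup>2 = 1 + fst p \<bullet> fst p" using one_plus_inner_pos[of "fst p"] by simp_all
  then show "p \<in> hyp_space" by (simp add: hyp_space_def mink_def power2_eq_square)
qed

lemma lift_in_hyp_space: "lift x \<in> hyp_space" by (simp add: hyp_space_iff lift_def)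

lemma lift_fst: "p \<in> hyp_space \<Longrightarrow> lift (fst p) = p" by (simp add: hyp_space_iff lift_def prod_eq_iff)

lemma homeomorphism_lift: "homeomorphism UNIV (hyp_space :: ('a::euclidean_space \<times> real) set) lift fst"
proof (rule homeomorphismI)
  show "continuous_on UNIV (lift :: 'a \<Rightarrow> _)" unfolding lift_def[abs_def] by (intro continuous_intros)
  show "continuous_on hyp_space (fst :: 'a \<times> real \<Rightarrow> 'a)" by (intro continuous_intros)
qed (auto simp: lift_fst lift_in_hyp_space)

lemma hyp_space_snd:
  assumes "p \<in> hyp_space"
  shows "snd p > 0" "(snd p)\<^sup>2 = 1 + fst p \<bullet> fst p" "snd p \<ge> 1"
proof -
  show 1: "snd p > 0" "(snd p)\<^sup>2 = 1 + fst p \<bullet> fst p"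
    using assms by (auto simp: hyp_space_def mink_def power2_eq_square)
  have "1\<^sup>2 \<le> (snd p)\<^sup>2" unfolding 1(2) one_power2 using inner_ge_zero[of "fst p"] by linarith
  then show "snd p \<ge> 1" by (rule power2_le_imp_le) (use 1(1) in linarith)
qed

text \<open>
  When \<open>y\<close> is the unit normal at \<open>p\<close>, this is the square of the density of the Euclidean area of the
  projected hypersurface with respect to the hyperbolic area.
\<close>

definition defect :: "'a \<times> real \<Rightarrow> 'a \<times> real \<Rightarrow> real" where
  "defect p y = (snd p)\<^sup>2 - (snd y)\<^sup>2"

text \<open>
  The Euclidean unit normal of the projected hypersurface at \<open>fst p\<close>, when \<open>y\<close> is the hyperbolic unit
  normal at \<open>p\<close>: the combination of \<open>y\<close> and \<open>p\<close> with vanishing height, normalized.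
\<close>

definition eucl_normal :: "'a::real_inner \<times> real \<Rightarrow> 'a \<times> real \<Rightarrow> 'a" where
  "eucl_normal p y = (defect p y powr (- 1 / 2)) *\<^sub>R (snd p *\<^sub>R fst y - snd y *\<^sub>R fst p)"

text \<open>
  The conditions \<open>mink y p = 0\<close> and \<open>mink y y = 1\<close> determine all inner products of \<open>fst p\<close> and
  \<open>fst y\<close> in terms of the heights. Positivity of \<open>defect\<close> is the Cauchy-Schwarz inequality for these
  two vectors.
\<close>

lemma eucl_normal_props:
  fixes p y :: "'a::real_inner \<times> real"
  assumes p: "p \<in> hyp_space" and y: "mink y p = 0" "mink y y = 1"
  shows "defect p y > 0" "eucl_normal p y \<bullet> eucl_normal p y = 1"
    "fst p \<bullet> eucl_normal p y = snd y / sqrt (defect p y)"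
    "\<And>v. mink p v = 0 \<Longrightarrow> mink y v = 0 \<Longrightarrow> eucl_normal p y \<bullet> fst v = 0"
proof -
  have pp: "fst p \<bullet> fst p = (snd p)\<^sup>2 - 1" using hyp_space_snd[OF p] by simp
  have yp: "fst y \<bullet> fst p = snd y * snd p" and yy: "fst y \<bullet> fst y = 1 + (snd y)\<^sup>2"
    using y by (auto simp: mink_def power2_eq_square)
  have "(fst y \<bullet> fst p)\<^sup>2 \<le> (fst y \<bullet> fst y) * (fst p \<bullet> fst p)" by (rule Cauchy_Schwarz_ineq)
  then have "(snd y)\<^sup>2 * (snd p)\<^sup>2 \<le> (1 + (snd y)\<^sup>2) * ((snd p)\<^sup>2 - 1)"
    unfolding yp yy pp by (simp add: power_mult_distrib)
  then have "(snd y)\<^sup>2 + 1 \<le> (snd p)\<^sup>2" by (simp add: algebra_simps)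
  then show d: "defect p y > 0" by (simp add: defect_def)
  let ?w = "snd p *\<^sub>R fst y - snd y *\<^sub>R fst p"
  have pw: "defect p y powr (- 1 / 2) = 1 / sqrt (defect p y)"
  proof -
    have "defect p y powr (- (1 / 2)) = inverse (sqrt (defect p y))"
      using d by (simp only: powr_minus powr_half_sqrt less_imp_le)
    then show ?thesis by (simp add: inverse_eq_divide)
  qed
  have "?w \<bullet> ?w = defect p y"
    by (simp add: inner_diff_left inner_diff_right pp yp yy inner_commute[of "fst p" "fst y"] defect_def)
       (simp add: power2_eq_square algebra_simps)
  then show "eucl_normal p y \<bullet> eucl_normal p y = 1"
    unfolding eucl_normal_def pw inner_scaleR_left inner_scaleR_right
    using d by (simp add: real_div_sqrt)
  have "fst p \<bullet> ?w = snd y"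
    by (simp add: inner_diff_right pp yp inner_commute[of "fst p" "fst y"])
       (simp add: power2_eq_square algebra_simps)
  then show "fst p \<bullet> eucl_normal p y = snd y / sqrt (defect p y)"
    unfolding eucl_normal_def pw inner_scaleR_right by simp
  fix v assume "mink p v = 0" "mink y v = 0"
  then have "fst p \<bullet> fst v = snd p * snd v" "fst y \<bullet> fst v = snd y * snd v" by (auto simp: mink_def)
  then show "eucl_normal p y \<bullet> fst v = 0"
    unfolding eucl_normal_def inner_scaleR_left inner_diff_left by simp
qed

text \<open>
  Differentiate \<open>mink (\<phi> x) (\<phi> x) = -1\<close>.
\<close>

lemma patch_tangent_orthogonal_point:
  fixes \<phi> :: "real^'n::finite \<Rightarrow> ('a::euclidean_space) \<times> real"
  assumes p: "patch M U \<phi>" and M: "M \<subseteq> hyp_space" and x: "x \<in> U"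
  shows "mink (\<phi> x) (frechet_derivative \<phi> (at x) v) = 0"
proof -
  let ?d = "frechet_derivative \<phi> (at x)"
  have d: "(\<phi> has_derivative ?d) (at x)" by (rule patch_has_derivative[OF p x])
  have "((\<lambda>x. fst (\<phi> x) \<bullet> fst (\<phi> x) - snd (\<phi> x) * snd (\<phi> x)) has_derivative
     (\<lambda>v. (fst (\<phi> x) \<bullet> fst (?d v) + fst (?d v) \<bullet> fst (\<phi> x)) - (snd (\<phi> x) * snd (?d v) + snd (?d v) * snd (\<phi> x)))) (at x)"
    by (intro has_derivative_diff has_derivative_inner has_derivative_mult has_derivative_fst has_derivative_snd d)
  moreover have "((\<lambda>x. fst (\<phi> x) \<bullet> fst (\<phi> x) - snd (\<phi> x) * snd (\<phi> x)) has_derivative (\<lambda>v. 0)) (at x)"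
  proof (rule has_derivative_transform_within_open[OF has_derivative_const patch_Ck1(1)[OF p] x])
    fix z assume "z \<in> U"
    then have "\<phi> z \<in> hyp_space" using patch_image_subset[OF p] M by blast
    then show "-1 = fst (\<phi> z) \<bullet> fst (\<phi> z) - snd (\<phi> z) * snd (\<phi> z)" by (simp add: hyp_space_def mink_def)
  qed
  ultimately have "(\<lambda>v. (fst (\<phi> x) \<bullet> fst (?d v) + fst (?d v) \<bullet> fst (\<phi> x)) - (snd (\<phi> x) * snd (?d v) + snd (?d v) * snd (\<phi> x))) = (\<lambda>v. 0)"
    by (rule has_derivative_unique)
  then have "(fst (\<phi> x) \<bullet> fst (?d v) + fst (?d v) \<bullet> fst (\<phi> x)) - (snd (\<phi> x) * snd (?d v) + snd (?d v) * snd (\<phi> x)) = 0"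
    by (rule fun_cong)
  then show ?thesis by (simp add: mink_def inner_commute)
qed

text \<open>
  A hypersurface of the hyperboloid with a continuously differentiable unit normal field. The
  Euclidean area element of its projection is \<open>w d\<mu>\<close> (\<open>frame_volume_normal\<close>) and the flux element of
  the position vector is \<open>\<bar>snd (\<nu> p)\<bar> d\<mu>\<close> (\<open>frame_volume_position\<close>).
\<close>

locale normal_hypersurface =
  fixes S :: "((real^'m::finite) \<times> real) set" and \<nu> :: "(real^'m) \<times> real \<Rightarrow> (real^'m) \<times> real"
    and dim :: "'n::finite itself"
  assumes card: "CARD('m) = CARD('n) + 1" and S: "S \<subseteq> hyp_space"
    and \<nu>_C1: "\<And>(U :: (real^'n) set) \<phi>. patch S U \<phi> \<Longrightarrow> Ck_on 1 (\<nu> \<circ> \<phi>) U"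
    and \<nu>: "\<And>p. p \<in> S \<Longrightarrow> mink (\<nu> p) p = 0 \<and> mink (\<nu> p) (\<nu> p) = 1"
    and \<nu>_tan: "\<And>(U :: (real^'n) set) \<phi> x v. patch S U \<phi> \<Longrightarrow> x \<in> U \<Longrightarrow> mink (\<nu> (\<phi> x)) (frechet_derivative \<phi> (at x) v) = 0"
begin

definition N where "N p = eucl_normal p (\<nu> p)"
definition w where "w p = sqrt (defect p (\<nu> p))"

lemma R_iso: "basis_iso (reindex :: real^'m \<Rightarrow> real^'n ext)"
  using card by (intro basis_iso_reindex) (simp add: CARD_ext)

lemma R_linear: "linear (reindex :: real^'m \<Rightarrow> real^'n ext)" by (rule basis_iso_linear[OF R_iso])

context
  fixes U :: "(real^'n) set" and \<phi> and x
  assumes p: "patch S U \<phi>" and x: "x \<in> U"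
begin

abbreviation (input) "d \<equiv> frechet_derivative \<phi> (at x)"
abbreviation (input) "f \<equiv> fst (\<phi> x)"
abbreviation (input) "f' \<equiv> (\<lambda>v. fst (frechet_derivative \<phi> (at x) v))"

lemma point_S: "\<phi> x \<in> S" and point_hyp: "\<phi> x \<in> hyp_space"
  using patch_image_subset[OF p] x S by auto

lemmas tan = patch_tangent_orthogonal_point[OF p S x]

lemma pos: "defect (\<phi> x) (\<nu> (\<phi> x)) > 0" "w (\<phi> x) > 0"
  using eucl_normal_props(1)[OF point_hyp] \<nu>[OF point_S] by (auto simp: w_def)

lemma N_unit: "N (\<phi> x) \<bullet> N (\<phi> x) = 1"
  using eucl_normal_props(2)[OF point_hyp] \<nu>[OF point_S] by (auto simp: N_def)

lemma f_N: "f \<bullet> N (\<phi> x) = snd (\<nu> (\<phi> x)) / w (\<phi> x)"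
  using eucl_normal_props(3)[OF point_hyp] \<nu>[OF point_S] by (auto simp: N_def w_def)

lemma N_tan: "N (\<phi> x) \<bullet> f' v = 0"
  using eucl_normal_props(4)[OF point_hyp _ _ tan \<nu>_tan[OF p x]] \<nu>[OF point_S] by (auto simp: N_def)

lemma d_linear: "linear d" using patch_has_derivative[OF p x] by (rule has_derivative_linear)

lemma f'_linear: "linear f'"
  using d_linear by (simp add: linear_iff)

lemma f'_eq_0: "f' v = 0 \<Longrightarrow> v = 0"
proof -
  assume "f' v = 0"
  moreover have "snd (d v) = 0" using tan[of v] \<open>f' v = 0\<close> hyp_space_snd(1)[OF point_hyp] by (simp add: mink_def)
  ultimately have "d v = 0" by (simp add: prod_eq_iff)
  moreover have "inj d" using p x by (simp add: patch_def)
  ultimately show "v = 0" using d_linear linear_injective_0 by blast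
qed

abbreviation (input) "rN \<equiv> (reindex (N (\<phi> x)) :: real^'n ext)"
abbreviation (input) "rf \<equiv> (reindex f :: real^'n ext)"
abbreviation (input) "rv \<equiv> (\<lambda>i. reindex (f' (axis i 1)) :: real^'n ext)"

lemma rN: "rN \<bullet> rv i = 0" "rN \<bullet> rN = 1"
  by (simp_all add: basis_iso_inner[OF R_iso] N_tan N_unit)

lemma det_N_nonzero: "det (rowmat rN rv) \<noteq> 0"
proof (rule det_rowmat_nonzero[OF rN(1) rN(2)])
  fix c :: "'n \<Rightarrow> real"
  assume "(\<Sum>i\<in>UNIV. c i *\<^sub>R rv i) = 0"
  then have "(reindex (f' (\<Sum>i\<in>UNIV. c i *\<^sub>R axis i 1)) :: real^'n ext) = 0"
    by (simp add: linear_sum[OF f'_linear] linear_cmul[OF f'_linear] linear_sum[OF R_linear] linear_cmul[OF R_linear])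
  then have "f' (\<Sum>i\<in>UNIV. c i *\<^sub>R axis i 1) = 0"
    using bij_is_inj[OF basis_iso_bij[OF R_iso]] R_linear linear_injective_0 by blast
  then have "(\<Sum>i\<in>UNIV. c i *\<^sub>R axis i 1 :: real^'n) = 0" by (rule f'_eq_0)
  then show "\<forall>i. c i = 0" by (simp add: vec_eq_iff axis_def if_distrib[of "\<lambda>x. _ * x"] cong: if_cong)
qed

text \<open>
  The tangential frame and \<open>N\<close> form an invertible matrix, and the component of \<open>u\<close> orthogonal to \<open>N\<close>
  lies in its kernel.
\<close>

lemma orthogonal_tangent_imp_normal:
  assumes u: "\<And>v. u \<bullet> f' v = 0"
  shows "u = (u \<bullet> N (\<phi> x)) *\<^sub>R N (\<phi> x)"
proof -
  let ?u = "u - (u \<bullet> N (\<phi> x)) *\<^sub>R N (\<phi> x)"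
  have "rowmat rN rv *v reindex ?u = 0"
  proof -
    have "(rowmat rN rv *v reindex ?u) $ k = 0" for k
    proof (cases k)
      case Base
      have "rN \<bullet> reindex ?u = 0"
        unfolding basis_iso_inner[OF R_iso] using N_unit by (simp add: inner_diff_right inner_commute)
      then show ?thesis using Base by (simp add: matrix_vector_mult_def rowmat_def inner_vec_def)
    next
      case (Ext i)
      have "rv i \<bullet> reindex ?u = 0"
        unfolding basis_iso_inner[OF R_iso] using N_tan u by (simp add: inner_diff_right inner_commute)
      then show ?thesis using Ext by (simp add: matrix_vector_mult_def rowmat_def inner_vec_def)
    qed
    then show ?thesis by (simp add: vec_eq_iff)
  qed
  moreover have "invertible (rowmat rN rv)" using det_N_nonzero by (simp add: invertible_det_nz)
  ultimately have "(reindex ?u :: real^'n ext) = 0"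
    using matrix_left_invertible_ker invertible_left_inverse by blast
  then have "?u = 0"
    using bij_is_inj[OF basis_iso_bij[OF R_iso]] R_linear linear_injective_0 by blast
  then show ?thesis by simp
qed

text \<open>
  The height of a tangent vector is determined by its projection, so the Lorentz Gram determinant is
  the one in \<open>det_graph_metric\<close>.
\<close>

lemma gram_mink_split:
  "(snd (\<phi> x))\<^sup>2 * gram_det mink \<phi> x = (frame_volume f f')\<^sup>2 + (frame_volume (N (\<phi> x)) f')\<^sup>2"
proof -
  have sp: "(snd (\<phi> x))\<^sup>2 = 1 + rf \<bullet> rf" using hyp_space_snd(2)[OF point_hyp] by (simp add: basis_iso_inner[OF R_iso])
  have "mink (d (axis i 1)) (d (axis j 1)) = rv i \<bullet> rv j - (rf \<bullet> rv i) * (rf \<bullet> rv j) / (1 + rf \<bullet> rf)" for i j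
  proof -
    have "f \<bullet> f' (axis k 1) = snd (\<phi> x) * snd (d (axis k 1))" for k using tan[of "axis k 1"] by (simp add: mink_def)
    then have "(rf \<bullet> rv i) * (rf \<bullet> rv j) = (snd (\<phi> x))\<^sup>2 * (snd (d (axis i 1)) * snd (d (axis j 1)))"
      by (simp add: basis_iso_inner[OF R_iso] power2_eq_square)
    then show ?thesis unfolding sp[symmetric] using hyp_space_snd(1)[OF point_hyp]
      by (simp add: mink_def basis_iso_inner[OF R_iso])
  qed
  then have "gram_det mink \<phi> x = det (\<chi> i j. rv i \<bullet> rv j - (rf \<bullet> rv i) * (rf \<bullet> rv j) / (1 + rf \<bullet> rf))"
    by (simp add: gram_det_def)
  then show ?thesis
    using det_graph_metric[of rf rv] det_gram_normal[of rN rv, OF rN] unfolding sp frame_volume_def by simp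
qed

lemma frame_volume_position_ratio: "frame_volume f f' = \<bar>snd (\<nu> (\<phi> x))\<bar> / w (\<phi> x) * frame_volume (N (\<phi> x)) f'"
  using abs_det_rowmat_normal[of rN rv rf, OF rN det_N_nonzero] pos(2)
  unfolding frame_volume_def by (simp add: basis_iso_inner[OF R_iso] f_N)

lemma gram_mink_eq: "gram_det mink \<phi> x = (frame_volume (N (\<phi> x)) f' / w (\<phi> x))\<^sup>2"
proof -
  let ?x = "snd (\<phi> x)" and ?y = "snd (\<nu> (\<phi> x))" and ?V = "frame_volume (N (\<phi> x)) f'"
  have w2: "(w (\<phi> x))\<^sup>2 = ?x\<^sup>2 - ?y\<^sup>2" using pos(1) by (simp add: w_def defect_def)
  have "?x\<^sup>2 * gram_det mink \<phi> x = (?y\<^sup>2 / (w (\<phi> x))\<^sup>2 + 1) * ?V\<^sup>2"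
    unfolding gram_mink_split frame_volume_position_ratio by (simp add: power_mult_distrib power_divide algebra_simps)
  also have "\<dots> = ?x\<^sup>2 * (?V / w (\<phi> x))\<^sup>2"
    using pos(2) by (simp add: w2[symmetric] power_divide field_simps) (simp add: w2 algebra_simps)
  finally show ?thesis using hyp_space_snd(1)[OF point_hyp] by simp
qed

lemma gram_mink_pos: "gram_det mink \<phi> x > 0"
  using gram_mink_eq det_N_nonzero pos(2) by (simp add: frame_volume_def)

lemma frame_volume_normal: "w (\<phi> x) * sqrt (gram_det mink \<phi> x) = frame_volume (N (\<phi> x)) f'"
  unfolding gram_mink_eq using pos(2) by (simp add: frame_volume_nonneg)

lemma frame_volume_position: "\<bar>snd (\<nu> (\<phi> x))\<bar> * sqrt (gram_det mink \<phi> x) = frame_volume f f'"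
  unfolding gram_mink_eq frame_volume_position_ratio using pos(2) by (simp add: frame_volume_nonneg)

end

lemma field_along_position:
  assumes p: "patch S U (\<phi> :: real^'n \<Rightarrow> _)"
  shows "field_along (\<lambda>x. fst (\<phi> x)) (\<lambda>x. fst (\<phi> x)) (\<lambda>x v. fst (frechet_derivative \<phi> (at x) v))
    (\<lambda>x v. fst (frechet_derivative \<phi> (at x) v)) U"
proof
  show "CARD('m) = CARD('n) + 1" by (rule card)
  show "open U" by (rule patch_Ck1(1)[OF p])
  show "((\<lambda>x. fst (\<phi> x)) has_derivative (\<lambda>v. fst (frechet_derivative \<phi> (at x) v))) (at x)" if "x \<in> U" for x
    by (rule has_derivative_fst[OF patch_has_derivative[OF p that]])
  show "continuous_on U (\<lambda>x. fst (frechet_derivative \<phi> (at x) v))" for v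
    by (intro continuous_intros patch_continuous_on_derivative[OF p])
qed

lemma N_C1:
  assumes p: "patch S U (\<phi> :: real^'n \<Rightarrow> _)"
  shows "Ck_on (Suc 0) (\<lambda>x. N (\<phi> x)) U"
proof -
  note U = patch_Ck1(1)[OF p]
  have n: "Ck_on (Suc 0) (\<lambda>x. \<nu> (\<phi> x)) U" using \<nu>_C1[OF p] unfolding comp_def One_nat_def .
  note c = Ck_on_compose_linear[OF U patch_Ck1(2)[OF p] bounded_linear_snd]
    Ck_on_compose_linear[OF U patch_Ck1(2)[OF p] bounded_linear_fst]
    Ck_on_compose_linear[OF U n bounded_linear_snd] Ck_on_compose_linear[OF U n bounded_linear_fst]
  have neg: "Ck_on (Suc 0) (\<lambda>x. - g x) U" if "Ck_on (Suc 0) g U" for g :: "real^'n \<Rightarrow> 'b::real_normed_vector"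
    by (rule Ck_on_compose_linear[OF U that]) (rule bounded_linear_minus[OF bounded_linear_ident])
  have "Ck_on (Suc 0) (\<lambda>x. (snd (\<phi> x) *\<^sub>R snd (\<phi> x) + - (snd (\<nu> (\<phi> x)) *\<^sub>R snd (\<nu> (\<phi> x)))) powr (- 1 / 2)) U"
  proof (rule Ck1_powr[OF U])
    show "Ck_on (Suc 0) (\<lambda>x. snd (\<phi> x) *\<^sub>R snd (\<phi> x) + - (snd (\<nu> (\<phi> x)) *\<^sub>R snd (\<nu> (\<phi> x)))) U"
      by (intro Ck_on_add neg Ck_on_scaleR U c)
    show "0 < snd (\<phi> x) *\<^sub>R snd (\<phi> x) + - (snd (\<nu> (\<phi> x)) *\<^sub>R snd (\<nu> (\<phi> x)))" if "x \<in> U" for x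
      using pos(1)[OF p that] by (simp add: defect_def power2_eq_square)
  qed
  then have "Ck_on (Suc 0) (\<lambda>x. ((snd (\<phi> x) *\<^sub>R snd (\<phi> x) + - (snd (\<nu> (\<phi> x)) *\<^sub>R snd (\<nu> (\<phi> x)))) powr (- 1 / 2))
      *\<^sub>R (snd (\<phi> x) *\<^sub>R fst (\<nu> (\<phi> x)) + - (snd (\<nu> (\<phi> x)) *\<^sub>R fst (\<phi> x)))) U"
    by (intro Ck_on_add neg Ck_on_scaleR U c)
  then show ?thesis by (simp add: N_def eucl_normal_def defect_def power2_eq_square del: Ck_on.simps)
qed

lemma field_along_normal:
  assumes p: "patch S U (\<phi> :: real^'n \<Rightarrow> _)"
  shows "field_along (\<lambda>x. fst (\<phi> x)) (\<lambda>x. N (\<phi> x)) (\<lambda>x v. fst (frechet_derivative \<phi> (at x) v))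
    (\<lambda>x v. frechet_derivative (\<lambda>x. N (\<phi> x)) (at x) v) U"
proof -
  interpret P: field_along "\<lambda>x. fst (\<phi> x)" "\<lambda>x. fst (\<phi> x)" "\<lambda>x v. fst (frechet_derivative \<phi> (at x) v)"
    "\<lambda>x v. fst (frechet_derivative \<phi> (at x) v)" U by (rule field_along_position[OF p])
  show ?thesis
  proof
    show "((\<lambda>x. N (\<phi> x)) has_derivative (\<lambda>v. frechet_derivative (\<lambda>x. N (\<phi> x)) (at x) v)) (at x)" if "x \<in> U" for x
      using Ck_on_has_derivative[OF N_C1[OF p] P.U that] .
    show "continuous_on U (\<lambda>x. frechet_derivative (\<lambda>x. N (\<phi> x)) (at x) v)" for v
      using N_C1[OF p] by simp
  qed (use P.card P.U P.df P.cf in auto)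
qed

end

section \<open>Flux and area of a hypersurface that bounds a domain\<close>

lemma homeomorphic_map_fst_hyp_space:
  "homeomorphic_map (top_of_set (hyp_space :: ('a::euclidean_space \<times> real) set)) euclidean fst"
proof (rule homeomorphic_maps_imp_map)
  show "homeomorphic_maps (top_of_set (hyp_space :: ('a \<times> real) set)) euclidean fst lift"
    unfolding homeomorphic_maps_def
    using homeomorphism_lift[where 'a = 'a]
    by (auto simp: homeomorphism_def lift_in_hyp_space continuous_map_in_subtopology lift_fst)
qed

lemma encloses_projection:
  fixes \<Sigma> \<Omega> :: "((real^'m::finite) \<times> real) set"
  assumes "encloses \<Sigma> \<Omega>"
  shows "open (fst ` \<Omega>)" "bounded (fst ` \<Omega>)" "connected (fst ` \<Omega>)" "frontier (fst ` \<Omega>) = fst ` \<Sigma>" "\<Omega> \<subseteq> hyp_space"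
proof -
  have o: "openin (top_of_set hyp_space) \<Omega>" and c: "connected \<Omega>" and b: "bounded \<Omega>"
    and f: "top_of_set hyp_space frontier_of \<Omega> = \<Sigma>" using assms by (auto simp: encloses_def)
  show sub: "\<Omega> \<subseteq> hyp_space" using o openin_imp_subset by blast
  have "openin euclidean (fst ` \<Omega>)"
    using homeomorphic_map_openness[OF homeomorphic_map_fst_hyp_space, of \<Omega>] o sub by simp
  then show "open (fst ` \<Omega>)" by simp
  show "bounded (fst ` \<Omega>)" by (rule bounded_linear_image[OF b bounded_linear_fst])
  show "connected (fst ` \<Omega>)" by (intro connected_continuous_image c continuous_intros)
  have "euclidean frontier_of (fst ` \<Omega>) = fst ` (top_of_set hyp_space frontier_of \<Omega>)"
    by (rule homeomorphic_map_frontier_of[OF homeomorphic_map_fst_hyp_space]) (use sub in simp)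
  then show "frontier (fst ` \<Omega>) = fst ` \<Sigma>" by (simp add: f)
qed

context normal_hypersurface
begin

text \<open>
  Suppose that every point of the set \<open>Q t\<close> is reached from the projected hypersurface along \<open>X\<close> in a
  time of absolute value at most \<open>t\<close>, and that the volume of \<open>Q t\<close> is at least \<open>2 t L\<close>. The swept
  volume is at most \<open>2 t\<close> times the integral of \<open>g\<close>, up to \<open>o(t)\<close>, so division by \<open>2 t\<close> bounds \<open>L\<close>.
\<close>

lemma first_variation_bound:
  fixes X :: "(real^'m) \<times> real \<Rightarrow> real^'m" and g :: "(real^'m) \<times> real \<Rightarrow> real"
    and \<phi> :: "nat \<Rightarrow> real^'n \<Rightarrow> (real^'m) \<times> real"
  assumes cS: "compact S" and pc: "pieces S K U \<phi> C A" and rm: "riemannian_measure TYPE('n) mink S \<mu>"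
    and fa: "\<And>k. k < K \<Longrightarrow> field_along (\<lambda>x. fst (\<phi> k x)) (\<lambda>x. X (\<phi> k x))
        (\<lambda>x v. fst (frechet_derivative (\<phi> k) (at x) v)) (X' k) (U k)"
    and gX: "\<And>k x. k < K \<Longrightarrow> x \<in> U k \<Longrightarrow> g (\<phi> k x) * sqrt (gram_det mink (\<phi> k) x) =
        frame_volume (X (\<phi> k x)) (\<lambda>v. fst (frechet_derivative (\<phi> k) (at x) v))"
    and g: "continuous_on S g" "\<And>p. p \<in> S \<Longrightarrow> g p \<ge> 0"
    and \<delta>: "\<delta> > 0"
    and Q: "\<And>t. 0 < t \<Longrightarrow> t < \<delta> \<Longrightarrow> Q t \<in> lmeasurable \<and> 2 * t * L \<le> measure lebesgue (Q t)"
    and Q_sub: "\<And>t y. 0 < t \<Longrightarrow> t < \<delta> \<Longrightarrow> y \<in> Q t \<Longrightarrow> \<exists>p\<in>S. \<exists>s\<in>{-t..t}. y = fst p + s *\<^sub>R X p"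
  shows "ennreal L \<le> (\<integral>\<^sup>+p. ennreal (g p) \<partial>\<mu>)"
proof (rule ennreal_le_epsilon)
  fix \<epsilon> :: real assume \<epsilon>: "\<epsilon> > 0"
  \<comment> \<open>Each of the \<open>K\<close> pieces contributes an error of at most \<open>e t\<close>, in total at most \<open>2 t \<epsilon>\<close>.\<close>
  define e where "e = 2 * \<epsilon> / (real K + 1)"
  have e: "e > 0" using \<epsilon> by (simp add: e_def)
  have Ke: "real K * e \<le> 2 * \<epsilon>"
  proof -
    have "(real K + 1) * e = 2 * \<epsilon>" by (simp add: e_def)
    then show ?thesis using e by (simp add: distrib_right)
  qed
  define I where "I k = (\<integral>\<^sup>+x\<in>A k. ennreal (frame_volume (X (\<phi> k x)) (\<lambda>v. fst (frechet_derivative (\<phi> k) (at x) v))) \<partial>lborel)" for k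
  have pk: "compact (C k)" "C k \<subseteq> U k" "A k \<subseteq> C k" "A k \<in> sets borel" if "k < K" for k
    using pc that by (auto simp: pieces_def)
  have tot: "(\<integral>\<^sup>+p. ennreal (g p) \<partial>\<mu>) = (\<Sum>k<K. I k)"
  proof -
    have "(\<integral>\<^sup>+p. ennreal (g p) \<partial>\<mu>) = (\<Sum>k<K. \<integral>\<^sup>+x\<in>A k. ennreal (g (\<phi> k x) * sqrt (gram_det mink (\<phi> k) x)) \<partial>lborel)"
      by (rule riemannian_measure_integral[OF rm compact_imp_closed[OF cS] pc continuous_on_mink g])
    also have "\<dots> = (\<Sum>k<K. I k)"
    proof (rule sum.cong[OF refl])
      fix k assume "k \<in> {..<K}"
      then have k: "k < K" by simp
      show "(\<integral>\<^sup>+x\<in>A k. ennreal (g (\<phi> k x) * sqrt (gram_det mink (\<phi> k) x)) \<partial>lborel) = I k"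
        unfolding I_def
      proof (rule nn_integral_cong)
        fix x
        show "ennreal (g (\<phi> k x) * sqrt (gram_det mink (\<phi> k) x)) * indicator (A k) x =
          ennreal (frame_volume (X (\<phi> k x)) (\<lambda>v. fst (frechet_derivative (\<phi> k) (at x) v))) * indicator (A k) x"
          using gX[OF k, of x] pk[OF k] by (cases "x \<in> A k") auto
      qed
    qed
    finally show ?thesis .
  qed
  define P where "P k t \<longleftrightarrow> (\<exists>W. open W \<and>
     (\<lambda>z. fst (\<phi> k (fst z)) + snd z *\<^sub>R X (\<phi> k (fst z))) ` (A k \<times> {-t..t}) \<subseteq> W \<and>
     emeasure lborel W \<le> ennreal (2 * t) * I k + ennreal (e * t))" for k t
  have "eventually (P k) (at_right 0)" if k: "k < K" for k
  proof -
    interpret field_along "\<lambda>x. fst (\<phi> k x)" "\<lambda>x. X (\<phi> k x)" "\<lambda>x v. fst (frechet_derivative (\<phi> k) (at x) v)" "X' k" "U k"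
      by (rule fa[OF k])
    show ?thesis
      using thin_tube_cover[OF pk[OF k] e]
      unfolding eventually_at_right_field P_def I_def F_def[abs_def] by auto
  qed
  then have "eventually (\<lambda>t. \<forall>k\<in>{..<K}. P k t) (at_right 0)" by (intro eventually_ball_finite) auto
  moreover have "eventually (\<lambda>t. 0 < t \<and> t < \<delta>) (at_right 0)"
    using \<delta> by (auto simp: eventually_at_right_field)
  ultimately have "eventually (\<lambda>t. (\<forall>k\<in>{..<K}. P k t) \<and> 0 < t \<and> t < \<delta>) (at_right 0)" by (rule eventually_conj)
  from eventually_happens'[OF trivial_limit_at_right_real this]
  obtain t where "(\<forall>k\<in>{..<K}. P k t) \<and> 0 < t \<and> t < \<delta>" by (elim exE)
  then have Pt: "\<And>k. k < K \<Longrightarrow> P k t" and t: "0 < t" "t < \<delta>" by simp_all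
  have "\<exists>W. \<forall>k\<in>{..<K}. open (W k) \<and>
     (\<lambda>z. fst (\<phi> k (fst z)) + snd z *\<^sub>R X (\<phi> k (fst z))) ` (A k \<times> {-t..t}) \<subseteq> W k \<and>
     emeasure lborel (W k) \<le> ennreal (2 * t) * I k + ennreal (e * t)"
    by (rule bchoice) (use Pt in \<open>unfold P_def, blast\<close>)
  then obtain W where "\<forall>k\<in>{..<K}. open (W k) \<and>
     (\<lambda>z. fst (\<phi> k (fst z)) + snd z *\<^sub>R X (\<phi> k (fst z))) ` (A k \<times> {-t..t}) \<subseteq> W k \<and>
     emeasure lborel (W k) \<le> ennreal (2 * t) * I k + ennreal (e * t)" by (elim exE)
  then have W: "\<And>k. k < K \<Longrightarrow> open (W k)"
     "\<And>k. k < K \<Longrightarrow> (\<lambda>z. fst (\<phi> k (fst z)) + snd z *\<^sub>R X (\<phi> k (fst z))) ` (A k \<times> {-t..t}) \<subseteq> W k"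
     "\<And>k. k < K \<Longrightarrow> emeasure lborel (W k) \<le> ennreal (2 * t) * I k + ennreal (e * t)"
    by blast+
  have cover: "Q t \<subseteq> (\<Union>k<K. W k)"
  proof
    fix y assume "y \<in> Q t"
    then obtain p s where ps: "p \<in> S" "s \<in> {-t..t}" "y = fst p + s *\<^sub>R X p" using Q_sub[OF t] by blast
    then obtain k x where k: "k < K" "x \<in> A k" "p = \<phi> k x" using pc unfolding pieces_def by blast
    then have "y \<in> (\<lambda>z. fst (\<phi> k (fst z)) + snd z *\<^sub>R X (\<phi> k (fst z))) ` (A k \<times> {-t..t})"
      using ps by (intro image_eqI[of _ _ "(x, s)"]) auto
    then show "y \<in> (\<Union>k<K. W k)" using W(2) k(1) by blast
  qed
  have "ennreal (2 * t) * ennreal L = ennreal (2 * t * L)" using t by (simp add: ennreal_mult')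
  also have "\<dots> \<le> ennreal (measure lebesgue (Q t))" using Q[OF t] by (intro ennreal_leI) simp
  also have "\<dots> = emeasure lebesgue (Q t)" using Q[OF t] by (simp add: emeasure_eq_measure2)
  also have "\<dots> \<le> emeasure lebesgue (\<Union>k<K. W k)"
    using W(1) by (intro emeasure_mono cover) auto
  also have "\<dots> = emeasure lborel (\<Union>k<K. W k)" using W(1) by simp
  also have "\<dots> \<le> (\<Sum>k<K. emeasure lborel (W k))"
    using W(1) by (intro emeasure_subadditive_finite) auto
  also have "\<dots> \<le> (\<Sum>k<K. ennreal (2 * t) * I k + ennreal (e * t))"
    using W(3) by (intro sum_mono) auto
  also have "\<dots> = ennreal (2 * t) * (\<Sum>k<K. I k) + ennreal (real K * (e * t))"
    using e t by (simp add: sum.distrib sum_distrib_left ennreal_mult ennreal_of_nat_eq_real_of_nat)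
  also have "ennreal (real K * (e * t)) \<le> ennreal (2 * t * \<epsilon>)"
    using mult_right_mono[OF Ke, of t] t by (intro ennreal_leI) (simp add: mult_ac)
  also have "ennreal (2 * t * \<epsilon>) = ennreal (2 * t) * ennreal \<epsilon>" using t \<epsilon> by (simp add: ennreal_mult)
  finally have "ennreal (2 * t) * ennreal L \<le> ennreal (2 * t) * ((\<Sum>k<K. I k) + ennreal \<epsilon>)"
    by (simp add: distrib_left add_left_mono)
  then show "ennreal L \<le> (\<integral>\<^sup>+p. ennreal (g p) \<partial>\<mu>) + ennreal \<epsilon>"
    using t unfolding tot by (subst (asm) ennreal_mult_le_mult_iff) auto
qed

lemma nu_continuous_on:
  assumes "submanifold TYPE('n) S" shows "continuous_on S \<nu>"
  unfolding continuous_on_eq_continuous_within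
proof
  fix p assume pS: "p \<in> S"
  have "\<exists>U (\<phi> :: real^'n \<Rightarrow> _). patch S U \<phi> \<and> p \<in> \<phi> ` U"
    using bspec[OF assms[unfolded submanifold_def] pS] .
  then obtain U and \<phi> :: "real^'n \<Rightarrow> (real^'m) \<times> real" where p: "patch S U \<phi>" "p \<in> \<phi> ` U" by (elim exE conjE)
  obtain \<psi> where h: "homeomorphism U (\<phi> ` U) \<phi> \<psi>" using p(1) by (auto simp: patch_def)
  have "openin (top_of_set S) (\<phi> ` U)" using p(1) by (simp add: patch_def)
  then obtain T where T: "open T" "\<phi> ` U = S \<inter> T" by (auto simp: openin_open)
  have "Ck_on (Suc 0) (\<nu> \<circ> \<phi>) U" using \<nu>_C1[OF p(1)] unfolding One_nat_def .
  from Ck_on_SucD[OF patch_Ck1(1)[OF p(1)] this] have c: "continuous_on U (\<nu> \<circ> \<phi>)" by (simp only: Ck_on.simps)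
  have \<psi>: "\<psi> ` (\<phi> ` U) = U" "continuous_on (\<phi> ` U) \<psi>" "\<And>q. q \<in> \<phi> ` U \<Longrightarrow> \<phi> (\<psi> q) = q"
    using h unfolding homeomorphism_def by blast+
  have "continuous_on (\<phi> ` U) (\<lambda>q. (\<nu> \<circ> \<phi>) (\<psi> q))"
    by (rule continuous_on_compose2[OF c \<psi>(2)]) (simp only: \<psi>(1) order_refl)
  then have "continuous_on (\<phi> ` U) \<nu>"
    by (rule continuous_on_eq) (simp only: \<psi>(3) comp_apply)
  then have "continuous (at p within \<phi> ` U) \<nu>" using p(2) unfolding continuous_on_eq_continuous_within by blast
  moreover
  have "at p within \<phi> ` U = at p within S"
  proof (rule at_within_nhd[of p T])
    show "p \<in> T" using p(2) T(2) by blast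
    show "\<phi> ` U \<inter> T - {p} = S \<inter> T - {p}" unfolding T(2) by blast
  qed (rule T(1))
  ultimately show "continuous (at p within S) \<nu>" by simp
qed

text \<open>
  First-order condition for an extremum of the distance to \<open>y\<close>. It is applied to the nearest point of
  the hypersurface, and with \<open>y = 0\<close> to the points of largest and smallest norm.
\<close>

lemma critical_point_normal:
  assumes p: "patch S U (\<phi> :: real^'n \<Rightarrow> _)" and x: "x \<in> U"
    and ext: "(\<forall>q\<in>S. (y - fst (\<phi> x)) \<bullet> (y - fst (\<phi> x)) \<le> (y - fst q) \<bullet> (y - fst q)) \<or>
       (\<forall>q\<in>S. (y - fst q) \<bullet> (y - fst q) \<le> (y - fst (\<phi> x)) \<bullet> (y - fst (\<phi> x)))"
  shows "y - fst (\<phi> x) = ((y - fst (\<phi> x)) \<bullet> N (\<phi> x)) *\<^sub>R N (\<phi> x)"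
proof (rule orthogonal_tangent_imp_normal[OF p x])
  let ?d = "frechet_derivative \<phi> (at x)"
  have d: "((\<lambda>z. y - fst (\<phi> z)) has_derivative (\<lambda>v. 0 - fst (?d v))) (at x)"
    by (intro has_derivative_diff has_derivative_const has_derivative_fst patch_has_derivative[OF p x])
  have "(\<lambda>v. (y - fst (\<phi> x)) \<bullet> (0 - fst (?d v)) + (0 - fst (?d v)) \<bullet> (y - fst (\<phi> x))) = (\<lambda>v. 0)"
  proof (rule differential_zero_maxmin[OF x patch_Ck1(1)[OF p] has_derivative_inner[OF d d]])
    show "(\<forall>z\<in>U. (y - fst (\<phi> z)) \<bullet> (y - fst (\<phi> z)) \<le> (y - fst (\<phi> x)) \<bullet> (y - fst (\<phi> x))) \<or>
       (\<forall>z\<in>U. (y - fst (\<phi> x)) \<bullet> (y - fst (\<phi> x)) \<le> (y - fst (\<phi> z)) \<bullet> (y - fst (\<phi> z)))"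
    proof -
      have \<phi>S: "\<phi> z \<in> S" if "z \<in> U" for z using patch_image_subset[OF p] that by auto
      from ext show ?thesis
      proof
        assume "\<forall>q\<in>S. (y - fst (\<phi> x)) \<bullet> (y - fst (\<phi> x)) \<le> (y - fst q) \<bullet> (y - fst q)"
        then show ?thesis using \<phi>S by (intro disjI2 ballI) simp
      next
        assume "\<forall>q\<in>S. (y - fst q) \<bullet> (y - fst q) \<le> (y - fst (\<phi> x)) \<bullet> (y - fst (\<phi> x))"
        then show ?thesis using \<phi>S by (intro disjI1 ballI) simp
      qed
    qed
  qed
  then have "(y - fst (\<phi> x)) \<bullet> (0 - fst (?d v)) + (0 - fst (?d v)) \<bullet> (y - fst (\<phi> x)) = 0" for v
    by (rule fun_cong)
  note zero = this
  fix v
  from zero[of v] show "(y - fst (\<phi> x)) \<bullet> fst (?d v) = 0"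
    by (simp add: inner_commute[of "fst (?d v)" "y - fst (\<phi> x)"])
qed

lemma patch_at:
  assumes "submanifold TYPE('n) S" "p \<in> S"
  obtains U and \<phi> :: "real^'n \<Rightarrow> (real^'m) \<times> real" and x where "patch S U \<phi>" "x \<in> U" "p = \<phi> x"
proof -
  have "\<exists>U (\<phi> :: real^'n \<Rightarrow> _). patch S U \<phi> \<and> p \<in> \<phi> ` U"
    using bspec[OF assms(1)[unfolded submanifold_def] assms(2)] .
  then show thesis using that by (elim exE conjE imageE)
qed

lemma w_continuous_on:
  assumes "submanifold TYPE('n) S" shows "continuous_on S w"
  unfolding w_def[abs_def] defect_def by (intro continuous_intros nu_continuous_on[OF assms])

text \<open>
  The first variation along the position vector, that is under dilations.
\<close>

theorem position_flux_ge_volume: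
  fixes D :: "(real^'m) set"
  assumes cS: "compact S" and sub: "submanifold TYPE('n) S" and rm: "riemannian_measure TYPE('n) mink S \<mu>"
    and D: "open D" "bounded D" "frontier D = fst ` S"
  shows "ennreal (real CARD('m) * measure lebesgue D) \<le> (\<integral>\<^sup>+p. ennreal \<bar>snd (\<nu> p)\<bar> \<partial>\<mu>)"
proof -
  obtain K U and \<phi> :: "nat \<Rightarrow> real^'n \<Rightarrow> (real^'m) \<times> real" and C A where pc: "pieces S K U \<phi> C A"
    using compact_submanifold_pieces[OF cS sub] .
  have pk: "patch S (U k) (\<phi> k)" if "k < K" for k using pc that by (simp add: pieces_def)
  show ?thesis
  proof (rule first_variation_bound[OF cS pc rm, where X = fst and \<delta> = 1 and
        Q = "\<lambda>t. (\<lambda>(s, x). (1 + s) *\<^sub>R x) ` ({-t..t} \<times> frontier D)"])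
    show "field_along (\<lambda>x. fst (\<phi> k x)) (\<lambda>x. fst (\<phi> k x))
        (\<lambda>x v. fst (frechet_derivative (\<phi> k) (at x) v)) (\<lambda>x v. fst (frechet_derivative (\<phi> k) (at x) v)) (U k)" if "k < K" for k
      by (rule field_along_position[OF pk[OF that]])
    show "\<bar>snd (\<nu> (\<phi> k x))\<bar> * sqrt (gram_det mink (\<phi> k) x) =
        frame_volume (fst (\<phi> k x)) (\<lambda>v. fst (frechet_derivative (\<phi> k) (at x) v))" if "k < K" "x \<in> U k" for k x
      by (rule frame_volume_position[OF pk[OF that(1)] that(2)])
    show "continuous_on S (\<lambda>p. \<bar>snd (\<nu> p)\<bar>)" by (intro continuous_intros nu_continuous_on[OF sub])
    fix t :: real assume t: "0 < t" "t < 1"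
    have "compact ((\<lambda>(s, x). (1 + s) *\<^sub>R x) ` ({-t..t} \<times> frontier D))"
      using D(2) by (intro compact_continuous_image compact_Times)
        (auto simp: compact_frontier_bounded case_prod_beta intro!: continuous_intros)
    then show "(\<lambda>(s, x). (1 + s) *\<^sub>R x) ` ({-t..t} \<times> frontier D) \<in> lmeasurable \<and>
       2 * t * (real CARD('m) * measure lebesgue D) \<le> measure lebesgue ((\<lambda>(s, x). (1 + s) *\<^sub>R x) ` ({-t..t} \<times> frontier D))"
      using radial_measure_lower_bound[OF D(1,2) t] by (simp add: lmeasurable_compact)
    fix y assume "y \<in> (\<lambda>(s, x). (1 + s) *\<^sub>R x) ` ({-t..t} \<times> frontier D)"
    then show "\<exists>p\<in>S. \<exists>s\<in>{-t..t}. y = fst p + s *\<^sub>R fst p"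
      unfolding D(3) by (auto simp: scaleR_add_left)
  qed auto
qed

text \<open>
  The Euclidean isoperimetric inequality for the projection. A point at distance at most \<open>t\<close> from the
  frontier is joined to its nearest frontier point by a normal segment.
\<close>

theorem area_ge_isoperimetric:
  fixes D :: "(real^'m) set"
  assumes cS: "compact S" and sub: "submanifold TYPE('n) S" and rm: "riemannian_measure TYPE('n) mink S \<mu>"
    and D: "open D" "bounded D" "D \<noteq> {}" "frontier D = fst ` S"
  shows "ennreal (real CARD('m) * root CARD('m) (measure lebesgue (ball (0 :: real^'m) 1)) *
      root CARD('m) (measure lebesgue D) ^ (CARD('m) - 1)) \<le> (\<integral>\<^sup>+p. ennreal (w p) \<partial>\<mu>)"
proof -
  obtain K U and \<phi> :: "nat \<Rightarrow> real^'n \<Rightarrow> (real^'m) \<times> real" and C A where pc: "pieces S K U \<phi> C A"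
    using compact_submanifold_pieces[OF cS sub] .
  have pk: "patch S (U k) (\<phi> k)" if "k < K" for k using pc that by (simp add: pieces_def)
  obtain \<delta> where \<delta>: "\<delta> > 0" and low: "\<And>t. 0 < t \<Longrightarrow> t < \<delta> \<Longrightarrow>
     2 * t * (real CARD('m) * root CARD('m) (measure lebesgue (ball (0 :: real^'m) 1)) *
      root CARD('m) (measure lebesgue D) ^ (CARD('m) - 1)) \<le> measure lebesgue (\<Union>x\<in>frontier D. cball x t)"
    using tube_measure_lower_bound[OF D(1-3)] by auto
  have cfr: "compact (frontier D)" using D(2) by (simp add: compact_frontier_bounded)
  show ?thesis
  proof (rule first_variation_bound[OF cS pc rm, where X = N and Q = "\<lambda>t. \<Union>x\<in>frontier D. cball x t"])
    show "field_along (\<lambda>x. fst (\<phi> k x)) (\<lambda>x. N (\<phi> k x)) (\<lambda>x v. fst (frechet_derivative (\<phi> k) (at x) v))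
        (\<lambda>x v. frechet_derivative (\<lambda>x. N (\<phi> k x)) (at x) v) (U k)" if "k < K" for k
      by (rule field_along_normal[OF pk[OF that]])
    show "w (\<phi> k x) * sqrt (gram_det mink (\<phi> k) x) =
        frame_volume (N (\<phi> k x)) (\<lambda>v. fst (frechet_derivative (\<phi> k) (at x) v))" if "k < K" "x \<in> U k" for k x
      by (rule frame_volume_normal[OF pk[OF that(1)] that(2)])
    show "continuous_on S w" by (rule w_continuous_on[OF sub])
    show "0 \<le> w p" if "p \<in> S" for p
      using eucl_normal_props(1)[of p "\<nu> p"] \<nu>[OF that] S that by (auto simp: w_def)
    show "\<delta> > 0" by (rule \<delta>)
    fix t :: real assume t: "0 < t" "t < \<delta>"
    show "(\<Union>x\<in>frontier D. cball x t) \<in> lmeasurable \<and>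
     2 * t * (real CARD('m) * root CARD('m) (measure lebesgue (ball (0 :: real^'m) 1)) *
      root CARD('m) (measure lebesgue D) ^ (CARD('m) - 1)) \<le> measure lebesgue (\<Union>x\<in>frontier D. cball x t)"
      using low[OF t] lmeasurable_compact[OF compact_minkowski_sum_cball[OF cfr]] by blast
    fix y assume y: "y \<in> (\<Union>x\<in>frontier D. cball x t)"
    then have "frontier D \<noteq> {}" by auto
    then obtain z where z: "z \<in> frontier D" "\<And>z'. z' \<in> frontier D \<Longrightarrow> dist y z \<le> dist y z'"
      using distance_attains_inf[of "frontier D" y] by auto
    have dz: "dist y z \<le> t"
    proof -
      obtain z' where "z' \<in> frontier D" "dist z' y \<le> t" using y by auto
      then show ?thesis using z(2)[of z'] by (simp add: dist_commute)
    qed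
    obtain p where p: "p \<in> S" "z = fst p" using z(1) D(4) by auto
    obtain U \<phi> and x :: "real^'n" where \<phi>: "patch S U \<phi>" "x \<in> U" "p = \<phi> x" using patch_at[OF sub p(1)] .
    have "(y - fst p) \<bullet> (y - fst p) \<le> (y - fst q) \<bullet> (y - fst q)" if "q \<in> S" for q
    proof -
      have "dist y (fst p) \<le> dist y (fst q)" using z(2)[of "fst q"] p D(4) that by auto
      then show ?thesis by (simp add: dist_norm norm_le)
    qed
    then have eq: "y - fst p = ((y - fst p) \<bullet> N p) *\<^sub>R N p"
      using critical_point_normal[OF \<phi>(1,2), of y] unfolding \<phi>(3) by blast
    have N1: "norm (N p) = 1" using N_unit[OF \<phi>(1,2)] unfolding \<phi>(3) by (simp add: norm_eq_sqrt_inner)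
    have "\<bar>(y - fst p) \<bullet> N p\<bar> = norm (y - fst p)"
      using arg_cong[OF eq, of norm] N1 by simp
    then have "\<bar>(y - fst p) \<bullet> N p\<bar> \<le> t" using dz p by (simp add: dist_norm)
    moreover have "y = fst p + ((y - fst p) \<bullet> N p) *\<^sub>R N p" using eq by (simp add: algebra_simps)
    ultimately show "\<exists>p\<in>S. \<exists>s\<in>{-t..t}. y = fst p + s *\<^sub>R N p"
      using p(1) by (intro bexI[of _ p] bexI[of _ "(y - fst p) \<bullet> N p"]) (auto simp: abs_le_iff)
  qed
qed

end

section \<open>The area of the unit sphere\<close>

lemma exists_isometry_onto_orthogonal_complement:
  fixes p :: "real^'m::finite"
  assumes card: "CARD('m) = CARD('n::finite) + 1" and p: "norm p = 1"
  obtains T :: "real^'n \<Rightarrow> real^'m" where "linear T" "\<And>x y. T x \<bullet> T y = x \<bullet> y" "range T = {q. p \<bullet> q = 0}"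
proof -
  have p0: "p \<noteq> 0" using p by auto
  have dH: "dim {q. p \<bullet> q = 0} = CARD('n)" using dim_hyperplane[OF p0] card by simp
  obtain T :: "real^'n \<Rightarrow> real^'m" where T: "linear T" "T \<in> UNIV \<rightarrow> {q. p \<bullet> q = 0}" "\<And>x. x \<in> UNIV \<Longrightarrow> norm (T x) = norm x"
    by (rule isometry_subset_subspace[OF subspace_UNIV subspace_hyperplane[of p]]) (use dH in auto)
  have inner: "T x \<bullet> T y = x \<bullet> y" for x y
    using T(3) by (simp add: dot_norm linear_add[OF T(1), symmetric])
  have "inj T" using T linear_injective_0[OF T(1)] by (metis UNIV_I norm_eq_zero)
  then have "dim (range T) = CARD('n)" using dim_image_eq[OF T(1), of UNIV] by simp
  moreover have "range T \<subseteq> {q. p \<bullet> q = 0}" using T(2) by auto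
  ultimately have "range T = {q. p \<bullet> q = 0}"
    using subspace_dim_equal[of "range T" "{q. p \<bullet> q = 0}"] dH subspace_hyperplane[of p]
      linear_subspace_image[OF T(1) subspace_UNIV] by simp
  then show thesis using that T(1) inner by blast
qed

text \<open>
  The patch is the inverse of the central projection of the open hemisphere around \<open>p\<close> to the tangent
  hyperplane at \<open>p\<close>.
\<close>

lemma sphere_patch:
  fixes p :: "real^'m::finite"
  assumes card: "CARD('m) = CARD('n::finite) + 1" and p: "norm p = 1"
  obtains \<phi> :: "real^'n \<Rightarrow> real^'m" where "patch (sphere 0 1) UNIV \<phi>" "p \<in> range \<phi>"
proof -
  obtain T :: "real^'n \<Rightarrow> real^'m" where T: "linear T" "\<And>x y. T x \<bullet> T y = x \<bullet> y" "range T = {q. p \<bullet> q = 0}"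
    using exists_isometry_onto_orthogonal_complement[OF card p] by blast
  have pp: "p \<bullet> p = 1" using p by (simp add: dot_square_norm)
  have Tp: "T x \<bullet> p = 0" "p \<bullet> T x = 0" for x using T(3) by (auto simp: inner_commute)
  have bT: "bounded_linear T" using T(1) by (simp add: linear_conv_bounded_linear)
  define c where "c x = (1 + x \<bullet> x) powr (- 1 / 2)" for x :: "real^'n"
  have cpos: "c x > 0" for x using one_plus_inner_pos[of x] by (simp add: c_def)
  have c2: "c x * c x * (1 + x \<bullet> x) = 1" for x
  proof -
    have "c x * c x = (1 + x \<bullet> x) powr (- 1)" by (simp add: c_def powr_add[symmetric])
    then show ?thesis using one_plus_inner_pos[of x] by (simp add: powr_minus)
  qed
  define \<phi> where "\<phi> x = c x *\<^sub>R (p + T x)" for x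
  define \<psi> where "\<psi> q = (1 / (q \<bullet> p)) *\<^sub>R (\<chi> i. q \<bullet> T (axis i 1))" for q
  have \<phi>p: "\<phi> x \<bullet> p = c x" for x by (simp add: \<phi>_def inner_add_left pp Tp)
  have \<psi>\<phi>: "\<psi> (\<phi> x) = x" for x
  proof -
    have "\<phi> x \<bullet> T (axis i 1) = c x * x $ i" for i
      by (simp add: \<phi>_def inner_add_left Tp T(2) inner_axis)
    then show ?thesis using cpos[of x] by (simp add: \<psi>_def \<phi>p vec_eq_iff)
  qed
  have im: "range \<phi> = sphere 0 1 \<inter> {q. 0 < p \<bullet> q}"
  proof
    have "norm (\<phi> x) = 1" for x
    proof -
      have "\<phi> x \<bullet> \<phi> x = c x * c x * (1 + x \<bullet> x)"
        by (simp add: \<phi>_def inner_add_left inner_add_right pp Tp T(2) distrib_left mult.assoc)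
      then show ?thesis using c2 by (simp add: norm_eq_sqrt_inner)
    qed
    then show "range \<phi> \<subseteq> sphere 0 1 \<inter> {q. 0 < p \<bullet> q}" using \<phi>p cpos by (auto simp: inner_commute[of p])
    show "sphere 0 1 \<inter> {q. 0 < p \<bullet> q} \<subseteq> range \<phi>"
    proof
      fix q assume q: "q \<in> sphere 0 1 \<inter> {q. 0 < p \<bullet> q}"
      let ?a = "p \<bullet> q"
      have a: "?a > 0" using q by simp
      have qq: "q \<bullet> q = 1" using q by (simp add: dot_square_norm)
      have "p \<bullet> (q - ?a *\<^sub>R p) = 0" by (simp add: inner_diff_right pp)
      then obtain z where z: "q - ?a *\<^sub>R p = T z" using T(3) by (metis (mono_tags, lifting) mem_Collect_eq rangeE)
      have zz: "z \<bullet> z = 1 - ?a\<^sup>2"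
        unfolding T(2)[symmetric] z[symmetric]
        by (simp add: inner_diff_left inner_diff_right pp qq inner_commute[of q p] power2_eq_square)
      have "1 + ((1 / ?a) *\<^sub>R z) \<bullet> ((1 / ?a) *\<^sub>R z) = (1 / ?a) ^ 2"
        using a by (simp add: zz power2_eq_square field_simps)
      then have "c ((1 / ?a) *\<^sub>R z) = ((1 / ?a) ^ 2) powr (- 1 / 2)" by (simp only: c_def)
      also have "\<dots> = (1 / ?a) powr (- 1)" using a by (simp add: powr_powr flip: powr_numeral)
      also have "\<dots> = ?a" using a by (simp add: powr_minus_divide)
      finally have "\<phi> ((1 / ?a) *\<^sub>R z) = ?a *\<^sub>R p + T z"
        using a by (simp add: \<phi>_def scaleR_add_right linear_cmul[OF T(1)])
      then have "\<phi> ((1 / ?a) *\<^sub>R z) = q" by (simp add: z[symmetric])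
      then show "q \<in> range \<phi>" by (metis rangeI)
    qed
  qed
  have C: "Ck_on k \<phi> UNIV" for k
    unfolding \<phi>_def[abs_def] c_def
    by (intro Ck_on_scaleR Ck_on_add Ck_on_powr_one_plus_norm Ck_on_const Ck_on_bounded_linear bT open_UNIV)
  have d: "(\<phi> has_derivative frechet_derivative \<phi> (at x)) (at x)" for x
    by (rule Ck_on_has_derivative[OF C[of "Suc 0"] open_UNIV UNIV_I])
  have "inj (frechet_derivative \<phi> (at x))" for x
  proof -
    let ?d = "frechet_derivative \<phi> (at x)"
    have lin: "linear ?d" using d by (rule has_derivative_linear)
    have "v = 0" if v: "?d v = 0" for v
    proof -
      have e: "(1 / (\<phi> x \<bullet> p)) *\<^sub>R \<phi> x = p + T x" for x
        using cpos[of x] unfolding \<phi>p by (simp add: \<phi>_def)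
      have "((\<lambda>x. (1 / (\<phi> x \<bullet> p)) *\<^sub>R \<phi> x) has_derivative
         (\<lambda>v. (1 / (\<phi> x \<bullet> p)) *\<^sub>R ?d v + (- (?d v \<bullet> p) / (\<phi> x \<bullet> p)\<^sup>2) *\<^sub>R \<phi> x)) (at x)"
      proof -
        have nz: "\<phi> x \<bullet> p \<noteq> 0" using cpos[of x] by (simp add: \<phi>p)
        have "((\<lambda>x. \<phi> x \<bullet> p) has_derivative (\<lambda>v. ?d v \<bullet> p)) (at x)"
          by (rule has_derivative_inner_left[OF d])
        from has_derivative_scaleR[OF Deriv.has_derivative_inverse[OF nz this] d]
        show ?thesis by (simp add: divide_inverse power2_eq_square mult_ac)
      qed
      moreover have "((\<lambda>x. (1 / (\<phi> x \<bullet> p)) *\<^sub>R \<phi> x) has_derivative (\<lambda>v. 0 + T v)) (at x)"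
        unfolding e by (intro has_derivative_add has_derivative_const bounded_linear_imp_has_derivative bT)
      ultimately have "(\<lambda>v. (1 / (\<phi> x \<bullet> p)) *\<^sub>R ?d v + (- (?d v \<bullet> p) / (\<phi> x \<bullet> p)\<^sup>2) *\<^sub>R \<phi> x) = (\<lambda>v. 0 + T v)"
        by (rule has_derivative_unique)
      from fun_cong[OF this, of v] have "T v = 0" using v by simp
      then show "v = 0" using T(2)[of v v] by simp
    qed
    then show ?thesis using linear_injective_0[OF lin] by blast
  qed
  moreover have "openin (top_of_set (sphere 0 1)) (range \<phi>)"
    unfolding im by (intro openin_open_Int open_halfspace_gt)
  moreover have "homeomorphism UNIV (range \<phi>) \<phi> \<psi>"
  proof (rule homeomorphismI)
    show "continuous_on UNIV \<phi>" using C[of 0] by simp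
    show "continuous_on (range \<phi>) \<psi>"
      unfolding \<psi>_def[abs_def] im by (auto intro!: continuous_intros simp: inner_commute)
  qed (auto simp: \<psi>\<phi>)
  ultimately have "patch (sphere 0 1) UNIV \<phi>" unfolding patch_def using C[of 2] by auto
  moreover have "p \<in> range \<phi>" unfolding im using p pp by simp
  ultimately show thesis by (rule that)
qed

lemma submanifold_sphere:
  assumes "CARD('m::finite) = CARD('n::finite) + 1"
  shows "submanifold TYPE('n) (sphere 0 1 :: (real^'m) set)"
  unfolding submanifold_def
proof
  fix p :: "real^'m" assume "p \<in> sphere 0 1"
  then have "norm p = 1" by simp
  then obtain \<phi> :: "real^'n \<Rightarrow> real^'m" where "patch (sphere 0 1) UNIV \<phi>" "p \<in> range \<phi>"
    using sphere_patch[OF assms] by blast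
  then show "\<exists>(U :: (real^'n) set) \<phi>. patch (sphere 0 1) U \<phi> \<and> p \<in> \<phi> ` U" by blast
qed

lemma sphere_patch_props:
  fixes \<phi> :: "real^'n::finite \<Rightarrow> real^'m::finite"
  assumes card: "CARD('m) = CARD('n) + 1" and p: "patch (sphere 0 1) U \<phi>" and x: "x \<in> U"
  shows "\<phi> x \<bullet> \<phi> x = 1" "\<phi> x \<bullet> frechet_derivative \<phi> (at x) v = 0"
    "sqrt (gram_det (\<bullet>) \<phi> x) = frame_volume (\<phi> x) (frechet_derivative \<phi> (at x))"
proof -
  have on: "\<phi> z \<bullet> \<phi> z = 1" if "z \<in> U" for z
    using patch_image_subset[OF p] that by (auto simp: norm_eq_sqrt_inner)
  show "\<phi> x \<bullet> \<phi> x = 1" by (rule on[OF x])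
  let ?d = "frechet_derivative \<phi> (at x)"
  have "((\<lambda>z. \<phi> z \<bullet> \<phi> z) has_derivative (\<lambda>v. \<phi> x \<bullet> ?d v + ?d v \<bullet> \<phi> x)) (at x)"
    by (intro has_derivative_inner patch_has_derivative[OF p x])
  moreover have "((\<lambda>z. \<phi> z \<bullet> \<phi> z) has_derivative (\<lambda>v. 0)) (at x)"
    by (rule has_derivative_transform_within_open[OF has_derivative_const[of 1] patch_Ck1(1)[OF p] x]) (simp add: on)
  ultimately have "(\<lambda>v. \<phi> x \<bullet> ?d v + ?d v \<bullet> \<phi> x) = (\<lambda>v. 0)" by (rule has_derivative_unique)
  then have zero: "\<phi> x \<bullet> ?d v + ?d v \<bullet> \<phi> x = 0" for v by (rule fun_cong)
  show orth: "\<phi> x \<bullet> ?d v = 0" for v using zero[of v] by (simp add: inner_commute[of "?d v" "\<phi> x"])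
  have R: "basis_iso (reindex :: real^'m \<Rightarrow> real^'n ext)"
    using card by (intro basis_iso_reindex) (simp add: CARD_ext)
  have "gram_det (\<bullet>) \<phi> x = det (gram (\<lambda>i. reindex (?d (axis i 1)) :: real^'n ext))"
    by (simp add: gram_det_def gram_def basis_iso_inner[OF R])
  also have "\<dots> = (frame_volume (\<phi> x) ?d)\<^sup>2"
    using det_gram_normal[of "reindex (\<phi> x) :: real^'n ext" "\<lambda>i. reindex (?d (axis i 1))"]
    by (simp add: basis_iso_inner[OF R] orth on[OF x] frame_volume_def)
  finally show "sqrt (gram_det (\<bullet>) \<phi> x) = frame_volume (\<phi> x) ?d" by (simp add: frame_volume_nonneg)
qed

lemma nn_integral_power_01: "(\<integral>\<^sup>+s. ennreal (s ^ n) * indicator {0<..<1} s \<partial>lborel) = ennreal (1 / (real n + 1))"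
proof -
  have "(\<integral>\<^sup>+s. ennreal (s ^ n) * indicator {0<..<1::real} s \<partial>lborel) = (\<integral>\<^sup>+s. ennreal (s ^ n) * indicator {0..1} s \<partial>lborel)"
  proof (rule nn_integral_cong_AE)
    have "AE s in lborel. s \<noteq> (0::real)" "AE s in lborel. s \<noteq> (1::real)" by (auto intro: AE_lborel_singleton)
    then show "AE s in lborel. ennreal (s ^ n) * indicator {0<..<1} s = ennreal (s ^ n) * indicator {0..1::real} s"
      by eventually_elim (auto simp: indicator_def)
  qed
  also have "\<dots> = ennreal (1 ^ Suc n / (real n + 1) - 0 ^ Suc n / (real n + 1))"
  proof (rule nn_integral_FTC_Icc)
    fix x :: real
    have "((\<lambda>x. x ^ Suc n / (real n + 1)) has_real_derivative (real (Suc n) * x ^ n) / (real n + 1)) (at x)"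
      by (rule DERIV_cdivide) (use DERIV_pow[of "Suc n" x] in simp)
    moreover have "real (Suc n) * x ^ n / (real n + 1) = x ^ n"
      using nonzero_mult_div_cancel_left[of "real (Suc n)" "x ^ n"] by (simp add: add.commute)
    ultimately show "((\<lambda>x. x ^ Suc n / (real n + 1)) has_real_derivative x ^ n) (at x)"
      by (simp only:)
    show "(\<lambda>s::real. s ^ n) \<in> borel_measurable borel" by simp
  qed auto
  finally show ?thesis by simp
qed

text \<open>
  \<open>Q\<close> is the open cone over the spherical piece \<open>\<phi> ` A\<close>, injectively parametrized by \<open>(x, s) \<mapsto> s \<phi> x\<close>
  with Jacobian \<open>s\<^sup>n\<close> times the area element, and the integral of \<open>s\<^sup>n\<close> over the unit interval is
  \<open>1 / (n + 1)\<close>.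
\<close>

lemma cone_measure:
  fixes \<phi> :: "real^'n::finite \<Rightarrow> real^'m::finite"
  assumes card: "CARD('m) = CARD('n) + 1" and p: "patch (sphere 0 1) U \<phi>" and A: "A \<in> sets borel" "A \<subseteq> U"
  defines "Q \<equiv> {y. 0 < norm y \<and> norm y < 1 \<and> (1 / norm y) *\<^sub>R y \<in> \<phi> ` A}"
  shows "Q \<in> sets borel"
    "(\<integral>\<^sup>+x\<in>A. ennreal (sqrt (gram_det (\<bullet>) \<phi> x)) \<partial>lborel) = ennreal (real CARD('m)) * emeasure lborel Q"
proof -
  note U = patch_Ck1(1)[OF p]
  have n1: "norm (\<phi> x) = 1" if "x \<in> U" for x
    using sphere_patch_props(1)[OF card p that] by (simp add: norm_eq_sqrt_inner)
  have \<phi>A: "\<phi> ` A \<in> sets borel" by (rule patch_image_borel[OF p closed_sphere A])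
  have "(\<lambda>y::real^'m. (1 / norm y) *\<^sub>R y) \<in> borel_measurable borel" by measurable
  from measurable_sets[OF this \<phi>A] have "(\<lambda>y. (1 / norm y) *\<^sub>R y) -` (\<phi> ` A) \<in> sets borel" by simp
  moreover have "Q = ball 0 1 \<inter> - {0} \<inter> (\<lambda>y. (1 / norm y) *\<^sub>R y) -` (\<phi> ` A)"
    by (auto simp: Q_def)
  ultimately show QB: "Q \<in> sets borel" by simp
  interpret field_along "\<lambda>x. 0 :: real^'m" \<phi> "\<lambda>x v. 0" "\<lambda>x. frechet_derivative \<phi> (at x)" U
    by standard (auto simp: card U patch_has_derivative[OF p] patch_continuous_on_derivative[OF p])
  interpret P: parametrised_image F F' "A \<times> {0<..<1}"
    using A by (intro parametrised_image) auto
  define J where "J x = sqrt (gram_det (\<bullet>) \<phi> x)" for x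
  have J0: "J x \<ge> 0" if "x \<in> U" for x
    using sphere_patch_props(3)[OF card p that] by (simp add: J_def frame_volume_nonneg)
  have Jm: "(\<lambda>x. indicator A x * J x) \<in> borel_measurable borel"
    unfolding J_def
    by (rule borel_indicator_times_continuous_on[OF _ A]) (intro continuous_intros gram_det_continuous_on[OF p] continuous_on_inner)
  have jac: "jac (F' z) = snd z ^ CARD('n) * J (fst z)" if "z \<in> A \<times> {0<..<1}" for z
  proof -
    have z: "fst z \<in> U" "0 < snd z" using that A by auto
    have R: "linear (reindex :: real^'m \<Rightarrow> real^'n ext)" using card by (intro basis_iso_linear basis_iso_reindex) (simp add: CARD_ext)
    have "jac (F' z) = frame_volume (\<phi> (fst z)) (\<lambda>v. 0 + snd z *\<^sub>R frechet_derivative \<phi> (at (fst z)) v)"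
      by (rule jac_F'[OF z(1)])
    also have "\<dots> = snd z ^ CARD('n) * frame_volume (\<phi> (fst z)) (frechet_derivative \<phi> (at (fst z)))"
      using z(2) by (simp add: frame_volume_def linear_cmul[OF R] det_rowmat_scale abs_mult)
    finally show ?thesis using sphere_patch_props(3)[OF card p z(1)] by (simp add: J_def)
  qed
  have FQ: "F ` (A \<times> {0<..<1}) = Q"
  proof
    have "\<phi> x \<noteq> 0" if "x \<in> U" for x using n1[OF that] by auto
    then show "F ` (A \<times> {0<..<1}) \<subseteq> Q" using n1 A by (auto simp: F_def Q_def subset_iff)
    show "Q \<subseteq> F ` (A \<times> {0<..<1})"
    proof
      fix y assume y: "y \<in> Q"
      then obtain x where x: "x \<in> A" "(1 / norm y) *\<^sub>R y = \<phi> x" by (auto simp: Q_def)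
      have "norm y *\<^sub>R ((1 / norm y) *\<^sub>R y) = y" using y by (simp add: Q_def)
      then have "y = F (x, norm y)" unfolding x(2) by (simp add: F_def)
      then show "y \<in> F ` (A \<times> {0<..<1})" using x y by (intro image_eqI[of _ _ "(x, norm y)"]) (auto simp: Q_def)
    qed
  qed
  have inj: "inj_on F (A \<times> {0<..<1})"
  proof (rule inj_onI)
    fix a b assume a: "a \<in> A \<times> {0<..<1}" and b: "b \<in> A \<times> {0<..<1}" and eq: "F a = F b"
    have "norm (F a) = snd a" "norm (F b) = snd b" using a b A n1 by (auto simp: F_def)
    then have s: "snd a = snd b" using eq by simp
    then have "\<phi> (fst a) = \<phi> (fst b)" using eq a by (auto simp: F_def)
    moreover have "fst a \<in> U" "fst b \<in> U" using a b A by auto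
    ultimately have "fst a = fst b" by (rule inj_onD[OF patch_inj_on[OF p]])
    then show "a = b" using s by (simp add: prod_eq_iff)
  qed
  have "bounded Q" by (rule bounded_subset[of "ball 0 1"]) (auto simp: Q_def)
  then have "emeasure lborel Q = (\<integral>\<^sup>+z\<in>A \<times> {0<..<1}. jac (F' z) \<partial>lborel)"
    using P.emeasure_inj_image[OF inj] QB unfolding FQ by simp
  also have "\<dots> = (\<integral>\<^sup>+z. ennreal (indicator A (fst z) * J (fst z)) * (ennreal (snd z ^ CARD('n)) * indicator {0<..<1} (snd z)) \<partial>(lborel \<Otimes>\<^sub>M lborel))"
    unfolding lborel_prod
  proof (rule nn_integral_cong)
    fix z :: "(real^'n) \<times> real"
    show "ennreal (jac (F' z)) * indicator (A \<times> {0<..<1}) z =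
      ennreal (indicator A (fst z) * J (fst z)) * (ennreal (snd z ^ CARD('n)) * indicator {0<..<1} (snd z))"
    proof (cases "z \<in> A \<times> {0<..<1}")
      case True
      then have "J (fst z) \<ge> 0" using A by (intro J0) auto
      then show ?thesis using True jac[OF True] by (cases z) (auto simp: ennreal_mult mult.commute)
    next
      case False
      then show ?thesis by (cases z) (auto simp: indicator_def)
    qed
  qed
  also have "\<dots> = (\<integral>\<^sup>+x. \<integral>\<^sup>+s. ennreal (indicator A x * J x) * (ennreal (s ^ CARD('n)) * indicator {0<..<1} s) \<partial>lborel \<partial>lborel)"
  proof (subst lborel.nn_integral_fst[symmetric])
    have "(\<lambda>x. ennreal (indicator A x * J x)) \<in> borel_measurable lborel" using Jm by simp
    then show "(\<lambda>z. ennreal (indicator A (fst z) * J (fst z)) * (ennreal (snd z ^ CARD('n)) * indicator {0<..<1} (snd z))) \<in> borel_measurable (lborel \<Otimes>\<^sub>M lborel)"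
      by measurable
  qed simp
  also have "\<dots> = (\<integral>\<^sup>+x. ennreal (indicator A x * J x) * ennreal (1 / real CARD('m)) \<partial>lborel)"
    by (subst nn_integral_cmult) (simp_all add: nn_integral_power_01 card add.commute)
  also have "\<dots> = (\<integral>\<^sup>+x. ennreal (indicator A x * J x) \<partial>lborel) * ennreal (1 / real CARD('m))"
    using Jm by (intro nn_integral_multc) simp
  also have "(\<integral>\<^sup>+x. ennreal (indicator A x * J x) \<partial>lborel) = (\<integral>\<^sup>+x\<in>A. ennreal (J x) \<partial>lborel)"
    by (intro nn_integral_cong) (auto simp: indicator_def)
  finally have "ennreal (real CARD('m)) * emeasure lborel Q =
     (\<integral>\<^sup>+x\<in>A. ennreal (J x) \<partial>lborel) * (ennreal (real CARD('m)) * ennreal (1 / real CARD('m)))"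
    by (simp add: mult_ac)
  also have "ennreal (real CARD('m)) * ennreal (1 / real CARD('m)) = 1"
    by (simp add: ennreal_mult[symmetric])
  finally show "(\<integral>\<^sup>+x\<in>A. ennreal (sqrt (gram_det (\<bullet>) \<phi> x)) \<partial>lborel) = ennreal (real CARD('m)) * emeasure lborel Q"
    by (simp add: J_def)
qed

text \<open>
  The cones over disjoint pieces of the sphere are disjoint subsets of the unit ball.
\<close>

lemma sphere_measure_le:
  fixes \<sigma> :: "(real^'m::finite) measure"
  assumes card: "CARD('m) = CARD('n::finite) + 1" and rm: "riemannian_measure TYPE('n) (\<bullet>) (sphere 0 1) \<sigma>"
    and pc: "pieces (sphere 0 1) K U (\<phi> :: nat \<Rightarrow> real^'n \<Rightarrow> real^'m) C A"
  shows "emeasure \<sigma> (sphere 0 1) = (\<Sum>k<K. \<integral>\<^sup>+x\<in>A k. ennreal (sqrt (gram_det (\<bullet>) (\<phi> k) x)) \<partial>lborel)"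
    "emeasure \<sigma> (sphere 0 1) \<le> ennreal (real CARD('m) * measure lebesgue (ball (0 :: real^'m) 1))"
proof -
  have sp: "space \<sigma> = sphere 0 1" using rm by (simp add: riemannian_measure_def)
  have pk: "patch (sphere 0 1) (U k) (\<phi> k)" "A k \<in> sets borel" "A k \<subseteq> U k" if "k < K" for k
    using pc that by (auto simp: pieces_def)
  have "emeasure \<sigma> (sphere 0 1) = (\<integral>\<^sup>+p. ennreal 1 \<partial>\<sigma>)" using sp by (simp flip: sp)
  also have "\<dots> = (\<Sum>k<K. \<integral>\<^sup>+x\<in>A k. ennreal (1 * sqrt (gram_det (\<bullet>) (\<phi> k) x)) \<partial>lborel)"
    by (rule riemannian_measure_integral[OF rm closed_sphere pc continuous_on_inner]) auto
  finally show 1: "emeasure \<sigma> (sphere 0 1) = (\<Sum>k<K. \<integral>\<^sup>+x\<in>A k. ennreal (sqrt (gram_det (\<bullet>) (\<phi> k) x)) \<partial>lborel)" by simp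
  define Q where "Q k = {y. 0 < norm y \<and> norm y < 1 \<and> (1 / norm y) *\<^sub>R y \<in> \<phi> k ` A k}" for k
  have QB: "Q k \<in> sets borel" if "k < K" for k
    unfolding Q_def by (rule cone_measure(1)[OF card pk[OF that]])
  have "disjoint_family_on Q {..<K}"
    using pc unfolding pieces_def disjoint_family_on_def Q_def by blast
  then have "(\<Sum>k<K. emeasure lborel (Q k)) = emeasure lborel (\<Union>k<K. Q k)"
    using QB by (intro sum_emeasure) auto
  also have "\<dots> \<le> emeasure lborel (ball (0 :: real^'m) 1)"
    by (intro emeasure_mono) (auto simp: Q_def)
  also have "\<dots> = ennreal (measure lebesgue (ball (0 :: real^'m) 1))"
    using emeasure_lborel_ball_finite[of "0 :: real^'m" 1] by (subst emeasure_eq_ennreal_measure) auto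
  finally have "ennreal (real CARD('m)) * (\<Sum>k<K. emeasure lborel (Q k)) \<le> ennreal (real CARD('m) * measure lebesgue (ball (0 :: real^'m) 1))"
    by (simp add: ennreal_mult mult_left_mono)
  moreover have "emeasure \<sigma> (sphere 0 1) = ennreal (real CARD('m)) * (\<Sum>k<K. emeasure lborel (Q k))"
    unfolding 1 sum_distrib_left Q_def using cone_measure(2)[OF card pk] by (intro sum.cong) auto
  ultimately show "emeasure \<sigma> (sphere 0 1) \<le> ennreal (real CARD('m) * measure lebesgue (ball (0 :: real^'m) 1))" by simp
qed

section \<open>The weighted volume, and integrals of continuous functions\<close>

lemma closed_hyp_space: "closed (hyp_space :: ('a::euclidean_space \<times> real) set)"
proof -
  have *: "hyp_space = {p :: 'a \<times> real. snd p = sqrt (1 + fst p \<bullet> fst p)}"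
    using hyp_space_iff by blast
  show ?thesis unfolding * by (intro closed_Collect_eq continuous_intros)
qed

lemma lift_patch: "patch (hyp_space :: ((real^'m::finite) \<times> real) set) UNIV lift"
proof -
  have C: "Ck_on k (lift :: real^'m \<Rightarrow> _) UNIV" for k
    unfolding lift_def[abs_def] by (intro Ck_on_Pair Ck_on_sqrt_one_plus_norm Ck_on_bounded_linear bounded_linear_ident open_UNIV)
  have "inj (frechet_derivative (lift :: real^'m \<Rightarrow> _) (at x))" for x
  proof -
    have d: "(lift has_derivative frechet_derivative lift (at x)) (at x)"
      by (rule Ck_on_has_derivative[OF C[of "Suc 0"] open_UNIV UNIV_I])
    have "((\<lambda>z. fst (lift z)) has_derivative (\<lambda>v. fst (frechet_derivative lift (at x) v))) (at x)"
      by (rule has_derivative_fst[OF d])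
    moreover have "((\<lambda>z. fst (lift z)) has_derivative (\<lambda>v. v)) (at x)" by simp
    ultimately have "(\<lambda>v. fst (frechet_derivative lift (at x) v)) = (\<lambda>v. v)" by (rule has_derivative_unique)
    note left = fun_cong[OF this]
    show ?thesis by (rule inj_on_inverseI[of _ fst]) (rule left)
  qed
  moreover have "range lift = (hyp_space :: ((real^'m) \<times> real) set)"
    using homeomorphism_lift unfolding homeomorphism_def by blast
  ultimately show ?thesis unfolding patch_def using C[of 2] homeomorphism_lift[where 'a = "real^'m"]
    by (intro conjI ballI exI[of _ fst] open_UNIV) simp_all
qed

lemma fst_derivative_lift: "fst (frechet_derivative lift (at x) v) = v" for x :: "real^'m::finite"
proof -
  have "((\<lambda>z. fst (lift z)) has_derivative (\<lambda>v. fst (frechet_derivative lift (at x) v))) (at x)"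
    by (rule has_derivative_fst[OF patch_has_derivative[OF lift_patch UNIV_I]])
  moreover have "((\<lambda>z. fst (lift z)) has_derivative (\<lambda>v. v)) (at x)" by simp
  ultimately have "(\<lambda>v. fst (frechet_derivative lift (at x) v)) = (\<lambda>v. v)" by (rule has_derivative_unique)
  then show ?thesis by (rule fun_cong)
qed

text \<open>
  The hyperbolic volume element is \<open>dx / x\<^sub>0\<close>.
\<close>

lemma gram_det_lift: "snd (lift x) * sqrt (gram_det mink lift x) = 1" for x :: "real^'m::finite"
proof -
  let ?d = "frechet_derivative lift (at x)"
  have sp: "(snd (lift x))\<^sup>2 = 1 + x \<bullet> x" "snd (lift x) > 0" using hyp_space_snd[OF lift_in_hyp_space[of x]] by simp_all
  have "mink (?d (axis i 1)) (?d (axis j 1)) = mat 1 $ i $ j - x $ i * x $ j / (1 + x \<bullet> x)" for i j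
  proof -
    have "x $ k = snd (lift x) * snd (?d (axis k 1))" for k
      using patch_tangent_orthogonal_point[OF lift_patch order_refl UNIV_I, of x "axis k 1"]
      by (simp add: mink_def fst_derivative_lift inner_axis)
    then have "x $ i * x $ j = (snd (lift x))\<^sup>2 * (snd (?d (axis i 1)) * snd (?d (axis j 1)))"
      by (simp add: power2_eq_square)
    then have "x $ i * x $ j / (1 + x \<bullet> x) = snd (?d (axis i 1)) * snd (?d (axis j 1))"
      using sp(2) unfolding sp(1)[symmetric] by simp
    then show ?thesis by (simp add: mink_def fst_derivative_lift inner_axis_axis mat_def)
  qed
  then have "gram_det mink lift x = det (\<chi> i j. mat 1 $ i $ j - x $ i * x $ j / (1 + x \<bullet> x))"
    by (simp add: gram_det_def)
  then have "(snd (lift x))\<^sup>2 * gram_det mink lift x = det (bordered (1 + x \<bullet> x) x x (mat 1))"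
    using one_plus_inner_pos[of x] by (simp add: det_bordered sp(1))
  then have "(snd (lift x))\<^sup>2 * gram_det mink lift x = 1" by (simp add: det_bordered_mat_1)
  then have "sqrt ((snd (lift x))\<^sup>2 * gram_det mink lift x) = 1" by simp
  then show ?thesis using sp(2) by (simp add: real_sqrt_mult)
qed

lemma cosh_hyp_dist_origin:
  assumes "p \<in> hyp_space" shows "cosh (hyp_dist hyp_origin p) = snd p"
  using hyp_space_snd(3)[OF assms] by (simp add: hyp_dist_def hyp_origin_def mink_def cosh_arcosh_real)

lemma weighted_volume_eq_lebesgue:
  fixes \<Omega> :: "((real^'m::finite) \<times> real) set"
  assumes rm: "riemannian_measure TYPE('m) mink hyp_space N" and sub: "\<Omega> \<subseteq> hyp_space"
    and D: "open (fst ` \<Omega>)" "bounded (fst ` \<Omega>)"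
  shows "(LINT p:\<Omega>|N. cosh (hyp_dist hyp_origin p)) = measure lebesgue (fst ` \<Omega>)"
proof -
  have sp: "space N = hyp_space" and se: "sets N = sets (restrict_space borel hyp_space)"
    using rm by (auto simp: riemannian_measure_def)
  have "(\<lambda>p. lift (fst p)) ` \<Omega> = (\<lambda>p. p) ` \<Omega>"
    by (rule image_cong[OF refl]) (use sub lift_fst in blast)
  then have im: "lift ` (fst ` \<Omega>) = \<Omega>" unfolding image_image by simp
  have DB: "fst ` \<Omega> \<in> sets borel" using D by simp
  have \<Omega>N: "\<Omega> \<in> sets N"
    using patch_image_borel[OF lift_patch closed_hyp_space DB subset_UNIV] sub closed_hyp_space unfolding se im
    by (subst sets_restrict_space_iff) (auto intro: borel_closed)
  have sb: "snd \<in> borel_measurable (borel :: ((real^'m) \<times> real) measure)"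
    by (intro borel_measurable_continuous_onI continuous_intros)
  have sm: "snd \<in> borel_measurable N"
    unfolding measurable_cong_sets[OF se refl] by (rule measurable_restrict_space1[OF sb])
  have "(\<integral>\<^sup>+p\<in>lift ` (fst ` \<Omega>). ennreal (snd p) \<partial>N) = (\<integral>\<^sup>+x\<in>fst ` \<Omega>. ennreal (snd (lift x) * sqrt (gram_det mink lift x)) \<partial>lborel)"
  proof (rule riemannian_measure_patch_integral[OF rm closed_hyp_space lift_patch DB subset_UNIV continuous_on_mink])
    show "(\<lambda>p. indicator hyp_space p * snd p) \<in> borel_measurable (borel :: ((real^'m) \<times> real) measure)"
      using closed_hyp_space by (intro borel_measurable_times borel_measurable_indicator sb) (auto intro: borel_closed)
  qed (auto dest: hyp_space_snd(1))
  also have "\<dots> = emeasure lborel (fst ` \<Omega>)" using DB by (simp add: gram_det_lift)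
  also have "\<dots> = ennreal (measure lebesgue (fst ` \<Omega>))"
    using emeasure_bounded_finite[OF D(2)] DB by (subst emeasure_eq_ennreal_measure) (auto simp: less_top[symmetric])
  finally have nn: "(\<integral>\<^sup>+p\<in>\<Omega>. ennreal (snd p) \<partial>N) = ennreal (measure lebesgue (fst ` \<Omega>))" unfolding im .
  have "(LINT p:\<Omega>|N. cosh (hyp_dist hyp_origin p)) = (LINT p|N. indicator \<Omega> p * snd p)"
    unfolding set_lebesgue_integral_def
    by (rule Bochner_Integration.integral_cong) (auto simp: cosh_hyp_dist_origin sp)
  also have "\<dots> = enn2real (\<integral>\<^sup>+p. ennreal (indicator \<Omega> p * snd p) \<partial>N)"
  proof (rule integral_eq_nn_integral)
    show "(\<lambda>p. indicator \<Omega> p * snd p) \<in> borel_measurable N" using \<Omega>N sm by simp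
    show "AE p in N. 0 \<le> indicator \<Omega> p * snd p"
    proof (rule AE_I2)
      fix p assume "p \<in> space N"
      then have "0 < snd p" using hyp_space_snd(1) sp by blast
      then show "0 \<le> indicator \<Omega> p * snd p" by (simp add: indicator_def)
    qed
  qed
  also have "(\<integral>\<^sup>+p. ennreal (indicator \<Omega> p * snd p) \<partial>N) = (\<integral>\<^sup>+p\<in>\<Omega>. ennreal (snd p) \<partial>N)"
    by (intro nn_integral_cong) (auto simp: indicator_def)
  finally show ?thesis by (simp add: nn)
qed

lemma riemannian_measure_compact_finite:
  fixes M :: "((real^'m::finite) \<times> real) set"
  assumes rm: "riemannian_measure TYPE('n::finite) mink M \<mu>" and cM: "compact M"
    and pc: "pieces M K U (\<phi> :: nat \<Rightarrow> real^'n \<Rightarrow> _) C A"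
  shows "finite_measure \<mu>"
proof
  have sp: "space \<mu> = M" using rm by (simp add: riemannian_measure_def)
  have "emeasure \<mu> M = (\<integral>\<^sup>+p. ennreal 1 \<partial>\<mu>)" by (simp flip: sp)
  also have "\<dots> = (\<Sum>k<K. \<integral>\<^sup>+x\<in>A k. ennreal (1 * sqrt (gram_det mink (\<phi> k) x)) \<partial>lborel)"
    by (rule riemannian_measure_integral[OF rm compact_imp_closed[OF cM] pc continuous_on_mink]) auto
  also have "\<dots> < \<infinity>"
  proof -
    have "(\<integral>\<^sup>+x\<in>A k. ennreal (sqrt (gram_det mink (\<phi> k) x)) \<partial>lborel) < \<infinity>" if k: "k < K" for k
    proof -
      have pk: "patch M (U k) (\<phi> k)" "compact (C k)" "C k \<subseteq> U k" "A k \<subseteq> C k" using pc k by (auto simp: pieces_def)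
      have "continuous_on (C k) (\<lambda>x. sqrt (gram_det mink (\<phi> k) x))"
        by (intro continuous_intros continuous_on_subset[OF gram_det_continuous_on[OF pk(1) continuous_on_mink] pk(3)])
      then have "compact ((\<lambda>x. sqrt (gram_det mink (\<phi> k) x)) ` C k)" using pk(2) by (rule compact_continuous_image)
      then obtain B where "\<forall>y\<in>(\<lambda>x. sqrt (gram_det mink (\<phi> k) x)) ` C k. norm y \<le> B"
        using compact_imp_bounded bounded_iff by blast
      then have B: "\<bar>sqrt (gram_det mink (\<phi> k) x)\<bar> \<le> B" if "x \<in> C k" for x
        using that by simp
      have "(\<integral>\<^sup>+x\<in>A k. ennreal (sqrt (gram_det mink (\<phi> k) x)) \<partial>lborel) \<le> (\<integral>\<^sup>+x. ennreal B * indicator (C k) x \<partial>lborel)"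
      proof (rule nn_integral_mono)
        fix x show "ennreal (sqrt (gram_det mink (\<phi> k) x)) * indicator (A k) x \<le> ennreal B * indicator (C k) x"
        proof (cases "x \<in> A k")
          case True
          then have "x \<in> C k" using pk(4) by blast
          then show ?thesis using True ennreal_leI[OF order_trans[OF abs_ge_self B]] by simp
        qed simp
      qed
      also have "\<dots> = ennreal B * emeasure lborel (C k)"
        using pk(2) by (intro nn_integral_cmult_indicator) (auto intro: borel_compact)
      also have "\<dots> < \<infinity>" using emeasure_compact_finite[OF pk(2)]
        using ennreal_mult_less_top[of "ennreal B" "emeasure lborel (C k)"] by (simp add: less_top)
      finally show ?thesis .
    qed
    then show ?thesis by (simp add: ennreal_sum_less_top)
  qed
  finally show "emeasure \<mu> (space \<mu>) \<noteq> \<infinity>" by (simp add: sp)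
qed

lemma compact_continuous_integral:
  fixes M :: "((real^'m::finite) \<times> real) set" and g :: "_ \<Rightarrow> real"
  assumes rm: "riemannian_measure TYPE('n::finite) mink M \<mu>" and cM: "compact M"
    and sub: "submanifold TYPE('n) M" and g: "continuous_on M g"
  shows "integrable \<mu> g" "(\<And>p. p \<in> M \<Longrightarrow> 0 \<le> g p) \<Longrightarrow> (\<integral>\<^sup>+p. ennreal (g p) \<partial>\<mu>) = ennreal (LINT p|\<mu>. g p)"
proof -
  obtain K U and \<phi> :: "nat \<Rightarrow> real^'n \<Rightarrow> (real^'m) \<times> real" and C A where pc: "pieces M K U \<phi> C A"
    using compact_submanifold_pieces[OF cM sub] .
  interpret finite_measure \<mu> by (rule riemannian_measure_compact_finite[OF rm cM pc])
  have sp: "space \<mu> = M" and se: "sets \<mu> = sets (restrict_space borel M)"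
    using rm by (auto simp: riemannian_measure_def)
  have gm: "g \<in> borel_measurable \<mu>"
    unfolding measurable_cong_sets[OF se refl] by (rule borel_measurable_continuous_on_restrict[OF g])
  have "compact (g ` M)" by (rule compact_continuous_image[OF g cM])
  then obtain B where "\<forall>y\<in>g ` M. norm y \<le> B" using compact_imp_bounded bounded_iff by blast
  then have B: "norm (g p) \<le> B" if "p \<in> M" for p using that by simp
  show int: "integrable \<mu> g"
    by (rule integrable_const_bound[OF AE_I2 gm]) (use B sp in simp)
  assume "\<And>p. p \<in> M \<Longrightarrow> 0 \<le> g p"
  then show "(\<integral>\<^sup>+p. ennreal (g p) \<partial>\<mu>) = ennreal (LINT p|\<mu>. g p)"
    by (intro nn_integral_eq_integral int AE_I2) (simp add: sp)
qed

context normal_hypersurface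
begin

text \<open>
  Nonempty relatively open sets have positive measure, since the density in every patch is positive.
\<close>

lemma continuous_nonneg_integral_zero:
  assumes cS: "compact S" and sub: "submanifold TYPE('n) S" and rm: "riemannian_measure TYPE('n) mink S \<mu>"
    and g: "continuous_on S g" "\<And>p. p \<in> S \<Longrightarrow> 0 \<le> g p" and zero: "(LINT p|\<mu>. g p) = (0::real)" and q: "q \<in> S"
  shows "g q = 0"
proof (rule ccontr)
  assume "g q \<noteq> 0"
  then have gq: "g q > 0" using g(2)[OF q] by simp
  obtain U and \<phi> :: "real^'n \<Rightarrow> (real^'m) \<times> real" and x where p: "patch S U \<phi>" "x \<in> U" "q = \<phi> x"
    using patch_at[OF sub q] .
  have sp: "space \<mu> = S" and se: "sets \<mu> = sets (restrict_space borel S)"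
    using rm by (auto simp: riemannian_measure_def)
  have "continuous_on U (\<lambda>z. g (\<phi> z))"
    by (rule continuous_on_compose2[OF g(1) patch_continuous_on[OF p(1)] patch_image_subset[OF p(1)]])
  then have oV: "open (U \<inter> (\<lambda>z. g (\<phi> z)) -` {0<..})"
    by (rule continuous_open_preimage[OF _ patch_Ck1(1)[OF p(1)]]) simp
  define V where "V = U \<inter> (\<lambda>z. g (\<phi> z)) -` {0<..}"
  have V: "open V" "V \<subseteq> U" "x \<in> V" using oV p gq by (auto simp: V_def)
  have gm: "g \<in> borel_measurable \<mu>"
    unfolding measurable_cong_sets[OF se refl] by (rule borel_measurable_continuous_on_restrict[OF g(1)])
  have gb: "(\<lambda>p. indicator S p * g p) \<in> borel_measurable borel"
    using borel_measurable_continuous_on_indicator[OF _ g(1)] compact_imp_closed[OF cS] by simp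
  have VB: "V \<in> sets borel" using V(1) by (rule borel_open)
  have "(\<integral>\<^sup>+z\<in>V. ennreal (g (\<phi> z) * sqrt (gram_det mink \<phi> z)) \<partial>lborel) = (\<integral>\<^sup>+p\<in>\<phi> ` V. ennreal (g p) \<partial>\<mu>)"
    by (rule riemannian_measure_patch_integral[OF rm compact_imp_closed[OF cS] p(1) VB V(2) continuous_on_mink gb g(2), symmetric])
  also have "\<dots> \<le> (\<integral>\<^sup>+p. ennreal (g p) \<partial>\<mu>)"
  proof (rule nn_integral_mono)
    show "ennreal (g p) * indicator (\<phi> ` V) p \<le> ennreal (g p)" for p by (cases "p \<in> \<phi> ` V") simp_all
  qed
  also have "\<dots> = ennreal (LINT p|\<mu>. g p)" by (rule compact_continuous_integral(2)[OF rm cS sub g])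
  also have "\<dots> = 0" by (simp only: zero ennreal_0)
  finally have "(\<integral>\<^sup>+z\<in>V. ennreal (g (\<phi> z) * sqrt (gram_det mink \<phi> z)) \<partial>lborel) = 0" by (simp only: le_zero_eq)
  moreover have "(\<lambda>z. ennreal (g (\<phi> z) * sqrt (gram_det mink \<phi> z)) * indicator V z) \<in> borel_measurable lborel"
  proof -
    have "continuous_on U (\<lambda>z. g (\<phi> z) * sqrt (gram_det mink \<phi> z))"
      by (intro continuous_intros gram_det_continuous_on[OF p(1) continuous_on_mink] \<open>continuous_on U (\<lambda>z. g (\<phi> z))\<close>)
    then have "(\<lambda>z. indicator V z * (g (\<phi> z) * sqrt (gram_det mink \<phi> z))) \<in> borel_measurable borel"
      using V by (intro borel_indicator_times_continuous_on[of U]) auto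
    then have "(\<lambda>z. ennreal (indicator V z * (g (\<phi> z) * sqrt (gram_det mink \<phi> z)))) \<in> borel_measurable lborel" by simp
    also have "(\<lambda>z. ennreal (indicator V z * (g (\<phi> z) * sqrt (gram_det mink \<phi> z)))) =
       (\<lambda>z. ennreal (g (\<phi> z) * sqrt (gram_det mink \<phi> z)) * indicator V z)" by (auto simp: indicator_def)
    finally show ?thesis .
  qed
  ultimately have "AE z in lborel. ennreal (g (\<phi> z) * sqrt (gram_det mink \<phi> z)) * indicator V z = 0"
    by (simp add: nn_integral_0_iff_AE)
  then have "AE z in lborel. z \<notin> V"
  proof eventually_elim
    fix z assume z: "ennreal (g (\<phi> z) * sqrt (gram_det mink \<phi> z)) * indicator V z = 0"
    show "z \<notin> V"
    proof
      assume zV: "z \<in> V"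
      then have "g (\<phi> z) * sqrt (gram_det mink \<phi> z) > 0"
        using gram_mink_pos[OF p(1), of z] V(2) by (intro mult_pos_pos) (auto simp: V_def)
      then show False using z zV by (simp add: ennreal_eq_0_iff)
    qed
  qed
  then have "emeasure lborel V = 0" using AE_iff_measurable[of V lborel "\<lambda>z. z \<notin> V"] VB by simp
  then have "V \<in> null_sets lborel" using VB by (simp add: null_setsI)
  then have "V \<in> null_sets lebesgue" by (rule null_sets_completionI)
  then have "negligible V" by (simp add: negligible_iff_null_sets)
  then show False using open_not_negligible[OF V(1)] V(3) by blast
qed

end

section \<open>Equality and geodesic spheres\<close>

text \<open>
  The Cauchy-Schwarz inequality in the plane, with its equality case.
\<close>

lemma extremal_split:
  fixes a b u v x :: real
  assumes ab: "a\<^sup>2 + b\<^sup>2 = 1" and x: "x\<^sup>2 = u\<^sup>2 + v\<^sup>2" "x \<ge> 0"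
  shows "a * u + b * v \<le> x" and "x = a * u + b * v \<Longrightarrow> u = a * x \<and> v = b * x"
proof -
  have id: "(a * u + b * v)\<^sup>2 + (a * v - b * u)\<^sup>2 = x\<^sup>2"
  proof -
    have "(a * u + b * v)\<^sup>2 + (a * v - b * u)\<^sup>2 = (a\<^sup>2 + b\<^sup>2) * (u\<^sup>2 + v\<^sup>2)"
      by (simp add: power2_eq_square algebra_simps)
    then show ?thesis using ab x by simp
  qed
  then have "(a * u + b * v)\<^sup>2 \<le> x\<^sup>2" using zero_le_power2[of "a * v - b * u"] by linarith
  then show "a * u + b * v \<le> x" using x(2) by (rule power2_le_imp_le)
  assume eq: "x = a * u + b * v"
  have "(a * v - b * u)\<^sup>2 = 0" using id unfolding eq[symmetric] by simp
  then have av: "a * v = b * u" by simp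
  have "a * x = a\<^sup>2 * u + b * (a * v)" by (simp add: eq power2_eq_square algebra_simps)
  also have "\<dots> = (a\<^sup>2 + b\<^sup>2) * u" by (simp add: av power2_eq_square algebra_simps)
  finally have 1: "a * x = u" using ab by simp
  have "b * x = a * (b * u) + b\<^sup>2 * v" by (simp add: eq power2_eq_square algebra_simps)
  also have "\<dots> = (a\<^sup>2 + b\<^sup>2) * v" unfolding av[symmetric] by (simp add: power2_eq_square algebra_simps)
  finally have "b * x = v" using ab by simp
  with 1 show "u = a * x \<and> v = b * x" by simp
qed

context normal_hypersurface
begin

lemma snd_squared_split:
  assumes "p \<in> S" shows "(snd p)\<^sup>2 = (w p)\<^sup>2 + \<bar>snd (\<nu> p)\<bar>\<^sup>2" "w p > 0"
proof -
  have "defect p (\<nu> p) > 0" using eucl_normal_props(1)[of p "\<nu> p"] \<nu>[OF assms] S assms by auto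
  then show "(snd p)\<^sup>2 = (w p)\<^sup>2 + \<bar>snd (\<nu> p)\<bar>\<^sup>2" "w p > 0" by (auto simp: w_def defect_def)
qed

lemma norm_critical_point:
  assumes sub: "submanifold TYPE('n) S" and p: "p \<in> S"
    and ext: "(\<forall>q\<in>S. norm (fst p) \<le> norm (fst q)) \<or> (\<forall>q\<in>S. norm (fst q) \<le> norm (fst p))"
  shows "norm (fst p) = \<bar>snd (\<nu> p)\<bar> / w p"
proof -
  obtain U \<phi> and x :: "real^'n" where \<phi>: "patch S U \<phi>" "x \<in> U" "p = \<phi> x" using patch_at[OF sub p] .
  have sq: "(0 - fst q) \<bullet> (0 - fst q) = (norm (fst q))\<^sup>2" for q :: "(real^'m) \<times> real"
    by (simp add: dot_square_norm)
  have "(\<forall>q\<in>S. (0 - fst (\<phi> x)) \<bullet> (0 - fst (\<phi> x)) \<le> (0 - fst q) \<bullet> (0 - fst q)) \<or>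
       (\<forall>q\<in>S. (0 - fst q) \<bullet> (0 - fst q) \<le> (0 - fst (\<phi> x)) \<bullet> (0 - fst (\<phi> x)))"
    unfolding sq using ext unfolding \<phi>(3) by (auto intro: power_mono)
  then have "0 - fst p = ((0 - fst p) \<bullet> N p) *\<^sub>R N p" unfolding \<phi>(3) by (rule critical_point_normal[OF \<phi>(1,2)])
  moreover have "norm (N p) = 1" using N_unit[OF \<phi>(1,2)] unfolding \<phi>(3) by (simp add: norm_eq_sqrt_inner)
  ultimately have "norm (0 - fst p) = \<bar>(0 - fst p) \<bullet> N p\<bar>" by (metis mult.right_neutral norm_scaleR real_norm_def)
  then have "norm (fst p) = \<bar>fst p \<bullet> N p\<bar>" by simp
  also have "\<dots> = \<bar>snd (\<nu> p)\<bar> / w p" using f_N[OF \<phi>(1,2)] pos(2)[OF \<phi>(1,2)] unfolding \<phi>(3) by (simp add: abs_divide)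
  finally show ?thesis .
qed

text \<open>
  The ratio is the absolute value of the support function, and at the points of largest and smallest
  norm the support function equals the norm up to sign.
\<close>

lemma constant_ratio_imp_sphere:
  assumes cS: "compact S" and sub: "submanifold TYPE('n) S"
    and c: "\<And>p. p \<in> S \<Longrightarrow> \<bar>snd (\<nu> p)\<bar> / w p = c" and q: "q \<in> S"
  shows "norm (fst q) = c"
proof -
  have cont: "continuous_on S (\<lambda>p. norm (fst p))" by (intro continuous_intros)
  have ne: "S \<noteq> {}" using q by blast
  obtain p1 where p1: "p1 \<in> S" "\<forall>q\<in>S. norm (fst q) \<le> norm (fst p1)"
    using continuous_attains_sup[OF cS ne cont] by blast
  obtain p2 where p2: "p2 \<in> S" "\<forall>q\<in>S. norm (fst p2) \<le> norm (fst q)"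
    using continuous_attains_inf[OF cS ne cont] by blast
  have "norm (fst p1) = c" "norm (fst p2) = c"
    using norm_critical_point[OF sub p1(1)] norm_critical_point[OF sub p2(1)] p1 p2 c by auto
  then show ?thesis using p1(2) p2(2) q by (metis order_antisym)
qed

end

text \<open>
  Neither the open ball nor the complement of the closed ball meets the frontier of \<open>D\<close>. Both are
  connected, the latter because the dimension is at least \<open>2\<close>; so the ball lies in \<open>D\<close>, and the
  unbounded complement is disjoint from it.
\<close>

lemma ball_if_frontier_subset_sphere:
  fixes D :: "'a::euclidean_space set"
  assumes D: "open D" "connected D" "bounded D" "0 \<in> D" and fr: "frontier D \<subseteq> sphere 0 c" and c: "c > 0"
    and dim: "DIM('a) \<ge> 2"
  shows "D = ball 0 c"
proof
  have "ball 0 c - D = {}"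
  proof (rule ccontr)
    assume "ball 0 c - D \<noteq> {}"
    moreover have "0 \<in> ball 0 c \<inter> D" using D(4) c by simp
    then have "ball 0 c \<inter> D \<noteq> {}" by blast
    ultimately have "ball 0 c \<inter> frontier D \<noteq> {}" by (intro connected_Int_frontier) auto
    then show False using fr by auto
  qed
  then show "ball 0 c \<subseteq> D" by blast
  have "- cball 0 c \<inter> D = {}"
  proof (rule ccontr)
    assume ne: "- cball 0 c \<inter> D \<noteq> {}"
    have "connected (- cball (0::'a) c)"
      using dim by (intro connected_complement_bounded_convex) auto
    moreover have "- cball (0::'a) c - D \<noteq> {}"
    proof
      assume "- cball (0::'a) c - D = {}"
      then have "UNIV \<subseteq> cball (0::'a) c \<union> D" by blast
      then have "bounded (UNIV :: 'a set)" using D(3) bounded_subset by (metis bounded_Un bounded_cball)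
      then show False by simp
    qed
    ultimately have "- cball 0 c \<inter> frontier D \<noteq> {}" using ne by (intro connected_Int_frontier) auto
    then show False using fr by auto
  qed
  then have "D \<subseteq> cball 0 c" by blast
  then have "D \<subseteq> interior (cball 0 c)" using D(1) by (rule interior_maximal)
  then show "D \<subseteq> ball 0 c" by simp
qed

lemma geodesic_sphere_eq_lift:
  assumes "r > 0"
  shows "geodesic_sphere hyp_origin r = lift ` sphere (0 :: 'a::real_inner) (sinh r)"
proof
  have sq: "1 + (sinh r)\<^sup>2 = (cosh r)\<^sup>2" by (simp add: cosh_square_eq)
  have cr: "cosh r > 0" "sinh r > 0" using assms by auto
  show "geodesic_sphere hyp_origin r \<subseteq> lift ` sphere (0 :: 'a) (sinh r)"
  proof
    fix q :: "'a \<times> real" assume "q \<in> geodesic_sphere hyp_origin r"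
    then have q: "q \<in> hyp_space" "hyp_dist hyp_origin q = r" by (auto simp: geodesic_sphere_def)
    then have "snd q = cosh r" using cosh_hyp_dist_origin[OF q(1)] by simp
    then have "fst q \<bullet> fst q = (sinh r)\<^sup>2" using hyp_space_snd(2)[OF q(1)] sq by simp
    then have "norm (fst q) = sinh r" using cr by (simp add: norm_eq_sqrt_inner)
    then have "fst q \<in> sphere 0 (sinh r)" by simp
    then have "lift (fst q) \<in> lift ` sphere 0 (sinh r)" by (rule imageI)
    then show "q \<in> lift ` sphere 0 (sinh r)" by (simp only: lift_fst[OF q(1)])
  qed
  show "lift ` sphere (0 :: 'a) (sinh r) \<subseteq> geodesic_sphere hyp_origin r"
  proof
    fix q :: "'a \<times> real" assume "q \<in> lift ` sphere 0 (sinh r)"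
    then obtain x where x: "q = lift x" "norm x = sinh r" by auto
    have "snd q = cosh r"
      using x(2) sq cr by (simp add: x(1) lift_def dot_square_norm)
    then show "q \<in> geodesic_sphere hyp_origin r"
      using assms by (simp add: geodesic_sphere_def x(1) lift_in_hyp_space hyp_dist_def hyp_origin_def mink_def arcosh_cosh_real)
  qed
qed

text \<open>
  A geodesic sphere of the hyperboloid around the origin is a horizontal Euclidean sphere of some
  radius \<open>s\<close>, on which the Lorentz form restricts to the Euclidean inner product.
\<close>

lemma scaled_sphere_patch:
  fixes \<phi> :: "real^'n::finite \<Rightarrow> real^'m::finite"
  assumes p: "patch (sphere 0 1) U \<phi>" and s: "s > 0" and c: "c = sqrt (1 + s\<^sup>2)"
  defines "\<Phi> \<equiv> (\<lambda>x. (s *\<^sub>R \<phi> x, c))"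
  shows "patch (lift ` sphere 0 s) U \<Phi>"
    "x \<in> U \<Longrightarrow> sqrt (gram_det mink \<Phi> x) = s ^ CARD('n) * sqrt (gram_det (\<bullet>) \<phi> x)"
proof -
  note U = patch_Ck1(1)[OF p]
  have C: "Ck_on 2 \<Phi> U"
    unfolding \<Phi>_def using p
    by (intro Ck_on_Pair U Ck_on_const Ck_on_compose_linear[of U 2 \<phi> "\<lambda>y. s *\<^sub>R y"] bounded_linear_scaleR_right)
       (simp_all add: patch_def)
  have d: "frechet_derivative \<Phi> (at x) = (\<lambda>v. (s *\<^sub>R frechet_derivative \<phi> (at x) v, 0))" if "x \<in> U" for x
  proof -
    have "(\<Phi> has_derivative (\<lambda>v. (s *\<^sub>R frechet_derivative \<phi> (at x) v, 0))) (at x)"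
      unfolding \<Phi>_def
      by (intro has_derivative_Pair has_derivative_const has_derivative_scaleR_right patch_has_derivative[OF p that])
    then show ?thesis using frechet_derivative_at by metis
  qed
  define \<Lambda> where "\<Lambda> q = (s *\<^sub>R q, c)" for q :: "real^'m"
  have \<Lambda>: "homeomorphism (sphere 0 1) (lift ` sphere 0 s) \<Lambda> (\<lambda>p. (1 / s) *\<^sub>R fst p)"
  proof (rule homeomorphismI)
    show "continuous_on (sphere 0 1) \<Lambda>" unfolding \<Lambda>_def[abs_def] by (intro continuous_intros)
    show "continuous_on (lift ` sphere 0 s) (\<lambda>p :: (real^'m) \<times> real. (1 / s) *\<^sub>R fst p)" by (intro continuous_intros)
    show "\<Lambda> ` sphere 0 1 \<subseteq> lift ` sphere 0 s"
    proof
      fix y assume "y \<in> \<Lambda> ` sphere 0 1"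
      then obtain q where q: "norm q = 1" "y = \<Lambda> q" by auto
      have "y = lift (s *\<^sub>R q)" using q s by (simp add: \<Lambda>_def lift_def c power2_eq_square dot_square_norm)
      moreover have "s *\<^sub>R q \<in> sphere 0 s" using q s by simp
      ultimately show "y \<in> lift ` sphere 0 s" by blast
    qed
    show "(\<lambda>p. (1 / s) *\<^sub>R fst p) ` lift ` sphere 0 s \<subseteq> (sphere 0 1 :: (real^'m) set)" using s by auto
    show "(1 / s) *\<^sub>R fst (\<Lambda> q) = q" if "q \<in> sphere 0 1" for q using s by (simp add: \<Lambda>_def)
    show "\<Lambda> ((1 / s) *\<^sub>R fst y) = y" if "y \<in> lift ` sphere 0 s" for y
      using that s by (auto simp: \<Lambda>_def lift_def c dot_square_norm)
  qed
  have \<Phi>\<Lambda>: "\<Phi> = \<Lambda> \<circ> \<phi>" by (simp add: \<Phi>_def \<Lambda>_def fun_eq_iff)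
  have sub: "\<phi> ` U \<subseteq> sphere 0 1" by (rule patch_image_subset[OF p])
  show pt: "patch (lift ` sphere 0 s) U \<Phi>"
    unfolding patch_def
  proof (intro conjI ballI U C)
    fix x assume x: "x \<in> U"
    have "inj (frechet_derivative \<phi> (at x))" using p x by (simp add: patch_def)
    then show "inj (frechet_derivative \<Phi> (at x))" using s unfolding d[OF x] by (simp add: inj_def)
  next
    show "openin (top_of_set (lift ` sphere 0 s)) (\<Phi> ` U)"
      using homeomorphism_imp_open_map[OF \<Lambda>, of "\<phi> ` U"] p by (simp add: patch_def \<Phi>\<Lambda> image_comp)
    obtain \<psi> where h: "homeomorphism U (\<phi> ` U) \<phi> \<psi>" using p by (auto simp: patch_def)
    have "homeomorphism (\<phi> ` U) (\<Lambda> ` \<phi> ` U) \<Lambda> (\<lambda>p. (1 / s) *\<^sub>R fst p)"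
      by (rule homeomorphism_of_subsets[OF \<Lambda> sub _ refl]) (use homeomorphism_image1[OF \<Lambda>] sub in blast)
    from homeomorphism_compose[OF h this]
    show "\<exists>\<psi>. homeomorphism U (\<Phi> ` U) \<Phi> \<psi>" by (auto simp: \<Phi>\<Lambda> image_comp)
  qed
  assume x: "x \<in> U"
  have "gram_det mink \<Phi> x = det (\<chi> i j. s\<^sup>2 * (\<chi> i j. frechet_derivative \<phi> (at x) (axis i 1) \<bullet> frechet_derivative \<phi> (at x) (axis j 1)) $ i $ j)"
    unfolding gram_det_def d[OF x] by (simp add: mink_def power2_eq_square mult.assoc)
  also have "\<dots> = (s\<^sup>2) ^ CARD('n) * gram_det (\<bullet>) \<phi> x" unfolding det_scale gram_det_def ..
  finally have "gram_det mink \<Phi> x = (s ^ CARD('n))\<^sup>2 * gram_det (\<bullet>) \<phi> x" by (simp add: power_mult[symmetric] mult.commute)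
  then show "sqrt (gram_det mink \<Phi> x) = s ^ CARD('n) * sqrt (gram_det (\<bullet>) \<phi> x)"
    using s by (simp add: real_sqrt_mult)
qed

lemma geodesic_sphere_weighted_area:
  fixes \<mu> :: "((real^'m::finite) \<times> real) measure" and \<sigma> :: "(real^'m) measure"
  assumes card: "CARD('m) = CARD('n::finite) + 1" and s: "s > 0"
    and rm: "riemannian_measure TYPE('n) mink (lift ` sphere 0 s) \<mu>"
    and rs: "riemannian_measure TYPE('n) (\<bullet>) (sphere 0 1) \<sigma>"
  shows "(\<integral>\<^sup>+p. ennreal (snd p) \<partial>\<mu>) = ennreal (sqrt (1 + s\<^sup>2) * s ^ CARD('n)) * emeasure \<sigma> (sphere 0 1)"
proof -
  obtain K U and \<phi> :: "nat \<Rightarrow> real^'n \<Rightarrow> real^'m" and C A where pc: "pieces (sphere 0 1) K U \<phi> C A"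
    using compact_submanifold_pieces[OF compact_sphere submanifold_sphere[OF card]] .
  define c where "c = sqrt (1 + s\<^sup>2)"
  define \<Phi> where "\<Phi> k x = (s *\<^sub>R \<phi> k x, c)" for k x
  have pk: "patch (sphere 0 1) (U k) (\<phi> k)" "A k \<subseteq> U k" if "k < K" for k using pc that by (auto simp: pieces_def)
  have pt: "patch (lift ` sphere 0 s) (U k) (\<Phi> k)"
    "\<And>x. x \<in> U k \<Longrightarrow> sqrt (gram_det mink (\<Phi> k) x) = s ^ CARD('n) * sqrt (gram_det (\<bullet>) (\<phi> k) x)" if "k < K" for k
    unfolding \<Phi>_def[abs_def]
    by (fact scaled_sphere_patch(1)[OF pk(1)[OF that] s c_def])
       (fact scaled_sphere_patch(2)[OF pk(1)[OF that] s c_def])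
  have inj: "inj (\<lambda>q :: real^'m. (s *\<^sub>R q, c))" using s by (simp add: inj_def)
  have im: "\<Phi> k ` X = (\<lambda>q. (s *\<^sub>R q, c)) ` \<phi> k ` X" for k X by (auto simp: \<Phi>_def)
  have lift_c: "lift (s *\<^sub>R q) = (s *\<^sub>R q, c)" if "norm q = 1" for q :: "real^'m"
    using that s by (simp add: lift_def c_def power2_eq_square dot_square_norm)
  have "(\<lambda>q. (s *\<^sub>R q, c)) ` sphere 0 1 = lift ` sphere (0 :: real^'m) s"
  proof -
    have "(\<lambda>q. (s *\<^sub>R q, c)) ` sphere 0 1 = (\<lambda>q. lift (s *\<^sub>R q)) ` sphere (0 :: real^'m) 1"
      by (rule image_cong) (simp_all add: lift_c)
    also have "\<dots> = lift ` ((\<lambda>q. s *\<^sub>R q) ` sphere 0 1)" by (simp add: image_image)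
    also have "(\<lambda>q. s *\<^sub>R q) ` sphere 0 1 = sphere (0 :: real^'m) s"
      using sphere_scale[of s "0 :: real^'m" 1] s by simp
    finally show ?thesis .
  qed
  moreover have "(\<Union>k<K. \<Phi> k ` A k) = (\<lambda>q. (s *\<^sub>R q, c)) ` (\<Union>k<K. \<phi> k ` A k)" by (simp only: im image_UN)
  ultimately have U: "(\<Union>k<K. \<Phi> k ` A k) = lift ` sphere 0 s" using pc by (simp add: pieces_def)
  have "disjoint_family_on (\<lambda>k. \<Phi> k ` A k) {..<K}"
    using pc unfolding pieces_def disjoint_family_on_def im by (simp add: image_Int[OF inj, symmetric])
  then have pc': "pieces (lift ` sphere 0 s) K U \<Phi> C A"
    unfolding pieces_def
  proof (intro conjI allI impI)
    fix k assume k: "k < K"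
    show "patch (lift ` sphere 0 s) (U k) (\<Phi> k)" by (rule pt(1)[OF k])
    show "compact (C k)" "C k \<subseteq> U k" "A k \<subseteq> C k" "A k \<in> sets borel" using pc k by (simp_all add: pieces_def)
  next
    show "(\<Union>k<K. \<Phi> k ` A k) = lift ` sphere 0 s" by (rule U)
  qed
  have cl: "closed (lift ` sphere (0 :: real^'m) s)"
    unfolding lift_def by (intro compact_imp_closed compact_continuous_image continuous_intros compact_sphere)
  have cs: "continuous_on (lift ` sphere (0 :: real^'m) s) snd" by (intro continuous_intros)
  have nn: "0 \<le> snd p" if "p \<in> lift ` sphere (0 :: real^'m) s" for p
  proof -
    have "p \<in> hyp_space" using that lift_in_hyp_space by blast
    then show ?thesis using hyp_space_snd(1)[of p] by simp
  qed
  have "(\<integral>\<^sup>+p. ennreal (snd p) \<partial>\<mu>) = (\<Sum>k<K. \<integral>\<^sup>+x\<in>A k. ennreal (snd (\<Phi> k x) * sqrt (gram_det mink (\<Phi> k) x)) \<partial>lborel)"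
    by (rule riemannian_measure_integral[OF rm cl pc' continuous_on_mink cs nn])
  also have "\<dots> = (\<Sum>k<K. ennreal (c * s ^ CARD('n)) * (\<integral>\<^sup>+x\<in>A k. ennreal (sqrt (gram_det (\<bullet>) (\<phi> k) x)) \<partial>lborel))"
  proof (rule sum.cong[OF refl])
    fix k assume "k \<in> {..<K}"
    then have k: "k < K" by simp
    have c0: "c * s ^ CARD('n) \<ge> 0" using s by (simp add: c_def)
    have Am: "A k \<in> sets borel" using pc k by (simp add: pieces_def)
    have "(\<lambda>x. indicator (A k) x * sqrt (gram_det (\<bullet>) (\<phi> k) x)) \<in> borel_measurable borel"
      by (rule borel_indicator_times_continuous_on[OF _ Am pk(2)[OF k]])
         (intro continuous_intros gram_det_continuous_on[OF pk(1)[OF k]] continuous_on_inner)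
    then have m: "(\<lambda>x. ennreal (indicator (A k) x * sqrt (gram_det (\<bullet>) (\<phi> k) x))) \<in> borel_measurable lborel" by simp
    have "(\<integral>\<^sup>+x\<in>A k. ennreal (snd (\<Phi> k x) * sqrt (gram_det mink (\<Phi> k) x)) \<partial>lborel) =
       (\<integral>\<^sup>+x. ennreal (c * s ^ CARD('n)) * ennreal (indicator (A k) x * sqrt (gram_det (\<bullet>) (\<phi> k) x)) \<partial>lborel)"
    proof (rule nn_integral_cong)
      fix x
      show "ennreal (snd (\<Phi> k x) * sqrt (gram_det mink (\<Phi> k) x)) * indicator (A k) x =
         ennreal (c * s ^ CARD('n)) * ennreal (indicator (A k) x * sqrt (gram_det (\<bullet>) (\<phi> k) x))"
      proof (cases "x \<in> A k")
        case True
        then have "x \<in> U k" using pk(2)[OF k] by blast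
        then have "snd (\<Phi> k x) * sqrt (gram_det mink (\<Phi> k) x) = (c * s ^ CARD('n)) * sqrt (gram_det (\<bullet>) (\<phi> k) x)"
          using pt(2)[OF k] by (simp add: \<Phi>_def)
        then show ?thesis using True c0 by (simp add: ennreal_mult')
      qed simp
    qed
    also have "\<dots> = ennreal (c * s ^ CARD('n)) * (\<integral>\<^sup>+x. ennreal (indicator (A k) x * sqrt (gram_det (\<bullet>) (\<phi> k) x)) \<partial>lborel)"
      by (rule nn_integral_cmult[OF m])
    also have "(\<integral>\<^sup>+x. ennreal (indicator (A k) x * sqrt (gram_det (\<bullet>) (\<phi> k) x)) \<partial>lborel) =
       (\<integral>\<^sup>+x\<in>A k. ennreal (sqrt (gram_det (\<bullet>) (\<phi> k) x)) \<partial>lborel)"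
    proof (rule nn_integral_cong)
      show "ennreal (indicator (A k) x * sqrt (gram_det (\<bullet>) (\<phi> k) x)) = ennreal (sqrt (gram_det (\<bullet>) (\<phi> k) x)) * indicator (A k) x" for x
        by (cases "x \<in> A k") simp_all
    qed
    finally show "(\<integral>\<^sup>+x\<in>A k. ennreal (snd (\<Phi> k x) * sqrt (gram_det mink (\<Phi> k) x)) \<partial>lborel) =
       ennreal (c * s ^ CARD('n)) * (\<integral>\<^sup>+x\<in>A k. ennreal (sqrt (gram_det (\<bullet>) (\<phi> k) x)) \<partial>lborel)" .
  qed
  also have "\<dots> = ennreal (c * s ^ CARD('n)) * emeasure \<sigma> (sphere 0 1)"
    unfolding sphere_measure_le(1)[OF card rs pc] sum_distrib_left ..
  finally show ?thesis by (simp add: c_def)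
qed

text \<open>
  This matches the isoperimetric bound with the powers in the theorem, for the value \<open>(n + 1) B\<close> of
  the sphere's area and \<open>(n + 1) d\<close> of the weighted volume.
\<close>

lemma isoperimetric_constant_squared:
  fixes n :: nat and B d :: real
  assumes B: "B > 0" and d: "d > 0"
  defines "m \<equiv> Suc n"
  shows "(real m * root m B * root m d ^ n)\<^sup>2 =
    (real m * B) powr (2 / (real n + 1)) * (real m * d) powr (2 * real n / (real n + 1))"
proof -
  have m: "real m = real n + 1" "m > 0" by (simp_all add: m_def)
  have e: "2 / real m + 2 * real n / real m = 2" using m(2) by (simp add: add_divide_distrib[symmetric] m(1)) (simp add: field_simps)
  have "(real m * B) powr (2 / real m) * (real m * d) powr (2 * real n / real m) =
     (real m powr (2 / real m) * real m powr (2 * real n / real m)) * (B powr (2 / real m)) * (d powr (2 * real n / real m))"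
    using B d by (simp add: powr_mult mult_ac)
  also have "real m powr (2 / real m) * real m powr (2 * real n / real m) = (real m)\<^sup>2"
    unfolding powr_add[symmetric] e using m(2) by (simp add: powr_numeral)
  also have "B powr (2 / real m) = (root m B)\<^sup>2"
    using B m(2) by (simp add: root_powr_inverse powr_power mult.commute)
  also have "d powr (2 * real n / real m) = (root m d ^ n)\<^sup>2"
    using d m(2) by (simp add: root_powr_inverse powr_power power_mult[symmetric] mult_ac)
  finally show ?thesis by (simp add: m(1) power_mult_distrib)
qed

section \<open>The weighted Minkowski inequality\<close>

lemma horo_convex_normal:
  fixes \<Sigma> \<Omega> :: "((real^'m::finite) \<times> real) set"
  assumes card: "CARD('m) = CARD('n::finite) + 1" and hyp: "\<Sigma> \<subseteq> hyp_space" and horo: "horo_convex TYPE('n) \<Sigma> \<Omega>"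
  obtains \<nu> where "normal_hypersurface TYPE('n) \<Sigma> \<nu>"
proof -
  obtain \<nu> where \<nu>: "outward_unit_normal TYPE('n) \<Sigma> \<Omega> \<nu>" using horo unfolding horo_convex_def by blast
  have "normal_hypersurface TYPE('n) \<Sigma> \<nu>"
  proof
    show "Ck_on 1 (\<nu> \<circ> \<phi>) U" if "patch \<Sigma> U \<phi>" for U :: "(real^'n) set" and \<phi>
      using \<nu> that unfolding outward_unit_normal_def by blast
    show "mink (\<nu> p) p = 0 \<and> mink (\<nu> p) (\<nu> p) = 1" if "p \<in> \<Sigma>" for p
      using \<nu> that unfolding outward_unit_normal_def by blast
    fix U :: "(real^'n) set" and \<phi> x v assume p: "patch \<Sigma> U \<phi>" "x \<in> U"
    then have "\<phi> x \<in> \<Sigma>" using patch_image_subset[OF p(1)] by blast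
    moreover have "frechet_derivative \<phi> (at x) v \<in> tangent_space TYPE('n) \<Sigma> (\<phi> x)"
      using p unfolding tangent_space_def by blast
    ultimately show "mink (\<nu> (\<phi> x)) (frechet_derivative \<phi> (at x) v) = 0"
      using \<nu> unfolding outward_unit_normal_def by blast
  qed (use card hyp in auto)
  then show thesis by (rule that)
qed

text \<open>
  The inequality with the sphere's area replaced by \<open>m\<close> times the volume of the unit ball. In the case of
  equality the integrand of the Cauchy-Schwarz deficit vanishes identically, which makes the support
  function constant.
\<close>

lemma weighted_minkowski_inequality:
  fixes \<Sigma> :: "((real^'m::finite) \<times> real) set" and \<mu> :: "((real^'m) \<times> real) measure"
  assumes nh: "normal_hypersurface TYPE('n::finite) \<Sigma> \<nu>"
    and cS: "compact \<Sigma>" and sub: "submanifold TYPE('n) \<Sigma>" and rm: "riemannian_measure TYPE('n) mink \<Sigma> \<mu>"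
    and D: "open D" "bounded D" "D \<noteq> {}" "frontier D = fst ` \<Sigma>"
  defines "V \<equiv> real CARD('m) * measure lebesgue D"
    and "P \<equiv> real CARD('m) * root CARD('m) (measure lebesgue (ball (0 :: real^'m) 1)) * root CARD('m) (measure lebesgue D) ^ CARD('n)"
  shows "sqrt (V\<^sup>2 + P\<^sup>2) \<le> (LINT p|\<mu>. snd p)"
    and "(LINT p|\<mu>. snd p) = sqrt (V\<^sup>2 + P\<^sup>2) \<Longrightarrow> \<exists>c>0. \<forall>p\<in>\<Sigma>. norm (fst p) = c"
proof -
  interpret normal_hypersurface \<Sigma> \<nu> "TYPE('n)" by (rule nh)
  have m: "CARD('m) - 1 = CARD('n)" using card by simp
  have Dpos: "measure lebesgue D > 0" by (rule open_measure_pos[OF D(1-3)])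
  have Bpos: "measure lebesgue (ball (0 :: real^'m) 1) > 0" by (rule open_measure_pos) auto
  have V: "V > 0" using Dpos by (simp add: V_def)
  have P: "P > 0" using Dpos Bpos by (simp add: P_def)
  define R where "R = sqrt (V\<^sup>2 + P\<^sup>2)"
  have R2: "R\<^sup>2 = V\<^sup>2 + P\<^sup>2" by (simp add: R_def)
  have R: "R > 0" using V by (auto simp: R_def intro!: add_pos_nonneg)
  \<comment> \<open>The coefficients for which the lower bound \<open>a P + b V\<close> is largest.\<close>
  define a where "a = P / R"
  define b where "b = V / R"
  have ab: "a > 0" "b > 0" "a\<^sup>2 + b\<^sup>2 = 1"
    using R V P R2 by (auto simp: a_def b_def power_divide add_divide_distrib[symmetric] add.commute)
  have split: "(snd p)\<^sup>2 = (w p)\<^sup>2 + \<bar>snd (\<nu> p)\<bar>\<^sup>2" "w p > 0" "snd p \<ge> 0" if "p \<in> \<Sigma>" for p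
    using snd_squared_split[OF that] hyp_space_snd(1)[of p] S that by auto
  have cont: "continuous_on \<Sigma> (\<lambda>p. snd p)" "continuous_on \<Sigma> w" "continuous_on \<Sigma> (\<lambda>p. \<bar>snd (\<nu> p)\<bar>)"
    by (intro continuous_intros nu_continuous_on[OF sub] w_continuous_on[OF sub])+
  note int = compact_continuous_integral[OF rm cS sub]
  have flux: "V \<le> (LINT p|\<mu>. \<bar>snd (\<nu> p)\<bar>)"
    using position_flux_ge_volume[OF cS sub rm D(1,2,4)] int(2)[OF cont(3)]
    by (simp add: V_def integral_nonneg_AE)
  have area: "P \<le> (LINT p|\<mu>. w p)"
  proof -
    have "(\<integral>\<^sup>+p. ennreal (w p) \<partial>\<mu>) = ennreal (LINT p|\<mu>. w p)"
      using split(2) by (intro int(2)[OF cont(2)]) (simp add: less_imp_le)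
    then have "ennreal P \<le> ennreal (LINT p|\<mu>. w p)"
      using area_ge_isoperimetric[OF cS sub rm D] unfolding m P_def by simp
    then show ?thesis using P by (simp add: ennreal_le_iff2)
  qed
  define h where "h p = snd p - (a * w p + b * \<bar>snd (\<nu> p)\<bar>)" for p
  have h0: "0 \<le> h p" if "p \<in> \<Sigma>" for p
    using extremal_split(1)[OF ab(3) split(1,3)[OF that]] by (simp add: h_def)
  have hc: "continuous_on \<Sigma> h"
    unfolding h_def[abs_def] by (intro continuous_on_diff continuous_on_add continuous_on_mult continuous_on_const cont)
  have "(LINT p|\<mu>. h p) = (LINT p|\<mu>. snd p) - (a * (LINT p|\<mu>. w p) + b * (LINT p|\<mu>. \<bar>snd (\<nu> p)\<bar>))"
    unfolding h_def using int(1)[OF cont(1)] int(1)[OF cont(2)] int(1)[OF cont(3)] by simp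
  moreover have hI: "0 \<le> (LINT p|\<mu>. h p)"
    using rm by (intro integral_nonneg_AE AE_I2) (simp add: h0 riemannian_measure_def)
  moreover have "a * P + b * V \<le> a * (LINT p|\<mu>. w p) + b * (LINT p|\<mu>. \<bar>snd (\<nu> p)\<bar>)"
    using ab flux area by (intro add_mono mult_left_mono) auto
  moreover have "a * P + b * V = R"
  proof -
    have "a * P + b * V = R\<^sup>2 / R" unfolding R2 by (simp add: a_def b_def add_divide_distrib power2_eq_square)
    then show ?thesis using R by (simp add: power2_eq_square)
  qed
  ultimately have lower: "R + (LINT p|\<mu>. h p) \<le> (LINT p|\<mu>. snd p)" by linarith
  then show "sqrt (V\<^sup>2 + P\<^sup>2) \<le> (LINT p|\<mu>. snd p)" using hI by (simp add: R_def)
  assume "(LINT p|\<mu>. snd p) = sqrt (V\<^sup>2 + P\<^sup>2)"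
  then have hz: "(LINT p|\<mu>. h p) = 0" using lower hI by (simp add: R_def)
  have ratio: "\<bar>snd (\<nu> p)\<bar> / w p = b / a" if p: "p \<in> \<Sigma>" for p
  proof -
    have "h p = 0" by (rule continuous_nonneg_integral_zero[OF cS sub rm hc h0 hz p])
    then have "w p = a * snd p \<and> \<bar>snd (\<nu> p)\<bar> = b * snd p"
      using extremal_split(2)[OF ab(3) split(1,3)[OF p]] by (simp add: h_def)
    moreover have "snd p > 0" using hyp_space_snd(1) S p by blast
    ultimately show ?thesis by simp
  qed
  show "\<exists>c>0. \<forall>p\<in>\<Sigma>. norm (fst p) = c"
    using constant_ratio_imp_sphere[OF cS sub ratio] ab by (intro exI[of _ "b / a"]) simp
qed

theorem theorem1p6:
  fixes n :: nat
    and \<Sigma> \<Omega> :: "((real^'m) \<times> real) set"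
    and \<mu> N :: "((real^'m) \<times> real) measure"
    and \<sigma> :: "(real^'m) measure"
  assumes "CARD('n::finite) = n" and "CARD('m) = n + 1"
    and "closed_hypersurface TYPE('n) \<Sigma>"
    and "encloses \<Sigma> \<Omega>"
    and "horo_convex TYPE('n) \<Sigma> \<Omega>"
    and "hyp_origin \<in> \<Omega>"
    and "riemannian_measure TYPE('n) mink \<Sigma> \<mu>"
    and "riemannian_measure TYPE('m) mink hyp_space N"
    and "riemannian_measure TYPE('n) (\<bullet>) (sphere 0 1) \<sigma>"
  shows "let dlam = (\<lambda>p. cosh (hyp_dist hyp_origin p));
             I = (LINT p|\<mu>. dlam p);
             V = (real n + 1) * (LINT p:\<Omega>|N. dlam p);
             \<omega> = measure \<sigma> (sphere 0 1);
             R = sqrt (V\<^sup>2 + \<omega> powr (2 / (real n + 1)) * V powr (2 * real n / (real n + 1)))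
         in I \<ge> R \<and> (I = R \<longleftrightarrow> (\<exists>r>0. \<Sigma> = geodesic_sphere hyp_origin r))"
proof -
  let ?dlam = "\<lambda>p :: (real^'m) \<times> real. cosh (hyp_dist hyp_origin p)"
  have card: "CARD('m) = CARD('n) + 1" using assms(1,2) by simp
  have mn: "real CARD('m) = real n + 1" using assms(2) by simp
  have hyp: "\<Sigma> \<subseteq> hyp_space" and cS: "compact \<Sigma>" and sub: "submanifold TYPE('n) \<Sigma>"
    using assms(3) by (auto simp: closed_hypersurface_def)
  obtain \<nu> where nh: "normal_hypersurface TYPE('n) \<Sigma> \<nu>"
    using horo_convex_normal[OF card hyp assms(5)] .
  define D where "D = fst ` \<Omega>"
  have D: "open D" "bounded D" "connected D" "frontier D = fst ` \<Sigma>" and \<Omega>: "\<Omega> \<subseteq> hyp_space"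
    using encloses_projection[OF assms(4)] by (simp_all add: D_def)
  have D0: "0 \<in> D" using assms(6) by (force simp: D_def hyp_origin_def)
  then have Dne: "D \<noteq> {}" by blast
  define I where "I = (LINT p|\<mu>. ?dlam p)"
  define V where "V = (real n + 1) * (LINT p:\<Omega>|N. ?dlam p)"
  define \<omega> where "\<omega> = measure \<sigma> (sphere 0 1)"
  define R where "R = sqrt (V\<^sup>2 + \<omega> powr (2 / (real n + 1)) * V powr (2 * real n / (real n + 1)))"
  define B where "B = measure lebesgue (ball (0 :: real^'m) 1)"
  define P where "P = real CARD('m) * root CARD('m) B * root CARD('m) (measure lebesgue D) ^ CARD('n)"
  have Dpos: "measure lebesgue D > 0" by (rule open_measure_pos[OF D(1,2) Dne])
  have Bpos: "B > 0" unfolding B_def by (rule open_measure_pos) auto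
  have VD: "V = real CARD('m) * measure lebesgue D"
    using weighted_volume_eq_lebesgue[OF assms(8) \<Omega>] D(1,2) by (simp add: V_def mn D_def)
  have Vpos: "V > 0" using Dpos by (simp add: VD)
  have I_snd: "I = (LINT p|\<mu>. snd p)"
    unfolding I_def
  proof (rule Bochner_Integration.integral_cong[OF refl])
    fix p assume "p \<in> space \<mu>"
    then have "p \<in> hyp_space" using assms(7) hyp by (auto simp: riemannian_measure_def)
    then show "?dlam p = snd p" by (rule cosh_hyp_dist_origin)
  qed
  have sig: "emeasure \<sigma> (sphere 0 1) \<le> ennreal (real CARD('m) * B)"
  proof -
    obtain K U and \<phi> :: "nat \<Rightarrow> real^'n \<Rightarrow> real^'m" and C A where pc: "pieces (sphere 0 1) K U \<phi> C A"
      using compact_submanifold_pieces[OF compact_sphere submanifold_sphere[OF card]] .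
    show ?thesis unfolding B_def by (rule sphere_measure_le(2)[OF card assms(9) pc])
  qed
  have sig_eq: "emeasure \<sigma> (sphere 0 1) = ennreal \<omega>"
    unfolding \<omega>_def using sig by (intro emeasure_eq_ennreal_measure) (auto simp: top_unique)
  have \<omega>: "0 \<le> \<omega>" "\<omega> \<le> real CARD('m) * B"
    using sig Bpos unfolding sig_eq by (auto simp: \<omega>_def)
  have P2: "P\<^sup>2 = (real CARD('m) * B) powr (2 / (real n + 1)) * V powr (2 * real n / (real n + 1))"
    using isoperimetric_constant_squared[OF Bpos Dpos, of n] unfolding P_def VD assms(1) assms(2) by simp
  have "\<omega> powr (2 / (real n + 1)) * V powr (2 * real n / (real n + 1)) \<le> P\<^sup>2"
    unfolding P2 using \<omega> by (intro mult_right_mono powr_mono2) auto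
  then have R_le: "R \<le> sqrt (V\<^sup>2 + P\<^sup>2)" by (simp add: R_def)
  note main = weighted_minkowski_inequality[OF nh cS sub assms(7) D(1,2) Dne D(4), folded B_def, folded P_def VD I_snd]
  have ge: "I \<ge> R" using main(1) R_le by linarith
  have sphere_radius: "\<Sigma> = lift ` sphere 0 s \<and> D = ball 0 s" if s: "s > 0" and Ss: "\<And>p. p \<in> \<Sigma> \<Longrightarrow> norm (fst p) = s" for s
  proof -
    have "frontier D \<subseteq> sphere 0 s" using D(4) Ss by auto
    then have Db: "D = ball 0 s"
      by (rule ball_if_frontier_subset_sphere[OF D(1,3,2) D0 _ s]) (use card in \<open>simp add: Suc_le_eq\<close>)
    then have "fst ` \<Sigma> = sphere 0 s" using D(4) s by (simp add: frontier_ball)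
    moreover have "lift ` fst ` \<Sigma> = \<Sigma>"
    proof -
      have "(\<lambda>p. lift (fst p)) ` \<Sigma> = (\<lambda>p. p) ` \<Sigma>"
        by (rule image_cong[OF refl]) (use hyp lift_fst in blast)
      then show ?thesis unfolding image_image by simp
    qed
    ultimately show ?thesis using Db by simp
  qed
  have "I = R \<longleftrightarrow> (\<exists>r>0. \<Sigma> = geodesic_sphere hyp_origin r)"
  proof
    assume "I = R"
    then have "I = sqrt (V\<^sup>2 + P\<^sup>2)" using main(1) R_le by linarith
    then obtain s where s: "s > 0" "\<And>p. p \<in> \<Sigma> \<Longrightarrow> norm (fst p) = s" using main(2) by blast
    have "\<Sigma> = geodesic_sphere hyp_origin (arsinh s)"
      using sphere_radius[OF s] geodesic_sphere_eq_lift[where r = "arsinh s" and 'a = "real^'m"] s(1) by simp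
    then show "\<exists>r>0. \<Sigma> = geodesic_sphere hyp_origin r" using s(1) by (intro exI[of _ "arsinh s"]) simp
  next
    assume "\<exists>r>0. \<Sigma> = geodesic_sphere hyp_origin r"
    then obtain r where r: "r > 0" "\<Sigma> = geodesic_sphere hyp_origin r" by blast
    define s where "s = sinh r"
    have s: "s > 0" using r(1) by (simp add: s_def)
    have \<Sigma>s: "\<Sigma> = lift ` sphere 0 s" using geodesic_sphere_eq_lift[OF r(1)] r(2) by (simp add: s_def)
    have "norm (fst p) = s" if "p \<in> \<Sigma>" for p using that unfolding \<Sigma>s by auto
    then have Db: "D = ball 0 s" using sphere_radius[OF s] by blast
    have Vs: "V = s ^ CARD('m) * (real CARD('m) * B)"
      using content_ball_conv_unit_ball[of s "0 :: real^'m"] s by (simp add: VD Db B_def)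
    have "(\<integral>\<^sup>+p. ennreal (snd p) \<partial>\<mu>) = ennreal (LINT p|\<mu>. snd p)"
    proof (rule compact_continuous_integral(2)[OF assms(7) cS sub])
      show "0 \<le> snd p" if "p \<in> \<Sigma>" for p using hyp_space_snd(1)[of p] that hyp by auto
    qed (intro continuous_intros)
    then have "ennreal I = ennreal (sqrt (1 + s\<^sup>2) * s ^ n) * ennreal \<omega>"
      using geodesic_sphere_weighted_area[OF card s assms(7)[unfolded \<Sigma>s] assms(9)]
      by (simp add: I_snd sig_eq assms(1))
    then have "ennreal I = ennreal (sqrt (1 + s\<^sup>2) * s ^ n * \<omega>)" using s \<omega> by (simp add: ennreal_mult)
    moreover have "I \<ge> 0" using ge by (rule order_trans[rotated]) (simp add: R_def)
    ultimately have Is: "I = sqrt (1 + s\<^sup>2) * s ^ n * \<omega>" using s \<omega> by simp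
    have sw: "0 \<le> s ^ CARD('m) * \<omega>" using s \<omega> by simp
    have Vge: "s ^ CARD('m) * \<omega> \<le> V" unfolding Vs using s \<omega> by (intro mult_left_mono) auto
    have "(\<omega> * s ^ n)\<^sup>2 = \<omega> powr (2 / (real n + 1)) * (s ^ CARD('m) * \<omega>) powr (2 * real n / (real n + 1))"
    proof (cases "\<omega> = 0")
      case False
      then have w: "\<omega> > 0" using \<omega> by simp
      have e: "2 / (real n + 1) + 2 * real n / (real n + 1) = 2"
        by (simp add: add_divide_distrib[symmetric]) (simp add: field_simps)
      have "(s ^ CARD('m)) powr (2 * real n / (real n + 1)) = s powr ((real n + 1) * (2 * real n / (real n + 1)))"
        using s by (simp add: powr_powr mn flip: powr_realpow)
      also have "(real n + 1) * (2 * real n / (real n + 1)) = real (2 * n)" by simp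
      also have "s powr real (2 * n) = s ^ (2 * n)" using s by (rule powr_realpow)
      finally have "\<omega> powr (2 / (real n + 1)) * (s ^ CARD('m) * \<omega>) powr (2 * real n / (real n + 1)) =
          s ^ (2 * n) * (\<omega> powr (2 / (real n + 1)) * \<omega> powr (2 * real n / (real n + 1)))"
        using s w by (simp add: powr_mult)
      also have "\<dots> = s ^ (2 * n) * \<omega>\<^sup>2" unfolding powr_add[symmetric] e using w by (simp add: powr_numeral)
      finally show ?thesis by (simp add: power_mult_distrib power_mult[symmetric] mult.commute)
    qed simp
    also have "\<dots> \<le> \<omega> powr (2 / (real n + 1)) * V powr (2 * real n / (real n + 1))"
      using Vge sw by (intro mult_left_mono powr_mono2) auto
    finally have 1: "(\<omega> * s ^ n)\<^sup>2 \<le> \<omega> powr (2 / (real n + 1)) * V powr (2 * real n / (real n + 1))" .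
    have 2: "(s ^ CARD('m) * \<omega>)\<^sup>2 \<le> V\<^sup>2" using Vge sw by (rule power_mono)
    have "I\<^sup>2 = (1 + s\<^sup>2) * (\<omega> * s ^ n)\<^sup>2" using s by (simp add: Is power_mult_distrib mult_ac)
    also have "\<dots> = (\<omega> * s ^ n)\<^sup>2 + (s ^ CARD('m) * \<omega>)\<^sup>2"
      unfolding assms(2) by (simp add: power2_eq_square algebra_simps)
    also have "\<dots> \<le> V\<^sup>2 + \<omega> powr (2 / (real n + 1)) * V powr (2 * real n / (real n + 1))" using 1 2 by linarith
    finally have "I \<le> R" unfolding R_def by (rule real_le_rsqrt)
    then show "I = R" using ge by simp
  qed
  with ge show ?thesis unfolding Let_def I_def V_def \<omega>_def R_def by blast
qed

end
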